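(* Let $d\ge 1$ and let $f\in \mathcal S_{1/2}'(\mathbf R^d)$ be a Gelfand-Shilov distribution with Bargmann transform $\mathfrak V f$. Then the following conditions are equivalent: (1) $f$ is radial symmetric, i.e. $U^*f=f$ for every unitary transformation $U$ on $\mathbf R^d$; (2) if $U$ is a unitary transformation on $\mathbf R^d$, then $(\mathfrak V f)(Uz)=(\mathfrak V f)(z)$ for all $z\in\mathbf C^d$; (3) there is an entire function $F_0$ on $\mathbf C$ such that $(\mathfrak V f)(z)=F_0(\langle z,z\rangle)$ for all $z\in\mathbf C^d$; (4) $(f,h_\alpha)=0$ for every $\alpha=(\alpha_1,\dots,\alpha_d)\in\mathbf N^d$ such that at least one $\alpha_j$ is odd, and $$\frac{\alpha!}{\sqrt{(2\alpha)!}}\,(f,h_{2\alpha})=\frac{\beta!}{\sqrt{(2\beta)!}}\,(f,h_{2\beta})$$ for all $\alpha,\beta\in\mathbf N^d$ with $|\alpha|=|\beta|$.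
   Context: $\mathbf N=\{0,1,2,\dots\}$; standard multi-index notation is used, so $|\alpha|=\alpha_1+\cdots+\alpha_d$ and $\alpha!=\alpha_1!\cdots\alpha_d!$. Gelfand-Shilov space: for $h>0$, $\mathcal S_{1/2,h}^{1/2}(\mathbf R^d)$ is the Banach space of all $f\in C^\infty(\mathbf R^d)$ such that $$\|f\|_{\mathcal S_{1/2,h}^{1/2}}=\sup_{\alpha,\beta\in\mathbf N^d}\ \sup_{x\in\mathbf R^d}\frac{|x^\beta\partial^\alpha f(x)|}{h^{|\alpha|+|\beta|}(\alpha!)^{1/2}(\beta!)^{1/2}}<\infty.$$ $\mathcal S_{1/2}(\mathbf R^d)=\bigcup_{h>0}\mathcal S_{1/2,h}^{1/2}(\mathbf R^d)$ with the inductive limit topology, and $\mathcal S_{1/2}'(\mathbf R^d)$ is its (topological) dual; it contains the tempered distributions $\mathscr S'(\mathbf R^d)$. For $z,w\in\mathbf C^d$, $\langle z,w\rangle=\sum_{j=1}^d z_jw_j$ (bilinear, no complex conjugation). When applied to a distribution and a test function, $\langle\cdot,\cdot\rangle$ is the bilinear dual pairing. Bargmann transform: for $f\in\mathcal S_{1/2}'(\mathbf R^d)$, $\mathfrak V f$ is the entire function on $\mathbf C^d$ given by $(\mathfrak V f)(z)=\langle f,\mathfrak A_d(z,\cdot)\rangle$, where $$\mathfrak A_d(z,y)=\pi^{-d/4}\exp\Big(-\tfrac12(\langle z,z\rangle+|y|^2)+2^{1/2}\langle z,y\rangle\Big),\qquad z\in\mathbf C^d,\ y\in\mathbf R^d.$$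 A unitary transformation $U$ on $\mathbf R^d$ is a linear isometry of $\mathbf R^d$ (real orthogonal map). For $z=x+iy$ with $x,y\in\mathbf R^d$, $Uz=Ux+iUy$. The pullback $U^*f$ is $f\circ U$ when $f$ is a function, and in general $\langle U^*f,\varphi\rangle=\langle f,\varphi\circ U^{-1}\rangle$ for $\varphi\in\mathcal S_{1/2}(\mathbf R^d)$. Hermite functions: $h_\alpha(x)=\pi^{-d/4}(-1)^{|\alpha|}(2^{|\alpha|}\alpha!)^{-1/2}e^{|x|^2/2}(\partial^\alpha e^{-|x|^2})$ for $\alpha\in\mathbf N^d$; they belong to $\mathcal S_{1/2}(\mathbf R^d)$ and form an orthonormal basis of $L^2(\mathbf R^d)$. $(f,h_\alpha)$ denotes the extension of the $L^2(\mathbf R^d)$ scalar product to $\mathcal S_{1/2}'\times\mathcal S_{1/2}$, i.e. $(f,h_\alpha)=\langle f,\overline{h_\alpha}\rangle=\langle f,h_\alpha\rangle$. *)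

theory Defs
  imports "HOL-Analysis.Analysis"
begin

text \<open>
  The dimension is \<open>d = CARD('n)\<close> for a finite type \<open>'n\<close> of coordinates (so \<open>d \<ge> 1\<close>);
  a multi-index is a function \<open>'n \<Rightarrow> nat\<close>.
\<close>

definition mi_abs :: "('n::finite \<Rightarrow> nat) \<Rightarrow> nat" where
  "mi_abs \<alpha> = (\<Sum>j\<in>UNIV. \<alpha> j)"

definition mi_fact :: "('n::finite \<Rightarrow> nat) \<Rightarrow> real" where
  "mi_fact \<alpha> = (\<Prod>j\<in>UNIV. fact (\<alpha> j))"

definition mi_power :: "real ^ 'n::finite \<Rightarrow> ('n \<Rightarrow> nat) \<Rightarrow> real" where
  "mi_power x \<beta> = (\<Prod>j\<in>UNIV. (x $ j) ^ \<beta> j)"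

definition partial_deriv :: "'n::finite \<Rightarrow> (real ^ 'n \<Rightarrow> complex) \<Rightarrow> real ^ 'n \<Rightarrow> complex" where
  "partial_deriv j f x = vector_derivative (\<lambda>t. f (x + t *\<^sub>R axis j 1)) (at 0)"

text \<open>
  \<open>C\<^sup>\<infinity>\<close>: all iterated partial derivatives, in any order, exist and are (Frechet) differentiable,
  hence continuous.
\<close>

definition smooth :: "(real ^ 'n::finite \<Rightarrow> complex) \<Rightarrow> bool" where
  "smooth f \<longleftrightarrow> (\<forall>js. foldr partial_deriv js f differentiable_on UNIV)"

text \<open>
  The type \<open>'n\<close> carries no order, so an enumeration of the coordinates is chosen.
  For smooth functions its choice does not affect \<open>mi_deriv\<close>, as partial derivatives commute.
\<close>

definition coords :: "'n::finite list" where
  "coords = (SOME js. distinct js \<and> set js = UNIV)"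

definition mi_deriv :: "('n::finite \<Rightarrow> nat) \<Rightarrow> (real ^ 'n \<Rightarrow> complex) \<Rightarrow> real ^ 'n \<Rightarrow> complex" where
  "mi_deriv \<alpha> f = foldr (\<lambda>j. partial_deriv j ^^ \<alpha> j) coords f"

definition gs_norm :: "real \<Rightarrow> (real ^ 'n::finite \<Rightarrow> complex) \<Rightarrow> ennreal" where
  "gs_norm h f = (SUP \<alpha>. SUP \<beta>. SUP x.
     ennreal (cmod (of_real (mi_power x \<beta>) * mi_deriv \<alpha> f x) /
       (h ^ (mi_abs \<alpha> + mi_abs \<beta>) * sqrt (mi_fact \<alpha>) * sqrt (mi_fact \<beta>))))"

definition gs_banach :: "real \<Rightarrow> (real ^ 'n::finite \<Rightarrow> complex) set" where
  "gs_banach h = {f. smooth f \<and> gs_norm h f < \<infinity>}"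

definition gs_space :: "(real ^ 'n::finite \<Rightarrow> complex) set" where
  "gs_space = (\<Union>h\<in>{0<..}. gs_banach h)"

text \<open>
  The (locally convex) inductive limit topology: a base of neighbourhoods of \<open>0\<close> consists of the
  absolutely convex sets whose intersection with each Banach space \<open>gs_banach h\<close>
  is a neighbourhood of \<open>0\<close> there.
\<close>

definition abs_convex :: "('a \<Rightarrow> complex) set \<Rightarrow> bool" where
  "abs_convex V \<longleftrightarrow> (\<forall>f\<in>V. \<forall>g\<in>V. \<forall>a b. cmod a + cmod b \<le> 1 \<longrightarrow> (\<lambda>x. a * f x + b * g x) \<in> V)"

definition gs_nhd0 :: "(real ^ 'n::finite \<Rightarrow> complex) set \<Rightarrow> bool" where
  "gs_nhd0 V \<longleftrightarrow> V \<subseteq> gs_space \<and> abs_convex V \<and>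
     (\<forall>h>0. \<exists>\<epsilon>>0. {f \<in> gs_banach h. gs_norm h f < ennreal \<epsilon>} \<subseteq> V)"

definition gs_open :: "(real ^ 'n::finite \<Rightarrow> complex) set \<Rightarrow> bool" where
  "gs_open W \<longleftrightarrow> W \<subseteq> gs_space \<and>
     (\<forall>f\<in>W. \<exists>V. gs_nhd0 V \<and> (\<forall>g\<in>V. (\<lambda>x. f x + g x) \<in> W))"

definition gs_topology :: "(real ^ 'n::finite \<Rightarrow> complex) topology" where
  "gs_topology = topology gs_open"

lemma gs_nhd0_Int:
  assumes "gs_nhd0 V" "gs_nhd0 W"
  shows "gs_nhd0 (V \<inter> W)"
  unfolding gs_nhd0_def
proof (intro conjI allI impI)
  show "V \<inter> W \<subseteq> gs_space" "abs_convex (V \<inter> W)"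
    using assms by (auto simp: gs_nhd0_def abs_convex_def)
  fix h :: real assume "h > 0"
  then obtain d e where de: "d > 0" "e > 0"
      "{f \<in> gs_banach h. gs_norm h f < ennreal d} \<subseteq> V"
      "{f \<in> gs_banach h. gs_norm h f < ennreal e} \<subseteq> W"
    using assms unfolding gs_nhd0_def by meson
  have "{f \<in> gs_banach h. gs_norm h f < ennreal (min d e)} \<subseteq> V \<inter> W"
    using de(3,4) ennreal_leI[of "min d e" d] ennreal_leI[of "min d e" e]
    by (fastforce dest: less_le_trans)
  then show "\<exists>\<epsilon>>0. {f \<in> gs_banach h. gs_norm h f < ennreal \<epsilon>} \<subseteq> V \<inter> W"
    using de(1,2) by (intro exI[of _ "min d e"]) auto
qed

lemma istopology_gs_open: "istopology gs_open"
  unfolding istopology_def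
proof (intro conjI allI impI)
  fix S T :: "(real ^ 'n \<Rightarrow> complex) set"
  assume ST: "gs_open S" "gs_open T"
  show "gs_open (S \<inter> T)"
    unfolding gs_open_def
  proof (intro conjI ballI)
    show "S \<inter> T \<subseteq> gs_space" using ST by (auto simp: gs_open_def)
    fix f assume "f \<in> S \<inter> T"
    then obtain V W where "gs_nhd0 V" "\<forall>g\<in>V. (\<lambda>x. f x + g x) \<in> S"
        "gs_nhd0 W" "\<forall>g\<in>W. (\<lambda>x. f x + g x) \<in> T"
      using ST unfolding gs_open_def by blast
    then show "\<exists>V. gs_nhd0 V \<and> (\<forall>g\<in>V. (\<lambda>x. f x + g x) \<in> S \<inter> T)"
      by (intro exI[of _ "V \<inter> W"]) (auto intro: gs_nhd0_Int)
  qed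
next
  fix \<W> :: "(real ^ 'n \<Rightarrow> complex) set set"
  assume "\<forall>W\<in>\<W>. gs_open W"
  then show "gs_open (\<Union>\<W>)"
    unfolding gs_open_def by (meson Union_iff Union_least)
qed

lemma openin_gs_topology: "openin gs_topology W \<longleftrightarrow> gs_open W"
  unfolding gs_topology_def by (simp add: topology_inverse' istopology_gs_open)

text \<open>
  Only the values on \<open>gs_space\<close> of an element \<open>f\<close> of the dual are meaningful; \<open>f \<phi>\<close> is the
  bilinear pairing \<open>\<langle>f, \<phi>\<rangle>\<close>.
\<close>

definition gs_dual :: "((real ^ 'n::finite \<Rightarrow> complex) \<Rightarrow> complex) set" where
  "gs_dual = {f. (\<forall>\<phi>\<in>gs_space. \<forall>\<psi>\<in>gs_space. \<forall>a b.
       f (\<lambda>x. a * \<phi> x + b * \<psi> x) = a * f \<phi> + b * f \<psi>) \<and>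
     continuous_map gs_topology euclidean f}"

definition gs_scalar :: "((real ^ 'n::finite \<Rightarrow> complex) \<Rightarrow> complex) \<Rightarrow> (real ^ 'n \<Rightarrow> complex) \<Rightarrow> complex" where
  "gs_scalar f \<phi> = f (\<lambda>x. cnj (\<phi> x))"

definition gs_pullback ::
  "(real ^ 'n::finite \<Rightarrow> real ^ 'n) \<Rightarrow> ((real ^ 'n \<Rightarrow> complex) \<Rightarrow> complex) \<Rightarrow> (real ^ 'n \<Rightarrow> complex) \<Rightarrow> complex" where
  "gs_pullback U f \<phi> = f (\<phi> \<circ> inv U)"

definition radial_symmetric :: "((real ^ 'n::finite \<Rightarrow> complex) \<Rightarrow> complex) \<Rightarrow> bool" where
  "radial_symmetric f \<longleftrightarrow>
     (\<forall>U. orthogonal_transformation U \<longrightarrow> (\<forall>\<phi>\<in>gs_space. gs_pullback U f \<phi> = f \<phi>))"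

definition cpair :: "complex ^ 'n::finite \<Rightarrow> complex ^ 'n \<Rightarrow> complex" where
  "cpair z w = (\<Sum>j\<in>UNIV. z $ j * w $ j)"

definition cvec :: "real ^ 'n::finite \<Rightarrow> complex ^ 'n" where
  "cvec x = (\<chi> j. of_real (x $ j))"

definition complexify :: "(real ^ 'n::finite \<Rightarrow> real ^ 'n) \<Rightarrow> complex ^ 'n \<Rightarrow> complex ^ 'n" where
  "complexify U z = cvec (U (\<chi> j. Re (z $ j))) + \<i> *s cvec (U (\<chi> j. Im (z $ j)))"

definition bargmann_kernel :: "complex ^ 'n::finite \<Rightarrow> real ^ 'n \<Rightarrow> complex" where
  "bargmann_kernel z y = of_real (pi powr (- real CARD('n) / 4)) *
     exp (- (cpair z z + of_real ((norm y)\<^sup>2)) / 2 + of_real (sqrt 2) * cpair z (cvec y))"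

definition bargmann :: "((real ^ 'n::finite \<Rightarrow> complex) \<Rightarrow> complex) \<Rightarrow> complex ^ 'n \<Rightarrow> complex" where
  "bargmann f z = f (bargmann_kernel z)"

definition hermite :: "('n::finite \<Rightarrow> nat) \<Rightarrow> real ^ 'n \<Rightarrow> complex" where
  "hermite \<alpha> x = of_real (pi powr (- real CARD('n) / 4) * (-1) ^ mi_abs \<alpha> *
       (2 ^ mi_abs \<alpha> * mi_fact \<alpha>) powr (-1/2) * exp ((norm x)\<^sup>2 / 2)) *
     mi_deriv \<alpha> (\<lambda>y. of_real (exp (- (norm y)\<^sup>2))) x"

end

theory Submission
  imports Defs "HOL-Complex_Analysis.Complex_Analysis"
begin

text \<open>
  The test functions are exactly the restrictions to \<open>\<real>\<^sup>d\<close> of the entire functions \<open>F\<close> with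
  \<open>\<bar>F (x + i y)\<bar> \<le> M exp (b \<bar>y\<bar>\<^sup>2 - c \<bar>x\<bar>\<^sup>2)\<close> for some \<open>b, c > 0\<close>, and an element of the dual space is bounded on each
  of these weighted spaces. In such a space \<open>F\<close> is the limit of (polynomials) \<open>exp (- a \<langle>z, z\<rangle>)\<close> as soon as
  \<open>c < a\<close> and \<open>b + c \<le> 2 a\<close>; letting \<open>a\<close> grow by factors \<open>3 / 2\<close> from \<open>1 / 2\<close> reaches all test functions. Hence a
  functional that annihilates the Bargmann kernels vanishes, which gives (1) \<open>\<longleftrightarrow>\<close> (2), because a rotation of
  the test function amounts to a rotation of the parameter of the kernel.

  Writing the kernel as \<open>exp (\<langle>w, w\<rangle> / 2) g (w - z / sqrt 2)\<close> with \<open>g = exp (- \<langle>w, w\<rangle>)\<close> and differentiating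
  under \<open>f\<close> shows that \<open>sqrt (\<alpha>!) (f, h\<^sub>\<alpha>)\<close> is the \<open>\<alpha>\<close>-th derivative at \<open>0\<close> of the Bargmann transform, so (3) and (4)
  compare the Taylor coefficients of an entire function with those of \<open>F\<^sub>0(\<langle>z, z\<rangle>)\<close>. For (2) \<open>\<longrightarrow>\<close> (3) one restricts to
  a coordinate axis, where the function is even, and continues analytically from \<open>\<real>\<^sup>d\<close>.
\<close>

text \<open>An element of the dual is known only through linearity and one bound for each pair of
  rates in \<open>gbound c b\<close>, so every limit taken under it has to be an explicit remainder
  estimate inside a single weight class. This is why the exponents are tracked throughout. The
  Gaussian weights come from the factorials: Cauchy's estimate with radius sqrt(k) has the factor k!
  / sqrt(k)^k, at most sqrt(k!), and conversely Taylor terms of size s^n / sqrt(n!) sum to a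
  Gaussian in s. The conditions on a come from expanding F exp(a<z,z>) into homogeneous polynomials.
  Its modulus is at most M exp((a - c)|x|^2 + (b - a)|y|^2) at z = x + iy, while Cauchy estimates
  for t \<mapsto> tz see |z| only; hence b - a \<le> a - c, and c > 0 leaves room for a circle of
  radius above 1. The kernels provide a = 1/2 only, and fast growth in imaginary directions violates
  the condition. Each enlargement of a therefore first shows that the functional kills the
  polynomials times the narrower Gaussian.\<close>

unbundle no fps_syntax

section \<open>Entire functions on \<open>\<complex>\<^sup>d\<close>\<close>

lemma norm_cscale: "norm (t *s w) = cmod t * norm w" for w :: "complex ^ 'n::finite"
  by (simp add: norm_vec_def vector_scalar_mult_def L2_set_right_distrib norm_mult)

lemma continuous_on_cscale [continuous_intros]:
  "continuous_on S f \<Longrightarrow> continuous_on S g \<Longrightarrow> continuous_on S (\<lambda>x. f x *s g x)"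
  for f :: "_ \<Rightarrow> complex"
  unfolding vector_scalar_mult_def by (intro continuous_intros)

text \<open>Circles of radius 1 about points of the closed unit disc stay in |t| \<le> 2, so Cauchy
  bounds g'' by 2B there. The constant depends on g through B only, which makes difference quotients
  converge uniformly in every parameter in which B is uniform.\<close>

lemma holomorphic_quadratic_remainder:
  assumes g: "g holomorphic_on UNIV" and B: "\<And>t. cmod t \<le> 2 \<Longrightarrow> cmod (g t) \<le> B" and s: "cmod s \<le> 1"
  shows "cmod (g s - g 0 - deriv g 0 * s) \<le> 2 * B * (cmod s)\<^sup>2"
proof -
  have 2: "cmod ((deriv ^^ 2) g x) \<le> 2 * B" if "x \<in> cball 0 1" for x
  proof -
    have "cmod ((deriv ^^ 2) g x) \<le> fact 2 * B / 1 ^ 2"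
    proof (rule Cauchy_inequality)
      show "g holomorphic_on ball x 1" "continuous_on (cball x 1) g"
        using g by (auto intro: holomorphic_on_subset holomorphic_on_imp_continuous_on)
      fix y assume "norm (x - y) = 1"
      then show "norm (g y) \<le> B"
        using that norm_triangle_ineq2[of y x] by (intro B) (auto simp: norm_minus_commute)
    qed auto
    then show ?thesis by simp
  qed
  have "cmod ((deriv ^^ 0) g s - (\<Sum>i\<le>1. (deriv ^^ i) g 0 * (s - 0) ^ i / fact i))
      \<le> 2 * B * cmod (s - 0) ^ Suc 1 / fact 1"
  proof (rule complex_Taylor[where S = "cball 0 1" and f = "\<lambda>i. (deriv ^^ i) g"])
    fix i x
    have "(deriv ^^ i) g holomorphic_on UNIV" using g by (simp add: holomorphic_higher_deriv)
    then show "((deriv ^^ i) g has_field_derivative (deriv ^^ Suc i) g x) (at x within cball 0 1)"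
      by (auto intro: holomorphic_derivI[where S = UNIV] has_field_derivative_at_within)
  qed (use 2 s in \<open>auto simp: numeral_2_eq_2\<close>)
  then show ?thesis by (simp add: power2_eq_square algebra_simps)
qed

text \<open>Osgood's characterisation of holomorphy in several variables: given joint continuity,
  holomorphy on complex lines suffices. It reduces the arguments to one complex variable.\<close>

definition entire :: "(complex ^ 'n::finite \<Rightarrow> complex) \<Rightarrow> bool" where
  "entire F \<longleftrightarrow> continuous_on UNIV F \<and> (\<forall>z w. (\<lambda>t. F (z + t *s w)) holomorphic_on UNIV)"

definition dird :: "complex ^ 'n::finite \<Rightarrow> (complex ^ 'n \<Rightarrow> complex) \<Rightarrow> complex ^ 'n \<Rightarrow> complex" where
  "dird w F z = deriv (\<lambda>t. F (z + t *s w)) 0"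

lemma entireI:
  "continuous_on UNIV F \<Longrightarrow> (\<And>z w. (\<lambda>t. F (z + t *s w)) holomorphic_on UNIV) \<Longrightarrow> entire F"
  by (simp add: entire_def)

lemma entire_continuous: "entire F \<Longrightarrow> continuous_on S F"
  by (auto simp: entire_def intro: continuous_on_subset)

lemma entire_line: "entire F \<Longrightarrow> (\<lambda>t. F (z + t *s w)) holomorphic_on S"
  by (auto simp: entire_def intro: holomorphic_on_subset)

lemma entire_ray: "entire F \<Longrightarrow> (\<lambda>t. F (t *s w)) holomorphic_on S"
  using entire_line[of F 0 w S] by simp

lemma entire_const: "entire (\<lambda>z. c)"
  by (simp add: entire_def)

lemma entire_component: "entire (\<lambda>z. z $ j)"
  unfolding entire_def by (auto intro!: continuous_intros holomorphic_intros)

lemma entire_add: "entire F \<Longrightarrow> entire G \<Longrightarrow> entire (\<lambda>z. F z + G z)"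
  by (auto simp: entire_def intro!: continuous_intros holomorphic_intros)

lemma entire_mult: "entire F \<Longrightarrow> entire G \<Longrightarrow> entire (\<lambda>z. F z * G z)"
  by (auto simp: entire_def intro!: continuous_intros holomorphic_intros)

lemma entire_sum: "(\<And>i. i \<in> I \<Longrightarrow> entire (F i)) \<Longrightarrow> entire (\<lambda>z. \<Sum>i\<in>I. F i z)"
  by (induction I rule: infinite_finite_induct) (auto intro: entire_const entire_add)

lemma entire_compose:
  assumes "h holomorphic_on UNIV" "entire F"
  shows "entire (\<lambda>z. h (F z))"
proof (rule entireI)
  show "continuous_on UNIV (\<lambda>z. h (F z))"
    using assms by (intro continuous_on_compose2[OF holomorphic_on_imp_continuous_on[OF assms(1)]])
      (auto intro: entire_continuous)
  show "(\<lambda>t. h (F (z + t *s w))) holomorphic_on UNIV" for z w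
    using holomorphic_on_compose_gen[OF entire_line[OF assms(2), of z w] assms(1)]
    by (simp add: o_def)
qed

lemma entire_cpair: "entire (\<lambda>z. cpair z z)"
  unfolding cpair_def by (intro entire_sum entire_mult entire_component)

lemma entire_cpair_right: "entire (\<lambda>z. cpair w z)"
  unfolding cpair_def by (intro entire_sum entire_mult entire_component entire_const)

lemma entire_exp: "entire F \<Longrightarrow> entire (\<lambda>z. exp (F z))"
  by (rule entire_compose) (auto intro: holomorphic_intros)

lemma entire_affine:
  assumes "entire F"
  shows "entire (\<lambda>z. F (c *s z + v))"
proof (rule entireI)
  show "continuous_on UNIV (\<lambda>z. F (c *s z + v))"
    by (rule continuous_on_compose2[OF entire_continuous[OF assms, of UNIV]]) (auto intro!: continuous_intros)
  fix z w :: "complex ^ 'a"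
  have eq: "c *s (z + t *s w) + v = (c *s z + v) + t *s (c *s w)" for t
    by (simp add: vec_eq_iff algebra_simps)
  show "(\<lambda>t. F (c *s (z + t *s w) + v)) holomorphic_on UNIV"
    unfolding eq by (rule entire_line[OF assms])
qed

lemma entire_uniform_limit:
  assumes F: "\<And>n. entire (F n)" and lim: "\<And>R. uniform_limit (cball 0 R) F G sequentially"
  shows "entire G"
proof (rule entireI)
  have "isCont G z" for z
  proof -
    have "continuous_on (cball 0 (norm z + 1)) G"
      by (rule uniform_limit_theorem[OF always_eventually lim]) (auto intro: entire_continuous F)
    then show ?thesis by (rule continuous_on_interior) auto
  qed
  then show "continuous_on UNIV G" by (simp add: continuous_on_eq_continuous_at)
  fix z w
  show "(\<lambda>t. G (z + t *s w)) holomorphic_on UNIV"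
  proof (rule holomorphic_uniform_sequence[where f = "\<lambda>n t. F n (z + t *s w)"])
    fix x :: complex
    have "uniform_limit (cball x 1) (\<lambda>n t. F n (z + t *s w)) (\<lambda>t. G (z + t *s w)) sequentially"
    proof (rule uniform_limit_compose'[where h = "\<lambda>t. z + t *s w", OF lim])
      show "(\<lambda>t. z + t *s w) \<in> cball x 1 \<rightarrow> cball 0 (norm z + (norm x + 1) * norm w)"
      proof
        fix t assume "t \<in> cball x 1"
        then have "cmod t \<le> norm x + 1"
          using norm_triangle_ineq2[of t x] by (auto simp: dist_norm norm_minus_commute)
        then show "z + t *s w \<in> cball 0 (norm z + (norm x + 1) * norm w)"
          using norm_triangle_ineq[of z "t *s w"] mult_right_mono[of "cmod t" "norm x + 1" "norm w"]
          by (simp add: norm_cscale)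
      qed
    qed
    then show "\<exists>d. 0 < d \<and> cball x d \<subseteq> UNIV \<and>
        uniform_limit (cball x d) (\<lambda>n t. F n (z + t *s w)) (\<lambda>t. G (z + t *s w)) sequentially"
      by (intro exI[of _ 1]) auto
  qed (auto intro: entire_line F)
qed

lemma entire_bounded:
  assumes "entire F"
  obtains B where "\<And>z. norm z \<le> R \<Longrightarrow> cmod (F z) \<le> B"
proof -
  have "compact (F ` cball 0 R)"
    by (intro compact_continuous_image entire_continuous assms) auto
  then obtain B where "\<forall>x\<in>F ` cball 0 R. cmod x \<le> B"
    using compact_imp_bounded bounded_iff by blast
  then show ?thesis using that[of B] by auto
qed

lemma dird_line:
  assumes "entire F"
  shows "((\<lambda>t. F (z + t *s w)) has_field_derivative dird w F (z + t *s w)) (at t)"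
proof -
  let ?G = "\<lambda>t. F (z + t *s w)"
  have G: "(?G has_field_derivative deriv ?G t) (at t)"
    by (rule holomorphic_derivI[OF entire_line[OF assms, of _ _ UNIV]]) auto
  have "((\<lambda>s. ?G (t + s)) has_field_derivative deriv ?G t) (at 0)"
    using G DERIV_shift[of ?G "deriv ?G t" 0 t] by (simp add: add.commute)
  moreover have "?G (t + s) = F ((z + t *s w) + s *s w)" for s
    by (simp add: vec.scale_left_distrib add_ac)
  ultimately have "dird w F (z + t *s w) = deriv ?G t"
    unfolding dird_def by (simp add: DERIV_imp_deriv)
  with G show ?thesis by simp
qed

lemma dird_remainder:
  assumes F: "entire F" and B: "\<And>t. cmod t \<le> 2 \<Longrightarrow> cmod (F (z + t *s w)) \<le> B" and s: "cmod s \<le> 1"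
  shows "cmod (F (z + s *s w) - F z - s * dird w F z) \<le> 2 * B * (cmod s)\<^sup>2"
  using holomorphic_quadratic_remainder[OF entire_line[OF F, of z w] B s]
  by (simp add: dird_def mult.commute)

text \<open>By the quadratic remainder the difference quotients with step 1/(n + 1) converge
  uniformly on balls, with error 2B/(n + 1). The quotients are entire, hence so is the limit, which
  includes holomorphy in directions other than w.\<close>

lemma entire_dird:
  assumes F: "entire F"
  shows "entire (dird w F)"
proof (rule entire_uniform_limit[where F = "\<lambda>n z. of_nat (Suc n) * (F (z + (1 / of_nat (Suc n)) *s w) + (-1) * F z)"])
  have "entire (\<lambda>z. F (1 *s z + (1 / of_nat (Suc n)) *s w))" for n
    by (rule entire_affine[OF F])
  then show "entire (\<lambda>z. of_nat (Suc n) * (F (z + (1 / of_nat (Suc n)) *s w) + (-1) * F z))" for n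
    by (intro entire_mult entire_add entire_const F) simp
  fix R
  obtain B where B: "\<And>z. norm z \<le> R + 2 * norm w \<Longrightarrow> cmod (F z) \<le> B"
    using entire_bounded[OF F, of "R + 2 * norm w"] by blast
  have bound: "cmod (of_nat (Suc n) * (F (z + (1 / of_nat (Suc n)) *s w) + (-1) * F z) - dird w F z)
      \<le> 2 * B / real (Suc n)" if z: "z \<in> cball 0 R" for n z
  proof -
    let ?s = "1 / of_nat (Suc n) :: complex"
    have s: "cmod ?s = 1 / real (Suc n)" by (simp add: norm_divide del: of_nat_Suc)
    have "cmod (F (z + ?s *s w) - F z - ?s * dird w F z) \<le> 2 * B * (cmod ?s)\<^sup>2"
    proof (rule dird_remainder[OF F])
      fix t :: complex assume "cmod t \<le> 2"
      then show "cmod (F (z + t *s w)) \<le> B"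
        using z norm_triangle_ineq[of z "t *s w"] mult_right_mono[of "cmod t" 2 "norm w"]
        by (intro B) (auto simp: norm_cscale)
    next
      show "cmod ?s \<le> 1" unfolding s by simp
    qed
    then have "real (Suc n) * cmod (F (z + ?s *s w) - F z - ?s * dird w F z)
        \<le> real (Suc n) * (2 * B * (cmod ?s)\<^sup>2)"
      by (rule mult_left_mono) simp
    also have "\<dots> = 2 * B / real (Suc n)"
      unfolding s by (simp add: power2_eq_square divide_simps del: of_nat_Suc)
    also have "real (Suc n) * cmod (F (z + ?s *s w) - F z - ?s * dird w F z)
      = cmod (of_nat (Suc n) * (F (z + ?s *s w) - F z - ?s * dird w F z))"
      by (simp only: norm_mult norm_of_nat)
    also have "of_nat (Suc n) * (F (z + ?s *s w) - F z - ?s * dird w F z)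
       = of_nat (Suc n) * (F (z + ?s *s w) + (-1) * F z) - dird w F z"
      by (simp add: field_simps del: of_nat_Suc)
    finally show ?thesis .
  qed
  have lim: "(\<lambda>n. 2 * B / real (Suc n)) \<longlonglongrightarrow> 0"
    using LIMSEQ_Suc[OF lim_const_over_n[of "2 * B"]] by simp
  show "uniform_limit (cball 0 R)
      (\<lambda>n z. of_nat (Suc n) * (F (z + (1 / of_nat (Suc n)) *s w) + (-1) * F z)) (dird w F) sequentially"
    unfolding uniform_limit_iff dist_norm
  proof (intro allI impI)
    fix e :: real assume "e > 0"
    with lim have "\<forall>\<^sub>F n in sequentially. 2 * B / real (Suc n) < e" by (rule order_tendstoD(2))
    then show "\<forall>\<^sub>F n in sequentially. \<forall>z\<in>cball 0 R.
        cmod (of_nat (Suc n) * (F (z + (1 / of_nat (Suc n)) *s w) + (-1) * F z) - dird w F z) < e"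
      by (rule eventually_mono) (use bound le_less_trans in blast)
  qed
qed

lemma entire_dird_funpow: "entire F \<Longrightarrow> entire ((dird w ^^ k) F)"
  by (induction k) (auto intro: entire_dird)

lemma higher_deriv_line:
  assumes "entire F"
  shows "(deriv ^^ k) (\<lambda>t. F (z + t *s w)) t = (dird w ^^ k) F (z + t *s w)"
proof (induction k arbitrary: t)
  case (Suc k)
  then have "(deriv ^^ Suc k) (\<lambda>t. F (z + t *s w)) t = deriv (\<lambda>t. (dird w ^^ k) F (z + t *s w)) t"
    by (simp add: Suc[abs_def])
  also have "\<dots> = (dird w ^^ Suc k) F (z + t *s w)"
    using dird_line[OF entire_dird_funpow[OF assms]] by (simp add: DERIV_imp_deriv)
  finally show ?case .
qed simp

lemma dird_cauchy:
  assumes F: "entire F" and r: "r > 0" and B: "\<And>t. cmod t = r \<Longrightarrow> cmod (F (z + t *s w)) \<le> B"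
  shows "cmod ((dird w ^^ k) F z) \<le> fact k * B / r ^ k"
proof -
  have "cmod ((deriv ^^ k) (\<lambda>t. F (z + t *s w)) 0) \<le> fact k * B / r ^ k"
    using r B by (intro Cauchy_inequality entire_line[OF F] holomorphic_on_imp_continuous_on) auto
  then show ?thesis by (simp add: higher_deriv_line[OF F])
qed

lemma dird_scale: "entire F \<Longrightarrow> dird (c *s w) F z = c * dird w F z"
proof -
  assume F: "entire F"
  have "((\<lambda>t. F (z + (c * t) *s w)) has_field_derivative dird w F (z + (c * 0) *s w) * (c * 1)) (at 0)"
    by (rule DERIV_chain2[OF dird_line[OF F]]) (intro DERIV_cmult DERIV_ident)
  then show ?thesis
    unfolding dird_def[of "c *s w"] by (simp add: vec.scale_scale mult_ac DERIV_imp_deriv)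
qed

text \<open>The increment from z to z + s(u + v) is also the sum of the two increments via z + su.
  Three quadratic remainders, divided by s, leave an error of at most 6B|s|, and continuity of
  \<open>dird v F\<close> identifies the limit as s tends to 0.\<close>

lemma dird_add:
  assumes F: "entire F"
  shows "dird (u + v) F z = dird u F z + dird v F z"
proof -
  define R where "R = norm z + 2 * norm u + 2 * norm v"
  obtain B where B: "\<And>z. norm z \<le> R + norm u \<Longrightarrow> cmod (F z) \<le> B"
    using entire_bounded[OF F, of "R + norm u"] by blast
  have bnd: "norm (y + t *s x) \<le> norm y + 2 * norm x" if "cmod t \<le> 2" for t and x y :: "complex^'a"
    using norm_triangle_ineq[of y "t *s x"] mult_right_mono[of "cmod t" 2 "norm x"] that
    by (auto simp: norm_cscale)
  let ?f = "\<lambda>s. dird v F (z + s *s u) - (dird (u + v) F z - dird u F z)"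
  have le: "cmod (?f s) \<le> 6 * B * cmod s" if s: "cmod s \<le> 1" "s \<noteq> 0" for s
  proof -
    have su: "norm (z + s *s u) \<le> norm z + norm u"
      using norm_triangle_ineq[of z "s *s u"] mult_right_mono[of "cmod s" 1 "norm u"] s
      by (auto simp: norm_cscale)
    have r1: "cmod (F (z + s *s (u + v)) - F z - s * dird (u + v) F z) \<le> 2 * B * (cmod s)\<^sup>2"
    proof (intro dird_remainder[OF F] B s)
      fix t :: complex assume "cmod t \<le> 2"
      from bnd[OF this, of z "u + v"] show "norm (z + t *s (u + v)) \<le> R + norm u"
        using norm_triangle_ineq[of u v] norm_ge_zero[of u] unfolding R_def by linarith
    qed
    have r2: "cmod (F (z + s *s u) - F z - s * dird u F z) \<le> 2 * B * (cmod s)\<^sup>2"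
    proof (intro dird_remainder[OF F] B s)
      fix t :: complex assume "cmod t \<le> 2"
      from bnd[OF this, of z u] show "norm (z + t *s u) \<le> R + norm u"
        using norm_ge_zero[of u] norm_ge_zero[of v] unfolding R_def by linarith
    qed
    have r3: "cmod (F ((z + s *s u) + s *s v) - F (z + s *s u) - s * dird v F (z + s *s u)) \<le> 2 * B * (cmod s)\<^sup>2"
    proof (intro dird_remainder[OF F] B s)
      fix t :: complex assume "cmod t \<le> 2"
      from bnd[OF this, of "z + s *s u" v] show "norm (z + s *s u + t *s v) \<le> R + norm u"
        using su norm_ge_zero[of u] unfolding R_def by linarith
    qed
    have eq: "s * ?f s = (F (z + s *s (u + v)) - F z - s * dird (u + v) F z)
        - (F (z + s *s u) - F z - s * dird u F z)
        - (F ((z + s *s u) + s *s v) - F (z + s *s u) - s * dird v F (z + s *s u))"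
      by (simp add: vec.scale_right_distrib algebra_simps)
    have tri: "cmod (a - b - c) \<le> cmod a + cmod b + cmod c" for a b c
      using norm_triangle_ineq4[of "a - b" c] norm_triangle_ineq4[of a b] by linarith
    have "cmod (s * ?f s) \<le> 2 * B * (cmod s)\<^sup>2 + 2 * B * (cmod s)\<^sup>2 + 2 * B * (cmod s)\<^sup>2"
      unfolding eq by (rule order_trans[OF tri]) (intro add_mono r1 r2 r3)
    then have "cmod s * cmod (?f s) \<le> cmod s * (6 * B * cmod s)"
      by (simp add: norm_mult power2_eq_square mult_ac)
    then show ?thesis by (rule mult_left_le_imp_le) (use s(2) in simp)
  qed
  have "(?f \<longlongrightarrow> ?f 0) (at 0)"
    using entire_line[OF entire_dird[OF F], of v z u UNIV]
    by (intro tendsto_intros) (metis UNIV_I continuous_on_eq_continuous_at holomorphic_on_imp_continuous_on isCont_def open_UNIV)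
  moreover have "(?f \<longlongrightarrow> 0) (at 0)"
  proof (rule Lim_null_comparison)
    show "\<forall>\<^sub>F s in at 0. cmod (?f s) \<le> 6 * B * cmod s"
      unfolding eventually_at using le by (intro exI[of _ 1]) auto
    show "((\<lambda>s. 6 * B * cmod s) \<longlongrightarrow> 0) (at 0)"
      by (intro tendsto_eq_intros) auto
  qed
  ultimately have "?f 0 = 0" by (rule tendsto_unique[rotated]) auto
  then show ?thesis by simp
qed

lemma dird_sum:
  assumes F: "entire F"
  shows "dird (\<Sum>i\<in>I. c i *s u i) F z = (\<Sum>i\<in>I. c i * dird (u i) F z)"
proof (induction I rule: infinite_finite_induct)
  case empty
  show ?case using dird_scale[OF F, of 0 0] by simp
next
  case (infinite A)
  then show ?case using dird_scale[OF F, of 0 0] by simp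
qed (simp add: dird_add[OF F] dird_scale[OF F])

text \<open>\<open>smooth\<close> asks for Frechet derivatives, not only directional ones. Writing h
  = |h| u with |u| = 1 makes the remainder bound 2B|h|^2 uniform in the direction.\<close>

lemma entire_has_derivative:
  assumes F: "entire F"
  shows "(F has_derivative (\<lambda>h. dird h F z)) (at z)"
proof -
  obtain B where B: "\<And>x. norm x \<le> norm z + 2 \<Longrightarrow> cmod (F x) \<le> B"
    using entire_bounded[OF F] by blast
  have rem: "cmod (F (z + h) - F z - dird h F z) \<le> 2 * B * (norm h)\<^sup>2" if h: "norm h \<le> 1" "h \<noteq> 0" for h
  proof -
    define u where "u = (1 / of_real (norm h)) *s h"
    have hu: "h = of_real (norm h) *s u" and u: "norm u = 1"
      using h by (auto simp: u_def norm_cscale norm_divide)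
    have "cmod (F (z + of_real (norm h) *s u) - F z - of_real (norm h) * dird u F z) \<le> 2 * B * (cmod (of_real (norm h)))\<^sup>2"
      using h u by (intro dird_remainder[OF F] B order_trans[OF norm_triangle_ineq]) (auto simp: norm_cscale)
    then show ?thesis
      using hu dird_scale[OF F, of "of_real (norm h)" u z] by simp
  qed
  have lin: "linear (\<lambda>h. dird h F z)"
  proof (rule linearI)
    show "dird (x + y) F z = dird x F z + dird y F z" for x y by (rule dird_add[OF F])
    have "r *\<^sub>R x = of_real r *s x" for r and x :: "complex ^ 'a"
      by (simp add: vec_eq_iff scaleR_conv_of_real[where 'a = complex])
    then show "dird (r *\<^sub>R x) F z = r *\<^sub>R dird x F z" for r x
      by (simp add: dird_scale[OF F] scaleR_conv_of_real)
  qed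
  show ?thesis
    unfolding has_derivative_at
  proof (intro conjI)
    show "bounded_linear (\<lambda>h. dird h F z)" by (rule linear_conv_bounded_linear[THEN iffD1, OF lin])
    show "(\<lambda>h. norm (F (z + h) - F z - dird h F z) / norm h) \<midarrow>0\<rightarrow> 0"
    proof (rule Lim_null_comparison)
      have "norm (norm (F (z + h) - F z - dird h F z) / norm h) \<le> 2 * B * norm h"
        if "norm h \<le> 1" "h \<noteq> 0" for h
        using rem[OF that] that by (simp add: power2_eq_square field_simps)
      then show "\<forall>\<^sub>F h in at 0. norm (norm (F (z + h) - F z - dird h F z) / norm h) \<le> 2 * B * norm h"
        unfolding eventually_at by (intro exI[of _ 1]) auto
      show "((\<lambda>h. 2 * B * norm h) \<longlongrightarrow> 0) (at 0)"
        by (intro tendsto_eq_intros) auto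
    qed
  qed
qed

text \<open>Along unit directions Cauchy bounds the first derivative by B, and the quadratic
  remainder adds 2B, so an increment by h is at most 3B|h|. This serves functions of a parameter
  under a functional, where bounds are at hand but continuity is not.\<close>

lemma entire_of_locally_bounded:
  assumes hol: "\<And>z w. (\<lambda>t. V (z + t *s w)) holomorphic_on UNIV"
    and bnd: "\<And>R. \<exists>B. \<forall>z. norm z \<le> R \<longrightarrow> cmod (V z) \<le> B"
  shows "entire V"
proof (rule entireI)
  have "isCont V z" for z
  proof -
    obtain B where B: "\<And>x. norm x \<le> norm z + 2 \<Longrightarrow> cmod (V x) \<le> B"
      using bnd by metis
    have rem: "cmod (V (z + h) - V z) \<le> 3 * B * norm h" if h: "norm h \<le> 1" "h \<noteq> 0" for h
    proof -
      define u where "u = (1 / of_real (norm h)) *s h"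
      have hu: "h = of_real (norm h) *s u" and u: "norm u = 1"
        using h by (auto simp: u_def norm_cscale norm_divide)
      let ?g = "\<lambda>t. V (z + t *s u)"
      have gB: "cmod (?g t) \<le> B" if "cmod t \<le> 2" for t
        using that u by (intro B order_trans[OF norm_triangle_ineq]) (auto simp: norm_cscale)
      have B0: "B \<ge> 0" using order_trans[OF norm_ge_zero gB[of 0]] by simp
      have "cmod ((deriv ^^ 1) ?g 0) \<le> fact 1 * B / 1 ^ 1"
        using gB by (intro Cauchy_inequality holomorphic_on_imp_continuous_on)
          (auto intro: holomorphic_on_subset[OF hol])
      then have d: "cmod (deriv ?g 0) \<le> B" by simp
      have "cmod (?g (norm h) - ?g 0 - deriv ?g 0 * norm h) \<le> 2 * B * (cmod (norm h))\<^sup>2"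
        using gB h by (intro holomorphic_quadratic_remainder[OF hol]) auto
      moreover have "cmod (deriv ?g 0 * norm h) \<le> B * norm h"
        using d by (simp add: norm_mult mult_right_mono)
      moreover have "2 * B * (norm h)\<^sup>2 \<le> 2 * B * norm h"
        using h B0 by (simp add: power2_eq_square mult_left_le mult_left_mono)
      ultimately have "cmod (?g (norm h) - ?g 0) \<le> 3 * B * norm h"
        using norm_triangle_sub[of "?g (norm h) - ?g 0" "deriv ?g 0 * norm h"] by (simp add: algebra_simps)
      then show ?thesis using hu by simp
    qed
    have "((\<lambda>h. V (z + h) - V z) \<longlongrightarrow> 0) (at 0)"
    proof (rule Lim_null_comparison)
      show "\<forall>\<^sub>F h in at 0. norm (V (z + h) - V z) \<le> 3 * B * norm h"
        unfolding eventually_at using rem by (intro exI[of _ 1]) auto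
      show "((\<lambda>h. 3 * B * norm h) \<longlongrightarrow> 0) (at 0)"
        by (intro tendsto_eq_intros) auto
    qed
    then show ?thesis by (simp add: isCont_iff LIM_zero_iff)
  qed
  then show "continuous_on UNIV V" by (simp add: continuous_on_eq_continuous_at)
qed (rule hol)

section \<open>Gaussian bounds and restrictions to \<open>\<real>\<^sup>d\<close>\<close>

definition rvec :: "complex ^ 'n::finite \<Rightarrow> real ^ 'n" where "rvec z = (\<chi> j. Re (z $ j))"
definition ivec :: "complex ^ 'n::finite \<Rightarrow> real ^ 'n" where "ivec z = (\<chi> j. Im (z $ j))"

lemma rvec_nth [simp]: "rvec z $ j = Re (z $ j)" and ivec_nth [simp]: "ivec z $ j = Im (z $ j)"
  and cvec_nth [simp]: "cvec x $ j = of_real (x $ j)"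
  by (simp_all add: rvec_def ivec_def cvec_def)

lemma cvec_decompose: "z = cvec (rvec z) + \<i> *s cvec (ivec z)"
  by (simp add: vec_eq_iff complex_eq_iff)

lemma rvec_add: "rvec (z + w) = rvec z + rvec w" and ivec_add: "ivec (z + w) = ivec z + ivec w"
  by (simp_all add: vec_eq_iff)

lemma rvec_cvec [simp]: "rvec (cvec x) = x" and ivec_cvec [simp]: "ivec (cvec x) = 0"
  and rvec_ii [simp]: "rvec (\<i> *s cvec x) = 0" and ivec_ii [simp]: "ivec (\<i> *s cvec x) = x"
  by (simp_all add: vec_eq_iff)

lemma norm_sum_squares: "(norm x)\<^sup>2 = (\<Sum>j\<in>UNIV. (norm (x $ j))\<^sup>2)"
  by (simp add: norm_vec_def L2_set_def sum_nonneg)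

lemma norm_rvec_ivec: "(norm z)\<^sup>2 = (norm (rvec z))\<^sup>2 + (norm (ivec z))\<^sup>2"
  by (simp add: norm_sum_squares cmod_power2 sum.distrib)

lemma cvec_add: "cvec (x + y) = cvec x + cvec y" and cvec_scaleR: "cvec (r *\<^sub>R x) = of_real r *s cvec x"
  and cvec_axis: "cvec (axis j 1) = axis j 1" and cvec_0 [simp]: "cvec 0 = 0"
  by (simp_all add: vec_eq_iff axis_def)

lemma bounded_linear_cvec: "bounded_linear cvec"
  by (rule linear_conv_bounded_linear[THEN iffD1], rule linearI)
    (auto simp: cvec_add vec_eq_iff scaleR_conv_of_real[where 'a = complex])

abbreviation cpd :: "'n::finite \<Rightarrow> (complex ^ 'n \<Rightarrow> complex) \<Rightarrow> complex ^ 'n \<Rightarrow> complex" where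
  "cpd j \<equiv> dird (axis j 1)"

lemma partial_deriv_cvec:
  assumes "entire F"
  shows "partial_deriv j (\<lambda>x. F (cvec x)) = (\<lambda>x. cpd j F (cvec x))"
proof
  fix x
  have "((\<lambda>t. F (cvec x + of_real t *s axis j 1)) has_vector_derivative cpd j F (cvec x)) (at 0)"
    using dird_line[OF assms, of "cvec x" "axis j 1" "of_real 0"]
    by (intro has_vector_derivative_real_field) simp
  then show "partial_deriv j (\<lambda>x. F (cvec x)) x = cpd j F (cvec x)"
    unfolding partial_deriv_def
    by (intro vector_derivative_at) (simp add: cvec_add cvec_scaleR cvec_axis)
qed

lemma entire_foldr_cpd: "entire F \<Longrightarrow> entire (foldr cpd js F)"
  by (induction js) (auto intro: entire_dird)

lemma foldr_partial_deriv_cvec: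
  "entire F \<Longrightarrow> foldr partial_deriv js (\<lambda>x. F (cvec x)) = (\<lambda>x. foldr cpd js F (cvec x))"
  by (induction js) (auto simp: partial_deriv_cvec entire_foldr_cpd)

lemma smooth_cvec:
  assumes "entire F"
  shows "smooth (\<lambda>x. F (cvec x))"
  unfolding smooth_def foldr_partial_deriv_cvec[OF assms] differentiable_on_def
proof (intro allI ballI)
  fix js x
  have "((\<lambda>x. foldr cpd js F (cvec x)) has_derivative (\<lambda>h. dird (cvec h) (foldr cpd js F) (cvec x))) (at x)"
    by (rule has_derivative_compose[OF bounded_linear_imp_has_derivative[OF bounded_linear_cvec]
      entire_has_derivative[OF entire_foldr_cpd[OF assms]]])
  then show "(\<lambda>x. foldr cpd js F (cvec x)) differentiable at x"
    by (rule differentiableI)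
qed

text \<open>A flat list of directions: multi-index derivatives become instances of
  \<open>foldr partial_deriv js\<close>, which list induction and reordering can handle.\<close>

definition mi_list :: "('n::finite \<Rightarrow> nat) \<Rightarrow> 'n list \<Rightarrow> 'n list" where
  "mi_list \<alpha> js = concat (map (\<lambda>j. replicate (\<alpha> j) j) js)"

lemma foldr_funpow: "foldr (\<lambda>j. T j ^^ \<alpha> j) js F = foldr T (mi_list \<alpha> js) F"
proof (induction js)
  case (Cons j js)
  have "foldr T (replicate k j) G = (T j ^^ k) G" for k G
    by (induction k) auto
  then show ?case using Cons by (simp add: mi_list_def)
qed (simp add: mi_list_def)

lemma mi_deriv_foldr: "mi_deriv \<alpha> f = foldr partial_deriv (mi_list \<alpha> coords) f"
  unfolding mi_deriv_def by (rule foldr_funpow)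

lemma coords: "distinct (coords :: 'n::finite list)" "set (coords :: 'n list) = UNIV"
  using someI_ex[OF finite_distinct_list[OF finite[of "UNIV :: 'n set"]]]
  by (auto simp: coords_def conj_commute)

lemma mi_deriv_cvec:
  assumes "entire F"
  shows "mi_deriv \<alpha> (\<lambda>x. F (cvec x)) = (\<lambda>x. foldr (\<lambda>j. cpd j ^^ \<alpha> j) coords F (cvec x))"
  unfolding mi_deriv_foldr foldr_partial_deriv_cvec[OF assms] by (simp only: foldr_funpow)

lemma entire_foldr_cpd_funpow: "entire F \<Longrightarrow> entire (foldr (\<lambda>j. cpd j ^^ \<alpha> j) js F)"
  by (simp add: foldr_funpow entire_foldr_cpd)

text \<open>From k! \<le> k^k. It bounds the Cauchy factor k! / sqrt(k)^k by sqrt(k!), the weight in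
  the Gelfand-Shilov norm.\<close>

lemma fact_le_sqrt: "fact k \<le> sqrt (fact k) * sqrt (real k) ^ k"
proof -
  have "sqrt (fact k) \<le> sqrt (real k ^ k)"
    using fact_le_power[of k, where 'a = real] by simp
  then have "sqrt (fact k) * sqrt (fact k) \<le> sqrt (fact k) * sqrt (real k) ^ k"
    by (intro mult_left_mono) (auto simp: real_sqrt_power)
  then show ?thesis by simp
qed

text \<open>One-variable Cauchy estimates, one coordinate at a time, with radius sqrt(\<alpha> j) so
  that \<open>fact_le_sqrt\<close> applies. A coordinate with \<alpha> j = 0 has radius 0 and is not
  differentiated, hence the case distinction.\<close>

lemma polydisc_cauchy:
  fixes \<alpha> :: "'n::finite \<Rightarrow> nat"
  assumes F: "entire F" and "distinct js"
    and B: "\<And>w. \<lbrakk>\<And>j. j \<in> set js \<Longrightarrow> cmod (w $ j) \<le> sqrt (\<alpha> j); \<And>j. j \<notin> set js \<Longrightarrow> w $ j = 0\<rbrakk>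
      \<Longrightarrow> cmod (F (z + w)) \<le> B"
  shows "cmod (foldr (\<lambda>j. cpd j ^^ \<alpha> j) js F z) \<le> B * (\<Prod>j\<in>set js. sqrt (fact (\<alpha> j)))"
  using \<open>distinct js\<close> B
proof (induction js arbitrary: z)
  case Nil
  show ?case using Nil(2)[of 0] by simp
next
  case (Cons j js)
  define G where "G = foldr (\<lambda>j. cpd j ^^ \<alpha> j) js F"
  define P where "P = (\<Prod>j\<in>set js. sqrt (fact (\<alpha> j)))"
  have G: "entire G" unfolding G_def by (rule entire_foldr_cpd_funpow[OF F])
  have P: "P \<ge> 0" unfolding P_def by (intro prod_nonneg) auto
  have Gb: "cmod (G (z + t *s axis j 1)) \<le> B * P" if t: "cmod t \<le> sqrt (\<alpha> j)" for t
    unfolding G_def P_def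
  proof (rule Cons.IH)
    fix w :: "complex ^ 'n"
    assume w: "\<And>i. i \<in> set js \<Longrightarrow> cmod (w $ i) \<le> sqrt (\<alpha> i)" "\<And>i. i \<notin> set js \<Longrightarrow> w $ i = 0"
    have "cmod (F (z + (t *s axis j 1 + w))) \<le> B"
      using w t Cons.prems(1) by (intro Cons.prems(2)) (auto simp: axis_def)
    then show "cmod (F (z + t *s axis j 1 + w)) \<le> B" by (simp add: add.assoc)
  qed (use Cons.prems in auto)
  have B: "0 \<le> B * P" using Gb[of 0] order_trans[OF norm_ge_zero] by fastforce
  have "cmod ((cpd j ^^ \<alpha> j) G z) \<le> (B * P) * sqrt (fact (\<alpha> j))"
  proof (cases "\<alpha> j = 0")
    case True
    then show ?thesis using Gb[of 0] by simp
  next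
    case False
    have "cmod ((cpd j ^^ \<alpha> j) G z) \<le> fact (\<alpha> j) * (B * P) / sqrt (\<alpha> j) ^ \<alpha> j"
      using False Gb by (intro dird_cauchy[OF G]) auto
    also have "\<dots> \<le> (sqrt (fact (\<alpha> j)) * sqrt (real (\<alpha> j)) ^ \<alpha> j) * (B * P) / sqrt (\<alpha> j) ^ \<alpha> j"
      using B by (intro divide_right_mono mult_right_mono fact_le_sqrt) auto
    also have "\<dots> = (B * P) * sqrt (fact (\<alpha> j))"
      using False by simp
    finally show ?thesis .
  qed
  then show ?case using Cons.prems(1) by (simp add: G_def P_def mult_ac)
qed

section \<open>Gaussian growth classes and Gelfand-Shilov norms\<close>

definition gbound :: "real \<Rightarrow> real \<Rightarrow> real \<Rightarrow> (complex ^ 'n::finite \<Rightarrow> complex) \<Rightarrow> bool" where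
  "gbound c b M F \<longleftrightarrow> (\<forall>z. cmod (F z) \<le> M * exp (b * (norm (ivec z))\<^sup>2 - c * (norm (rvec z))\<^sup>2))"

lemma gboundD: "gbound c b M F \<Longrightarrow> cmod (F z) \<le> M * exp (b * (norm (ivec z))\<^sup>2 - c * (norm (rvec z))\<^sup>2)"
  by (simp add: gbound_def)

lemma gbound_nonneg: "gbound c b M F \<Longrightarrow> M \<ge> 0"
  using order_trans[OF norm_ge_zero gboundD[of c b M F 0]] by (simp add: zero_le_mult_iff)

lemma gbound_mono:
  fixes F :: "complex ^ 'n::finite \<Rightarrow> complex"
  assumes F: "gbound c b M F" and "c' \<le> c" "b \<le> b'" "M \<le> M'"
  shows "gbound c' b' M' F"
  unfolding gbound_def
proof
  fix z :: "complex ^ 'n"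
  have "M * exp (b * (norm (ivec z))\<^sup>2 - c * (norm (rvec z))\<^sup>2) \<le> M' * exp (b' * (norm (ivec z))\<^sup>2 - c' * (norm (rvec z))\<^sup>2)"
    using assms(2-) gbound_nonneg[OF F] by (intro mult_mono) (auto intro!: diff_mono mult_right_mono)
  then show "cmod (F z) \<le> M' * exp (b' * (norm (ivec z))\<^sup>2 - c' * (norm (rvec z))\<^sup>2)"
    by (rule order_trans[OF gboundD[OF F]])
qed

text \<open>Weighted arithmetic-geometric mean: the square of sqrt(e) x plus or minus u / sqrt(e) is
  nonnegative, which bounds 2|<x,u>| by e|x|^2 + |u|^2 / e. Translating a Gaussian thus costs an
  arbitrarily small part of its exponent; e \<le> 1 absorbs |u|^2 into |u|^2 / e.\<close>

lemma norm_add_squared_ge: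
  fixes x u :: "'a::real_inner"
  assumes "0 < e" "e \<le> 1"
  shows "(norm (x + u))\<^sup>2 \<ge> (1 - e) * (norm x)\<^sup>2 - (norm u)\<^sup>2 / e"
    and "(norm (x + u))\<^sup>2 \<le> (1 + e) * (norm x)\<^sup>2 + 2 * (norm u)\<^sup>2 / e"
proof -
  have e: "sqrt e * (1 / sqrt e) = 1" "(sqrt e)\<^sup>2 = e" "(1 / sqrt e)\<^sup>2 = 1 / e"
    using assms by (auto simp: power_divide)
  have sq: "(norm (p *\<^sub>R x + q *\<^sub>R u))\<^sup>2 = p\<^sup>2 * (norm x)\<^sup>2 + 2 * (p * q) * (x \<bullet> u) + q\<^sup>2 * (norm u)\<^sup>2" for p q
    unfolding power2_norm_eq_inner
    by (simp add: inner_add_left inner_add_right inner_commute[of u x] algebra_simps power2_eq_square)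
  have 1: "0 \<le> e * (norm x)\<^sup>2 + 2 * (x \<bullet> u) + (norm u)\<^sup>2 / e"
    using zero_le_power2[of "norm (sqrt e *\<^sub>R x + (1 / sqrt e) *\<^sub>R u)"] unfolding sq e by simp
  have 2: "0 \<le> e * (norm x)\<^sup>2 - 2 * (x \<bullet> u) + (norm u)\<^sup>2 / e"
    using zero_le_power2[of "norm (sqrt e *\<^sub>R x + (- (1 / sqrt e)) *\<^sub>R u)"]
    unfolding sq power2_minus mult_minus_right e by simp
  have 3: "(norm (x + u))\<^sup>2 = (norm x)\<^sup>2 + 2 * (x \<bullet> u) + (norm u)\<^sup>2"
    unfolding power2_norm_eq_inner by (simp add: inner_add_left inner_add_right inner_commute[of u x])
  have 4: "0 \<le> (norm u)\<^sup>2" "(norm u)\<^sup>2 \<le> (norm u)\<^sup>2 / e"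
    using mult_right_mono[of e 1 "(norm u)\<^sup>2"] assms by (auto simp: pos_le_divide_eq mult.commute)
  have 5: "(1 - e) * (norm x)\<^sup>2 = (norm x)\<^sup>2 - e * (norm x)\<^sup>2" "(1 + e) * (norm x)\<^sup>2 = (norm x)\<^sup>2 + e * (norm x)\<^sup>2"
    by (auto simp: left_diff_distrib distrib_right)
  show "(norm (x + u))\<^sup>2 \<ge> (1 - e) * (norm x)\<^sup>2 - (norm u)\<^sup>2 / e"
    unfolding 3 5 using 1 4 by linarith
  have "2 * (norm u)\<^sup>2 / e = (norm u)\<^sup>2 / e + (norm u)\<^sup>2 / e" by simp
  then show "(norm (x + u))\<^sup>2 \<le> (1 + e) * (norm x)\<^sup>2 + 2 * (norm u)\<^sup>2 / e"
    unfolding 3 5 using 2 4 by linarith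
qed

lemma sqrt_prod: "sqrt (prod f A) = (\<Prod>i\<in>A. sqrt (f i))"
  by (induction A rule: infinite_finite_induct) (auto simp: real_sqrt_mult)

text \<open>A point w of the polydisc with radii sqrt(\<alpha> j) satisfies |w|^2 \<le> |\<alpha>|.
  Moving by w therefore costs a factor geometric in |\<alpha>|, and
  \<open>norm_add_squared_ge\<close> with e = 1/2 keeps half of the decay rate, which later absorbs
  the powers of x.\<close>

lemma mi_deriv_gbound:
  fixes F :: "complex ^ 'n::finite \<Rightarrow> complex"
  assumes F: "entire F" and b: "gbound c b M F" and "c > 0" "b > 0"
  shows "cmod (mi_deriv \<alpha> (\<lambda>x. F (cvec x)) x)
    \<le> M * exp ((b + 2 * c) * mi_abs \<alpha> - c / 2 * (norm x)\<^sup>2) * sqrt (mi_fact \<alpha>)"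
proof -
  have "cmod (foldr (\<lambda>j. cpd j ^^ \<alpha> j) coords F (cvec x))
     \<le> M * exp ((b + 2 * c) * mi_abs \<alpha> - c / 2 * (norm x)\<^sup>2) * (\<Prod>j\<in>set coords. sqrt (fact (\<alpha> j)))"
  proof (rule polydisc_cauchy[OF F coords(1)])
    fix w :: "complex ^ 'n"
    assume w: "\<And>j. j \<in> set coords \<Longrightarrow> cmod (w $ j) \<le> sqrt (\<alpha> j)"
    have "(cmod (w $ j))\<^sup>2 \<le> \<alpha> j" for j
      using w[of j] coords(2) power_mono[of "cmod (w $ j)" "sqrt (\<alpha> j)" 2] by auto
    then have "(norm w)\<^sup>2 \<le> mi_abs \<alpha>"
      unfolding norm_sum_squares mi_abs_def of_nat_sum by (intro sum_mono) auto
    then have ri: "(norm (rvec w))\<^sup>2 \<le> mi_abs \<alpha>" "(norm (ivec w))\<^sup>2 \<le> mi_abs \<alpha>"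
      unfolding norm_rvec_ivec using zero_le_power2[of "norm (rvec w)"] zero_le_power2[of "norm (ivec w)"]
      by linarith+
    have "(1 - 1/2) * (norm x)\<^sup>2 - (norm (rvec w))\<^sup>2 / (1/2) \<le> (norm (x + rvec w))\<^sup>2"
      by (rule norm_add_squared_ge) auto
    then have x: "(norm x)\<^sup>2 / 2 - 2 * (norm (rvec w))\<^sup>2 \<le> (norm (x + rvec w))\<^sup>2" by simp
    show "cmod (F (cvec x + w)) \<le> M * exp ((b + 2 * c) * mi_abs \<alpha> - c / 2 * (norm x)\<^sup>2)"
    proof (rule order_trans[OF gboundD[OF b]], rule mult_left_mono[OF _ gbound_nonneg[OF b]])
      have "b * (norm (ivec w))\<^sup>2 \<le> b * mi_abs \<alpha>" "2 * c * (norm (rvec w))\<^sup>2 \<le> 2 * c * mi_abs \<alpha>"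
        "c * ((norm x)\<^sup>2 / 2 - 2 * (norm (rvec w))\<^sup>2) \<le> c * (norm (x + rvec w))\<^sup>2"
        using assms mult_left_mono[OF ri(2), of b] mult_left_mono[OF ri(1), of "2 * c"] mult_left_mono[OF x, of c]
        by simp_all
      moreover have "(b + 2 * c) * mi_abs \<alpha> = b * mi_abs \<alpha> + 2 * c * mi_abs \<alpha>"
        "c * ((norm x)\<^sup>2 / 2 - 2 * (norm (rvec w))\<^sup>2) = c / 2 * (norm x)\<^sup>2 - 2 * c * (norm (rvec w))\<^sup>2"
        by (simp_all add: distrib_right right_diff_distrib)
      ultimately have "b * (norm (ivec w))\<^sup>2 - c * (norm (x + rvec w))\<^sup>2 \<le> (b + 2 * c) * mi_abs \<alpha> - c / 2 * (norm x)\<^sup>2"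
        by linarith
      then show "exp (b * (norm (ivec (cvec x + w)))\<^sup>2 - c * (norm (rvec (cvec x + w)))\<^sup>2)
          \<le> exp ((b + 2 * c) * mi_abs \<alpha> - c / 2 * (norm x)\<^sup>2)"
        by (simp only: rvec_add ivec_add rvec_cvec ivec_cvec add_0 exp_le_cancel_iff)
    qed
  qed
  moreover have "(\<Prod>j\<in>set coords. sqrt (fact (\<alpha> j))) = sqrt (mi_fact \<alpha>)"
    by (simp add: mi_fact_def coords(2) sqrt_prod)
  ultimately show ?thesis by (simp add: mi_deriv_cvec[OF F])
qed

lemma power_div_fact_le_exp:
  assumes "(y::real) \<ge> 0"
  shows "y ^ k / fact k \<le> exp y"
proof -
  have "(\<Sum>n\<in>{k}. y ^ n /\<^sub>R fact n) \<le> (\<Sum>n. y ^ n /\<^sub>R fact n)"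
    using assms by (intro sum_le_suminf summable_exp_generic) auto
  then show ?thesis by (simp add: exp_def divide_inverse_commute)
qed

text \<open>The square root of y^k / k! \<le> exp(y) at y = c x^2. Its Gaussian exp(c/2 x^2) is what
  the surviving half of the decay cancels.\<close>

lemma power_le_sqrt_fact_exp:
  assumes "(c::real) > 0"
  shows "\<bar>x\<bar> ^ k \<le> sqrt (fact k) * (1 / sqrt c) ^ k * exp (c / 2 * x\<^sup>2)"
proof -
  have "(c * x\<^sup>2) ^ k / fact k \<le> exp (c * x\<^sup>2)"
    using assms by (intro power_div_fact_le_exp) auto
  then have "sqrt ((c * x\<^sup>2) ^ k / fact k) \<le> sqrt (exp (c * x\<^sup>2))" by simp
  also have "sqrt (exp (c * x\<^sup>2)) = exp (c / 2 * x\<^sup>2)"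
    by (intro real_sqrt_unique) (auto simp: power2_eq_square[of "exp _"] exp_add[symmetric])
  also have "sqrt ((c * x\<^sup>2) ^ k / fact k) = (sqrt c * \<bar>x\<bar>) ^ k / sqrt (fact k)"
    unfolding real_sqrt_divide real_sqrt_power real_sqrt_mult by (simp flip: real_sqrt_power)
  finally have "(sqrt c * \<bar>x\<bar>) ^ k / sqrt (fact k) \<le> exp (c / 2 * x\<^sup>2)" .
  then have "sqrt c ^ k * \<bar>x\<bar> ^ k \<le> sqrt (fact k) * exp (c / 2 * x\<^sup>2)"
    by (simp add: pos_divide_le_eq power_mult_distrib mult.commute)
  moreover have "sqrt c ^ k > 0" using assms by simp
  ultimately have "\<bar>x\<bar> ^ k \<le> sqrt (fact k) * exp (c / 2 * x\<^sup>2) / sqrt c ^ k"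
    by (simp add: pos_le_divide_eq mult.commute)
  then show ?thesis by (simp add: power_one_over)
qed

lemma mi_power_bound:
  assumes "c > 0"
  shows "\<bar>mi_power x \<beta>\<bar> \<le> sqrt (mi_fact \<beta>) * (1 / sqrt c) ^ mi_abs \<beta> * exp (c / 2 * (norm x)\<^sup>2)"
proof -
  have "\<bar>mi_power x \<beta>\<bar> \<le> (\<Prod>j\<in>UNIV. sqrt (fact (\<beta> j)) * (1 / sqrt c) ^ \<beta> j * exp (c / 2 * (x $ j)\<^sup>2))"
    unfolding mi_power_def abs_prod using power_le_sqrt_fact_exp[OF assms]
    by (intro prod_mono) (auto simp: power_abs)
  also have "\<dots> = sqrt (mi_fact \<beta>) * (1 / sqrt c) ^ mi_abs \<beta> * exp (c / 2 * (norm x)\<^sup>2)"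
    by (simp add: prod.distrib mi_fact_def mi_abs_def sqrt_prod power_sum norm_sum_squares exp_sum sum_distrib_left)
  finally show ?thesis .
qed

lemma mi_fact_pos: "mi_fact \<alpha> > 0"
  by (simp add: mi_fact_def prod_pos)

text \<open>Dominates both geometric rates, exp(b + 2c) per derivative and 1/sqrt(c) per power of x.
  It depends on the class only, so all of \<open>gbound c b\<close> embeds boundedly into one Banach
  space.\<close>

definition gs_h :: "real \<Rightarrow> real \<Rightarrow> real" where "gs_h c b = exp (b + 2 * c) + 1 / sqrt c"

lemma gs_norm_gbound:
  fixes F :: "complex ^ 'n::finite \<Rightarrow> complex"
  assumes F: "entire F" and b: "gbound c b M F" and "c > 0" "b > 0"
  shows "gs_norm (gs_h c b) (\<lambda>x. F (cvec x)) \<le> ennreal M"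
  unfolding gs_norm_def
proof (intro SUP_least ennreal_leI)
  fix \<alpha> \<beta> :: "'n \<Rightarrow> nat" and x :: "real ^ 'n"
  let ?h = "gs_h c b"
  let ?D = "?h ^ (mi_abs \<alpha> + mi_abs \<beta>) * sqrt (mi_fact \<alpha>) * sqrt (mi_fact \<beta>)"
  have h: "exp (b + 2 * c) \<le> ?h" "1 / sqrt c \<le> ?h" "?h > 0"
    using assms by (auto simp: gs_h_def intro: add_pos_pos)
  have "cmod (of_real (mi_power x \<beta>) * mi_deriv \<alpha> (\<lambda>x. F (cvec x)) x)
    \<le> (sqrt (mi_fact \<beta>) * (1 / sqrt c) ^ mi_abs \<beta> * exp (c / 2 * (norm x)\<^sup>2)) *
      (M * exp ((b + 2 * c) * mi_abs \<alpha> - c / 2 * (norm x)\<^sup>2) * sqrt (mi_fact \<alpha>))"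
    unfolding norm_mult norm_of_real
  proof (rule mult_mono)
    show "0 \<le> sqrt (mi_fact \<beta>) * (1 / sqrt c) ^ mi_abs \<beta> * exp (c / 2 * (norm x)\<^sup>2)"
      using assms(3) mi_fact_pos[of \<beta>] by simp
    show "\<bar>mi_power x \<beta>\<bar> \<le> sqrt (mi_fact \<beta>) * (1 / sqrt c) ^ mi_abs \<beta> * exp (c / 2 * (norm x)\<^sup>2)"
      by (rule mi_power_bound[OF assms(3)])
    show "cmod (mi_deriv \<alpha> (\<lambda>x. F (cvec x)) x)
        \<le> M * exp ((b + 2 * c) * mi_abs \<alpha> - c / 2 * (norm x)\<^sup>2) * sqrt (mi_fact \<alpha>)"
      by (rule mi_deriv_gbound[OF assms])
  qed simp
  also have "\<dots> = M * ((1 / sqrt c) ^ mi_abs \<beta> * exp (b + 2 * c) ^ mi_abs \<alpha> * sqrt (mi_fact \<alpha>) * sqrt (mi_fact \<beta>))"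
    by (simp add: exp_diff exp_of_nat2_mult)
  also have "\<dots> \<le> M * (?h ^ mi_abs \<beta> * ?h ^ mi_abs \<alpha> * sqrt (mi_fact \<alpha>) * sqrt (mi_fact \<beta>))"
    using gbound_nonneg[OF b] h assms
    by (intro mult_left_mono mult_right_mono mult_mono power_mono) (use mi_fact_pos[of \<alpha>] mi_fact_pos[of \<beta>] in auto)
  also have "\<dots> = M * ?D" by (simp add: power_add mult_ac)
  finally show "cmod (of_real (mi_power x \<beta>) * mi_deriv \<alpha> (\<lambda>x. F (cvec x)) x) / ?D \<le> M"
    using h mi_fact_pos[of \<alpha>] mi_fact_pos[of \<beta>] by (simp add: pos_divide_le_eq)
qed

lemma gs_h_pos: "c > 0 \<Longrightarrow> gs_h c b > 0"
  by (auto simp: gs_h_def intro: add_pos_pos)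

lemma gs_banach_gbound:
  assumes "entire F" "gbound c b M F" "c > 0" "b > 0"
  shows "(\<lambda>x. F (cvec x)) \<in> gs_banach (gs_h c b)"
  unfolding gs_banach_def infinity_ennreal_def
  using order.strict_trans1[OF gs_norm_gbound[OF assms] ennreal_less_top] smooth_cvec[OF assms(1)]
  by blast

definition gs_entire :: "(complex ^ 'n::finite \<Rightarrow> complex) set" where
  "gs_entire = {F. entire F \<and> (\<exists>c>0. \<exists>b>0. \<exists>M. gbound c b M F)}"

lemma gs_entire_gs_space: "F \<in> gs_entire \<Longrightarrow> (\<lambda>x. F (cvec x)) \<in> gs_space"
  using gs_banach_gbound[of F] gs_h_pos by (fastforce simp: gs_entire_def gs_space_def)

lemma gs_dual_lincomb:
  assumes "f \<in> gs_dual" "F \<in> gs_entire" "G \<in> gs_entire"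
  shows "f (\<lambda>x. a * F (cvec x) + b * G (cvec x)) = a * f (\<lambda>x. F (cvec x)) + b * f (\<lambda>x. G (cvec x))"
proof -
  have lin: "\<forall>\<phi>\<in>gs_space. \<forall>\<psi>\<in>gs_space. \<forall>a b. f (\<lambda>x. a * \<phi> x + b * \<psi> x) = a * f \<phi> + b * f \<psi>"
    using assms(1) by (simp add: gs_dual_def)
  show ?thesis
    by (rule lin[rule_format, OF gs_entire_gs_space[OF assms(2)] gs_entire_gs_space[OF assms(3)]])
qed

lemma gbound_cmult:
  assumes "gbound c b M F"
  shows "gbound c b (cmod a * M) (\<lambda>z. a * F z)"
  unfolding gbound_def norm_mult mult.assoc
  by (intro allI mult_left_mono gboundD[OF assms]) simp

lemma gbound_zero: "gbound c b 0 (\<lambda>z. 0)"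
  by (simp add: gbound_def)

section \<open>Commuting partial derivatives\<close>

lemma smooth_foldr:
  assumes "smooth f" shows "smooth (foldr partial_deriv js f)"
proof -
  have "foldr partial_deriv (is @ js) f differentiable_on UNIV" for "is"
    using assms unfolding smooth_def by blast
  then show ?thesis by (simp add: smooth_def)
qed

lemma smooth_differentiable:
  assumes "smooth f" shows "f differentiable (at x)"
proof -
  have "foldr partial_deriv [] f differentiable_on UNIV"
    using assms unfolding smooth_def by blast
  then show ?thesis by (simp add: differentiable_on_def)
qed

lemma smooth_partial_deriv: "smooth f \<Longrightarrow> smooth (partial_deriv j f)"
  using smooth_foldr[of f "[j]"] by simp

lemma smooth_continuous:
  assumes "smooth f" shows "isCont f x"
  using differentiable_imp_continuous_within[OF smooth_differentiable[OF assms]] .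

lemma smooth_line:
  assumes "smooth f"
  shows "((\<lambda>t. f (x + t *\<^sub>R y)) has_vector_derivative
    (\<Sum>j\<in>UNIV. y $ j *\<^sub>R partial_deriv j f (x + t *\<^sub>R y))) (at t)"
proof -
  obtain D where D: "(f has_derivative D) (at (x + t *\<^sub>R y))"
    using smooth_differentiable[OF assms] by (auto simp: differentiable_def)
  interpret D: linear D using has_derivative_linear[OF D] .
  have line: "((\<lambda>s. f (x + s *\<^sub>R v)) has_vector_derivative D v) (at s)"
    if "x + s *\<^sub>R v = z" "(f has_derivative D) (at z)" for x v s z
  proof -
    have "((\<lambda>s. x + s *\<^sub>R v) has_derivative (\<lambda>h. h *\<^sub>R v)) (at s)"
      by (auto intro!: derivative_eq_intros)
    from has_derivative_compose[OF this, of f D] that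
    show ?thesis by (simp add: has_vector_derivative_def D.scaleR)
  qed
  have "partial_deriv j f (x + t *\<^sub>R y) = D (axis j 1)" for j
    unfolding partial_deriv_def by (intro vector_derivative_at line[OF _ D]) simp
  moreover have "D y = (\<Sum>j\<in>UNIV. y $ j *\<^sub>R D (axis j 1))"
  proof -
    have "y = (\<Sum>j\<in>UNIV. y $ j *\<^sub>R axis j 1)"
      using basis_expansion[of y] by (simp add: scalar_mult_eq_scaleR)
    then have "D y = D (\<Sum>j\<in>UNIV. y $ j *\<^sub>R axis j 1)" by simp
    then show ?thesis by (simp add: D.sum D.scaleR)
  qed
  ultimately show ?thesis using line[OF refl D] by simp
qed

lemma smooth_line_axis:
  assumes "smooth f"
  shows "((\<lambda>t. f (x + t *\<^sub>R axis j 1)) has_vector_derivative partial_deriv j f (x + t *\<^sub>R axis j 1)) (at t)"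
proof -
  have "(\<Sum>i\<in>UNIV. axis j 1 $ i *\<^sub>R partial_deriv i f z) = partial_deriv j f z" for z
    by (simp add: axis_def if_distrib[of "\<lambda>a. a *\<^sub>R _"] cong: if_cong)
  then show ?thesis using smooth_line[OF assms, of x "axis j 1" t] by simp
qed

lemma vector_increment_bound:
  fixes g :: "real \<Rightarrow> 'a::real_normed_vector"
  assumes g: "\<And>t. 0 \<le> t \<Longrightarrow> t \<le> h \<Longrightarrow> (g has_vector_derivative g' t) (at t)"
    and e: "\<And>t. 0 \<le> t \<Longrightarrow> t \<le> h \<Longrightarrow> norm (g' t - u) \<le> e" and h: "h > 0"
  shows "norm (g h - g 0 - h *\<^sub>R u) \<le> h * e"
proof -
  let ?G = "\<lambda>t. g t - t *\<^sub>R u"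
  have "norm (?G h - ?G 0) \<le> e * norm (h - 0)"
  proof (rule differentiable_bound[where S = "{0..h}"])
    fix t assume t: "t \<in> {0..h}"
    have "(?G has_vector_derivative (g' t - u)) (at t)"
      using t by (auto intro!: derivative_eq_intros g)
    then show "(?G has_derivative (\<lambda>d. d *\<^sub>R (g' t - u))) (at t within {0..h})"
      unfolding has_vector_derivative_def by (rule has_derivative_at_withinI)
    show "onorm (\<lambda>d. d *\<^sub>R (g' t - u)) \<le> e"
    proof (rule onorm_le)
      show "norm (d *\<^sub>R (g' t - u)) \<le> e * norm d" for d
        using mult_right_mono[OF e[of t], of "norm d"] t by (simp add: mult.commute)
    qed
  qed (use h in auto)
  moreover have "?G h - ?G 0 = g h - g 0 - h *\<^sub>R u" "e * norm (h - 0) = h * e" using h by auto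
  ultimately show ?thesis by (simp only:)
qed

text \<open>The mean value inequality is used twice: in direction i for
  \<open>partial_deriv j f\<close>, then in direction j for the increment of f over a step in
  direction i. The second difference itself is symmetric in i and j.\<close>

lemma second_difference_bound:
  fixes f :: "real ^ 'n::finite \<Rightarrow> complex" and i j :: 'n
  assumes f: "smooth f" and h: "h > 0"
    and e: "\<And>s t. 0 \<le> s \<Longrightarrow> s \<le> h \<Longrightarrow> 0 \<le> t \<Longrightarrow> t \<le> h \<Longrightarrow>
      cmod (partial_deriv i (partial_deriv j f) (x + t *\<^sub>R axis j 1 + s *\<^sub>R axis i 1) - u) \<le> e"
  shows "cmod (f (x + h *\<^sub>R axis i 1 + h *\<^sub>R axis j 1) - f (x + h *\<^sub>R axis i 1) - f (x + h *\<^sub>R axis j 1) + f x - h\<^sup>2 *\<^sub>R u) \<le> h\<^sup>2 * e"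
proof -
  let ?i = "axis i 1 :: real ^ 'n" and ?j = "axis j 1 :: real ^ 'n"
  have inner: "cmod (partial_deriv j f (x + h *\<^sub>R ?i + t *\<^sub>R ?j) - partial_deriv j f (x + t *\<^sub>R ?j) - h *\<^sub>R u) \<le> h * e"
    if t: "0 \<le> t" "t \<le> h" for t
    using vector_increment_bound[OF smooth_line_axis[OF smooth_partial_deriv[OF f], of j "x + t *\<^sub>R ?j" i] e h] t
    by (simp add: add_ac)
  have "cmod ((f (x + h *\<^sub>R ?i + h *\<^sub>R ?j) - f (x + h *\<^sub>R ?j)) - (f (x + h *\<^sub>R ?i + 0 *\<^sub>R ?j) - f (x + 0 *\<^sub>R ?j)) - h *\<^sub>R (h *\<^sub>R u)) \<le> h * (h * e)"
    by (rule vector_increment_bound[OF has_vector_derivative_diff[OF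
        smooth_line_axis[OF f, of "x + h *\<^sub>R ?i" j] smooth_line_axis[OF f, of x j]] inner h])
  then show ?thesis by (simp add: power2_eq_square mult.assoc algebra_simps)
qed

text \<open>Schwarz's theorem: the symmetric second difference, divided by h^2, approximates both
  mixed derivatives. Reordering matters because \<open>gs_norm\<close> controls derivatives in the
  order of \<open>coords\<close> only, whereas Taylor expansion along lines produces every
  order.\<close>

lemma partial_deriv_commute:
  assumes f: "smooth f"
  shows "partial_deriv i (partial_deriv j f) = partial_deriv j (partial_deriv i f)"
proof
  fix x :: "real ^ 'a"
  define u where "u = partial_deriv i (partial_deriv j f)"
  define v where "v = partial_deriv j (partial_deriv i f)"
  have cont: "isCont u x" "isCont v x"
    unfolding u_def v_def by (auto intro: smooth_continuous smooth_partial_deriv f)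
  have "dist (u x) (v x) \<le> 0 + e" if "e > 0" for e
  proof -
    obtain d1 where d1: "d1 > 0" "\<And>y. dist y x < d1 \<Longrightarrow> dist (u y) (u x) < e / 2"
      using cont(1) \<open>e > 0\<close> unfolding continuous_at_eps_delta by (metis half_gt_zero)
    obtain d2 where d2: "d2 > 0" "\<And>y. dist y x < d2 \<Longrightarrow> dist (v y) (v x) < e / 2"
      using cont(2) \<open>e > 0\<close> unfolding continuous_at_eps_delta by (metis half_gt_zero)
    \<comment> \<open>Steps of length at most h along two axes stay within 2h of x, so a third of
      the smaller radius suffices.\<close>
    define h where "h = min d1 d2 / 3"
    have h: "h > 0" "2 * h < d1" "2 * h < d2" using d1 d2 by (auto simp: h_def min_def)
    have near: "dist (x + t *\<^sub>R axis b 1 + s *\<^sub>R axis a 1) x \<le> 2 * h"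
      if "0 \<le> s" "s \<le> h" "0 \<le> t" "t \<le> h" for s t and a b :: 'a
      using that norm_triangle_ineq[of "t *\<^sub>R axis b (1::real)" "s *\<^sub>R axis a 1"]
      by (simp add: dist_norm add.assoc)
    let ?D = "f (x + h *\<^sub>R axis i 1 + h *\<^sub>R axis j 1) - f (x + h *\<^sub>R axis i 1) - f (x + h *\<^sub>R axis j 1) + f x"
    have 1: "cmod (?D - h\<^sup>2 *\<^sub>R u x) \<le> h\<^sup>2 * (e / 2)"
      using d1(2) le_less_trans[OF near h(2)]
      by (intro second_difference_bound[OF f h(1)]) (simp add: dist_norm u_def less_imp_le)
    have "cmod (f (x + h *\<^sub>R axis j 1 + h *\<^sub>R axis i 1) - f (x + h *\<^sub>R axis j 1) - f (x + h *\<^sub>R axis i 1) + f x - h\<^sup>2 *\<^sub>R v x) \<le> h\<^sup>2 * (e / 2)"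
      using d2(2) le_less_trans[OF near h(3)]
      by (intro second_difference_bound[OF f h(1)]) (simp add: dist_norm v_def less_imp_le)
    then have 2: "cmod (?D - h\<^sup>2 *\<^sub>R v x) \<le> h\<^sup>2 * (e / 2)" by (simp add: algebra_simps)
    have "h\<^sup>2 * cmod (u x - v x) = cmod ((?D - h\<^sup>2 *\<^sub>R v x) - (?D - h\<^sup>2 *\<^sub>R u x))"
      by (simp add: scaleR_diff_right[symmetric])
    also have "\<dots> \<le> h\<^sup>2 * (e / 2) + h\<^sup>2 * (e / 2)"
      by (rule order_trans[OF norm_triangle_ineq4 add_mono[OF 2 1]])
    also have "\<dots> = h\<^sup>2 * e" by simp
    finally show ?thesis using h(1) by (simp add: dist_norm)
  qed
  then show "partial_deriv i (partial_deriv j f) x = partial_deriv j (partial_deriv i f) x"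
    using field_le_epsilon[of "dist (u x) (v x)" 0] by (auto simp: u_def v_def)
qed

lemma foldr_partial_deriv_swap:
  assumes "smooth f"
  shows "foldr partial_deriv (xs @ j # ys) f = partial_deriv j (foldr partial_deriv (xs @ ys) f)"
proof (induction xs)
  case (Cons i xs)
  then show ?case
    using partial_deriv_commute[OF smooth_foldr[OF assms, of "xs @ ys"], of i j] by simp
qed simp

lemma foldr_partial_deriv_mset:
  assumes "smooth f"
  shows "mset js = mset is \<Longrightarrow> foldr partial_deriv js f = foldr partial_deriv is f"
proof (induction js arbitrary: "is")
  case (Cons j js)
  then have "j \<in> set is" by (metis list.set_intros(1) mset_eq_setD)
  then obtain xs ys where is_eq: "is = xs @ j # ys" by (meson split_list)
  with Cons.prems have "mset js = mset (xs @ ys)" by simp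
  then have "foldr partial_deriv js f = foldr partial_deriv (xs @ ys) f" by (rule Cons.IH)
  then show ?case by (simp only: is_eq foldr_partial_deriv_swap[OF assms] foldr_Cons o_apply)
qed simp

lemma mset_mi_list_count:
  "mset (mi_list (count_list js) coords) = mset (js :: 'n::finite list)"
proof (rule multiset_eqI)
  fix i :: 'n
  have "count (mset (mi_list (count_list js) xs)) i = (if i \<in> set xs then count_list js i else 0)"
    if "distinct xs" for xs
    using that by (induction xs) (auto simp: mi_list_def)
  then show "count (mset (mi_list (count_list js) coords)) i = count (mset js) i"
    by (simp add: coords count_mset)
qed

lemma foldr_partial_deriv_eq_mi_deriv:
  assumes "smooth f"
  shows "foldr partial_deriv js f = mi_deriv (count_list js) f"
  unfolding mi_deriv_foldr by (rule foldr_partial_deriv_mset[OF assms]) (simp add: mset_mi_list_count)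

lemma mi_abs_count_list: "mi_abs (count_list js) = length js"
  by (simp add: mi_abs_def sum_count_set)

text \<open>Multinomial coefficients are at least 1. This trades sqrt(\<alpha>!) for a weight that
  depends only on the number of derivatives.\<close>

lemma mi_fact_count_list: "mi_fact (count_list js) \<le> fact (length js)"
proof (induction js)
  case (Cons j js)
  have "mi_fact (count_list (j # js)) = (\<Prod>i\<in>UNIV. (if i = j then real (count_list js j + 1) else 1) * fact (count_list js i))"
    unfolding mi_fact_def by (intro prod.cong) auto
  also have "\<dots> = real (count_list js j + 1) * mi_fact (count_list js)"
    by (simp add: prod.distrib mi_fact_def)
  also have "\<dots> \<le> real (length js + 1) * fact (length js)"
    using Cons mi_fact_pos[of "count_list js"] by (intro mult_mono) (auto simp: count_le_length)
  also have "\<dots> = fact (length (j # js))" by simp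
  finally show ?case .
qed (simp add: mi_fact_def)

section \<open>Gaussian decay of test functions\<close>

text \<open>Sums over all words in the coordinates instead of multi-indices: the n-th derivative
  along a line is such a sum without multinomial coefficients, and one more derivative prepends a
  letter.\<close>

fun lsum :: "nat \<Rightarrow> ('n::finite list \<Rightarrow> complex) \<Rightarrow> complex" where
  "lsum 0 g = g []"
| "lsum (Suc n) g = (\<Sum>j\<in>UNIV. lsum n (\<lambda>js. g (j # js)))"

definition coord_monom :: "complex ^ 'n::finite \<Rightarrow> 'n list \<Rightarrow> complex" where
  "coord_monom z js = prod_list (map (\<lambda>j. z $ j) js)"

lemma coord_monom_simps [simp]: "coord_monom z [] = 1" "coord_monom z (j # js) = z $ j * coord_monom z js"
  by (simp_all add: coord_monom_def)

definition norm1 :: "'a::real_normed_vector ^ 'n::finite \<Rightarrow> real" where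
  "norm1 z = (\<Sum>j\<in>UNIV. norm (z $ j))"

lemma norm1_nonneg: "norm1 z \<ge> 0"
  by (simp add: norm1_def sum_nonneg)

lemma norm1_le: "norm1 z \<le> CARD('n) * norm z" for z :: "'a::real_normed_vector ^ 'n::finite"
proof -
  have "(\<Sum>j\<in>UNIV. norm (z $ j)) \<le> of_nat (card (UNIV :: 'n set)) * norm z"
    by (rule sum_bounded_above) (rule Finite_Cartesian_Product.norm_nth_le)
  then show ?thesis by (simp add: norm1_def)
qed

lemma lsum_cong: "(\<And>js. length js = n \<Longrightarrow> g js = g' js) \<Longrightarrow> lsum n g = lsum n g'"
proof (induction n arbitrary: g g')
  case (Suc n)
  have "lsum n (\<lambda>js. g (j # js)) = lsum n (\<lambda>js. g' (j # js))" for j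
    by (rule Suc.IH) (simp add: Suc.prems)
  then show ?case by simp
qed simp

lemma lsum_sum: "lsum n (\<lambda>js. \<Sum>i\<in>I. g i js) = (\<Sum>i\<in>I. lsum n (g i))"
proof (induction n arbitrary: g)
  case (Suc n)
  show ?case by (simp add: Suc.IH sum.swap[of _ UNIV I])
qed simp

lemma lsum_mult: "lsum n (\<lambda>js. c * g js) = c * lsum n g"
  by (induction n arbitrary: g) (simp_all add: sum_distrib_left)

text \<open>The moduli of the monomials over all words of length n sum to exactly
  \<open>norm1 z ^ n\<close>. This is how the dimension enters the constants, through
  \<open>norm1_le\<close>.\<close>

lemma lsum_bound:
  assumes "\<And>js. length js = n \<Longrightarrow> cmod (g js) \<le> A"
  shows "cmod (lsum n (\<lambda>js. coord_monom z js * g js)) \<le> A * norm1 z ^ n"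
  using assms
proof (induction n arbitrary: g)
  case (Suc n)
  have "cmod (lsum (Suc n) (\<lambda>js. coord_monom z js * g js)) \<le> (\<Sum>j\<in>UNIV. cmod (lsum n (\<lambda>js. coord_monom z (j # js) * g (j # js))))"
    by (simp add: sum_norm_le)
  also have "\<dots> = (\<Sum>j\<in>UNIV. cmod (z $ j) * cmod (lsum n (\<lambda>js. coord_monom z js * g (j # js))))"
    by (simp add: mult.assoc lsum_mult norm_mult)
  also have "\<dots> \<le> (\<Sum>j\<in>UNIV. cmod (z $ j) * (A * norm1 z ^ n))"
    by (intro sum_mono mult_left_mono Suc.IH Suc.prems) auto
  also have "\<dots> = A * norm1 z ^ Suc n"
    by (simp add: norm1_def sum_distrib_right[symmetric] sum_distrib_left[symmetric])
  finally show ?case .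
qed simp

lemma lsum_has_vector_derivative:
  assumes "\<And>js. (g js has_vector_derivative g' js) F"
  shows "((\<lambda>t. lsum n (\<lambda>js. g js t)) has_vector_derivative lsum n g') F"
  using assms
proof (induction n arbitrary: g g')
  case (Suc n)
  show ?case using Suc.prems by (simp, intro has_vector_derivative_sum Suc.IH)
qed simp

lemma entire_monom: "entire (\<lambda>z. coord_monom z js)"
  by (induction js) (auto intro: entire_const entire_mult entire_component)

lemma entire_lsum: "(\<And>js. entire (\<lambda>z. g z js)) \<Longrightarrow> entire (\<lambda>z. lsum n (g z))"
proof (induction n arbitrary: g)
  case (Suc n)
  show ?case using Suc.prems by (simp, intro entire_sum Suc.IH)
qed simp

text \<open>The square of (2s)^n / sqrt(n!) is (4s^2)^n / n!, at most exp(4s^2). The inserted factor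
  2^n leaves a geometric series with sum 2.\<close>

lemma sqrt_fact_series:
  assumes "s \<ge> 0"
  shows "summable (\<lambda>n. s ^ n / sqrt (fact n))" "(\<Sum>n. s ^ n / sqrt (fact n)) \<le> 2 * exp (2 * s\<^sup>2)"
proof -
  have le: "s ^ n / sqrt (fact n) \<le> exp (2 * s\<^sup>2) * (1 / 2) ^ n" for n
  proof -
    have "(4 * s\<^sup>2) ^ n / fact n \<le> exp (4 * s\<^sup>2)"
      by (rule power_div_fact_le_exp) simp
    also have "4 * s\<^sup>2 = (2 * s)\<^sup>2" by (simp add: power2_eq_square)
    also have "((2 * s)\<^sup>2) ^ n / fact n = ((2 * s) ^ n / sqrt (fact n))\<^sup>2"
      by (simp only: power_divide power_mult[symmetric] mult.commute) simp
    also have "exp ((2 * s)\<^sup>2) = (exp (2 * s\<^sup>2))\<^sup>2"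
      by (simp add: exp_double[symmetric])
    finally have "(2 * s) ^ n / sqrt (fact n) \<le> exp (2 * s\<^sup>2)"
      by (rule power2_le_imp_le) simp
    then show ?thesis by (simp add: power_mult_distrib power_one_over field_simps)
  qed
  have geo: "summable (\<lambda>n. exp (2 * s\<^sup>2) * (1 / 2 :: real) ^ n)"
    by (intro summable_mult summable_geometric) simp
  show sm: "summable (\<lambda>n. s ^ n / sqrt (fact n))"
    by (rule summable_comparison_test[OF _ geo]) (use assms le in auto)
  have "(\<Sum>n. s ^ n / sqrt (fact n)) \<le> (\<Sum>n. exp (2 * s\<^sup>2) * (1 / 2) ^ n)"
    by (rule suminf_le[OF le sm geo])
  also have "\<dots> = 2 * exp (2 * s\<^sup>2)"
    by (subst suminf_mult) (auto simp: suminf_geometric)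
  finally show "(\<Sum>n. s ^ n / sqrt (fact n)) \<le> 2 * exp (2 * s\<^sup>2)" .
qed

text \<open>Equivalently, the central binomial coefficient is at most 4^m. It replaces sqrt((2m)!)
  by 2^m m!, so that the bounds on even powers can be summed to an exponential.\<close>

lemma fact_double_le: "fact (2 * m) \<le> ((2 ^ m * fact m)\<^sup>2 :: real)"
proof (induction m)
  case (Suc m)
  have "fact (2 * Suc m) = (real (2 * m + 2) * real (2 * m + 1)) * fact (2 * m)"
    by (simp add: algebra_simps)
  also have "\<dots> \<le> (real (2 * m + 2) * real (2 * m + 2)) * (2 ^ m * fact m)\<^sup>2"
    by (intro mult_mono Suc.IH) auto
  also have "\<dots> = (2 ^ Suc m * fact (Suc m))\<^sup>2"
    by (simp add: power2_eq_square algebra_simps)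
  finally show ?case .
qed simp

lemma gs_norm_bound:
  fixes \<phi> :: "real ^ 'n::finite \<Rightarrow> complex" and h :: real
  assumes "\<phi> \<in> gs_banach h" "h > 0"
  obtains C where "C \<ge> 0" "\<And>\<alpha> \<beta> x. \<bar>mi_power x \<beta>\<bar> * cmod (mi_deriv \<alpha> \<phi> x)
    \<le> C * (h ^ (mi_abs \<alpha> + mi_abs \<beta>) * sqrt (mi_fact \<alpha>) * sqrt (mi_fact \<beta>))"
proof
  define C where "C = enn2real (gs_norm h \<phi>)"
  show "C \<ge> 0" by (simp add: C_def)
  fix \<alpha> \<beta> :: "'n \<Rightarrow> nat" and x
  let ?D = "h ^ (mi_abs \<alpha> + mi_abs \<beta>) * sqrt (mi_fact \<alpha>) * sqrt (mi_fact \<beta>)"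
  have "ennreal (cmod (of_real (mi_power x \<beta>) * mi_deriv \<alpha> \<phi> x) / ?D) \<le> gs_norm h \<phi>"
    unfolding gs_norm_def by (intro SUP_upper2[of \<alpha>] SUP_upper2[of \<beta>] SUP_upper2[of x]) auto
  also have "gs_norm h \<phi> = ennreal C"
    using assms(1) by (simp add: C_def gs_banach_def)
  finally have "cmod (of_real (mi_power x \<beta>) * mi_deriv \<alpha> \<phi> x) / ?D \<le> C"
    using \<open>C \<ge> 0\<close> by (simp add: ennreal_le_iff)
  moreover have "?D > 0" using assms(2) mi_fact_pos[of \<alpha>] mi_fact_pos[of \<beta>] by simp
  ultimately show "\<bar>mi_power x \<beta>\<bar> * cmod (mi_deriv \<alpha> \<phi> x) \<le> C * ?D"
    by (simp add: pos_divide_le_eq norm_mult)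
qed

text \<open>Only even powers of the largest coordinate of x are used. Summing their bounds controls
  exp(y) times the derivative, with y as defined in the proof, and |x|^2 is at most the dimension
  times the square of that coordinate.\<close>

lemma gs_gaussian_decay:
  fixes \<phi> :: "real ^ 'n::finite \<Rightarrow> complex" and h :: real
  assumes \<phi>: "\<phi> \<in> gs_banach h" and h: "h > 0"
  obtains C where "C \<ge> 0" "\<And>\<alpha> x. cmod (mi_deriv \<alpha> \<phi> x)
    \<le> C * h ^ mi_abs \<alpha> * sqrt (mi_fact \<alpha>) * exp (- (1 / (4 * CARD('n) * h\<^sup>2)) * (norm x)\<^sup>2)"
proof -
  obtain C where C: "C \<ge> 0" and bnd: "\<And>\<alpha> \<beta> x. \<bar>mi_power x \<beta>\<bar> * cmod (mi_deriv \<alpha> \<phi> x)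
    \<le> C * (h ^ (mi_abs \<alpha> + mi_abs \<beta>) * sqrt (mi_fact \<alpha>) * sqrt (mi_fact \<beta>))"
    using gs_norm_bound[OF \<phi> h] by blast
  have "cmod (mi_deriv \<alpha> \<phi> x) \<le> (2 * C) * h ^ mi_abs \<alpha> * sqrt (mi_fact \<alpha>) * exp (- (1 / (4 * CARD('n) * h\<^sup>2)) * (norm x)\<^sup>2)"
    for \<alpha> x
  proof -
    define D where "D = cmod (mi_deriv \<alpha> \<phi> x)"
    define E where "E = C * h ^ mi_abs \<alpha> * sqrt (mi_fact \<alpha>)"
    have E: "E \<ge> 0" using C h mi_fact_pos[of \<alpha>] by (simp add: E_def)
    obtain j where j: "\<And>i. \<bar>x $ i\<bar> \<le> \<bar>x $ j\<bar>"
    proof -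
      have "Max (range (\<lambda>i. \<bar>x $ i\<bar>)) \<in> range (\<lambda>i. \<bar>x $ i\<bar>)" by (intro Max_in) auto
      then obtain j where j: "Max (range (\<lambda>i. \<bar>x $ i\<bar>)) = \<bar>x $ j\<bar>" by (rule imageE)
      have "\<bar>x $ i\<bar> \<le> Max (range (\<lambda>i. \<bar>x $ i\<bar>))" for i by (intro Max_ge) auto
      then show ?thesis using that[of j] unfolding j by blast
    qed
    \<comment> \<open>Of the 4^m coming from the 4, one factor 2^m cancels that in sqrt((2m)!) \<le>
      2^m m!, and the other leaves the summable (1/2)^m.\<close>
    define y where "y = (x $ j)\<^sup>2 / (4 * h\<^sup>2)"
    have tm: "y ^ m / fact m * D \<le> E * (1 / 2) ^ m" for m
    proof -
      let ?\<beta> = "\<lambda>i. if i = j then 2 * m else 0"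
      have "mi_power x ?\<beta> = (\<Prod>i\<in>UNIV. if i = j then (x $ j) ^ (2 * m) else 1)"
        unfolding mi_power_def by (intro prod.cong) auto
      then have p: "mi_power x ?\<beta> = (x $ j) ^ (2 * m)" by simp
      have "mi_fact ?\<beta> = (\<Prod>i\<in>UNIV. if i = j then fact (2 * m) else 1)"
        unfolding mi_fact_def by (intro prod.cong) auto
      then have f: "mi_fact ?\<beta> = fact (2 * m)" by simp
      have "(x $ j) ^ (2 * m) * D \<le> C * (h ^ (mi_abs \<alpha> + 2 * m) * sqrt (mi_fact \<alpha>) * sqrt (fact (2 * m)))"
        using bnd[of x ?\<beta> \<alpha>] unfolding p f by (simp add: D_def mi_abs_def power_even_abs)
      also have "sqrt (fact (2 * m)) \<le> 2 ^ m * fact m"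
        using real_sqrt_le_mono[OF fact_double_le[of m]] by (simp add: real_sqrt_abs)
      then have "C * (h ^ (mi_abs \<alpha> + 2 * m) * sqrt (mi_fact \<alpha>) * sqrt (fact (2 * m)))
        \<le> C * (h ^ (mi_abs \<alpha> + 2 * m) * sqrt (mi_fact \<alpha>) * (2 ^ m * fact m))"
        using C h mi_fact_pos[of \<alpha>] by (intro mult_left_mono) auto
      finally have "(x $ j) ^ (2 * m) * D \<le> E * (h ^ (2 * m) * 2 ^ m * fact m)"
        by (simp add: E_def power_add mult_ac)
      moreover have "y ^ m = (x $ j) ^ (2 * m) / (h ^ (2 * m) * (2 ^ m * 2 ^ m))"
        unfolding y_def power_divide power_mult_distrib power_mult[symmetric]
        by (simp flip: power_mult_distrib)
      ultimately have "y ^ m * D \<le> E * (h ^ (2 * m) * 2 ^ m * fact m) / (h ^ (2 * m) * (2 ^ m * 2 ^ m))"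
        by (simp only: times_divide_eq_left) (intro divide_right_mono, use h in auto)
      also have "\<dots> = E * (1 / 2) ^ m * fact m"
        using h by (simp add: power_one_over)
      finally show ?thesis by (simp add: pos_divide_le_eq)
    qed
    have ex: "(\<lambda>m. y ^ m / fact m * D) sums (exp y * D)"
      using exp_converges[of y] by (intro sums_mult2) (simp add: divide_inverse_commute)
    have geo: "(\<lambda>m. E * (1 / 2) ^ m) sums (E * 2)"
      using geometric_sums[of "1 / 2 :: real"] by (intro sums_mult) simp
    have "exp y * D \<le> E * 2"
      by (rule sums_le[OF tm ex geo])
    then have "D \<le> 2 * E * exp (- y)"
      by (simp add: exp_minus field_simps)
    also have "\<dots> \<le> 2 * E * exp (- (1 / (4 * CARD('n) * h\<^sup>2)) * (norm x)\<^sup>2)"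
    proof -
      have "(norm x)\<^sup>2 \<le> (\<Sum>i\<in>(UNIV :: 'n set). (x $ j)\<^sup>2)"
        unfolding norm_sum_squares using j by (intro sum_mono) (simp add: abs_le_square_iff)
      then have "(norm x)\<^sup>2 \<le> CARD('n) * (x $ j)\<^sup>2" by simp
      then have "(1 / (4 * CARD('n) * h\<^sup>2)) * (norm x)\<^sup>2 \<le> (1 / (4 * CARD('n) * h\<^sup>2)) * (CARD('n) * (x $ j)\<^sup>2)"
        by (intro mult_left_mono) auto
      also have "\<dots> = y" by (simp add: y_def)
      finally show ?thesis using E by (intro mult_left_mono) auto
    qed
    finally show ?thesis by (simp add: D_def E_def mult_ac)
  qed
  with C show ?thesis by (intro that[of "2 * C"]) auto
qed

text \<open>The real Taylor formula is applied to real and imaginary parts separately, whence the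
  factor 2.\<close>

lemma vector_Taylor:
  fixes u :: "nat \<Rightarrow> real \<Rightarrow> complex"
  assumes u: "\<And>n t. (u n has_vector_derivative u (Suc n) t) (at t)"
    and B: "\<And>t. t \<in> {0..1} \<Longrightarrow> cmod (u (Suc n) t) \<le> B"
  shows "cmod (u 0 1 - (\<Sum>i\<le>n. u i 0 / fact i)) \<le> 2 * B / fact n"
proof -
  have part: "\<bar>p (u 0 1) - (\<Sum>i\<le>n. p (u i 0) / fact i)\<bar> \<le> B / fact n"
    if p: "bounded_linear p" "\<And>z. \<bar>p z\<bar> \<le> cmod z" for p :: "complex \<Rightarrow> real"
  proof -
    have "norm (p (u 0 1) - (\<Sum>i\<le>n. p (u i 0) * (1 - 0) ^ i / fact i)) \<le> B * norm (1 - 0 :: real) ^ Suc n / fact n"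
    proof (rule field_Taylor[where S = "{0..1}" and f = "\<lambda>i t. p (u i t)"])
      show "((\<lambda>t. p (u i t)) has_field_derivative p (u (Suc i) t)) (at t within {0..1})" for i t
        unfolding has_real_derivative_iff_has_vector_derivative
        by (rule bounded_linear.has_vector_derivative[OF p(1) has_vector_derivative_at_within[OF u]])
      show "norm (p (u (Suc n) t)) \<le> B" if "t \<in> {0..1}" for t
        using order_trans[OF p(2) B[OF that]] by simp
    qed auto
    then show ?thesis by simp
  qed
  have q: "Re (z / fact i) = Re z / fact i" "Im (z / fact i) = Im z / fact i" for z i
    using Re_divide_of_real[of z "fact i"] Im_divide_of_real[of z "fact i"] by simp_all
  have "Re (u 0 1 - (\<Sum>i\<le>n. u i 0 / fact i)) = Re (u 0 1) - (\<Sum>i\<le>n. Re (u i 0) / fact i)"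
    "Im (u 0 1 - (\<Sum>i\<le>n. u i 0 / fact i)) = Im (u 0 1) - (\<Sum>i\<le>n. Im (u i 0) / fact i)"
    by (simp_all add: q)
  then show ?thesis
    using part[OF bounded_linear_Re abs_Re_le_cmod] part[OF bounded_linear_Im abs_Im_le_cmod]
      cmod_le[of "u 0 1 - (\<Sum>i\<le>n. u i 0 / fact i)"] by linarith
qed

text \<open>Complex derivatives may be computed along real increments. This reads the Taylor
  coefficients of the extension on a line off the real derivatives of the test function.\<close>

lemma higher_deriv_real_axis:
  assumes g: "g holomorphic_on UNIV" and eq: "\<And>t. g (of_real t) = u 0 t"
    and u: "\<And>n t. (u n has_vector_derivative u (Suc n) t) (at t)"
  shows "(deriv ^^ n) g (of_real t) = u n t"
proof (induction n arbitrary: t)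
  case (Suc n)
  have "((deriv ^^ n) g has_field_derivative (deriv ^^ Suc n) g (of_real t)) (at (of_real t))"
    using holomorphic_derivI[OF holomorphic_higher_deriv[OF g open_UNIV], of "of_real t" n] by simp
  then have "((\<lambda>t. (deriv ^^ n) g (of_real t)) has_vector_derivative (deriv ^^ Suc n) g (of_real t)) (at t)"
    by (rule has_vector_derivative_real_field)
  then have "(u n has_vector_derivative (deriv ^^ Suc n) g (of_real t)) (at t)"
    unfolding Suc.IH by simp
  from vector_derivative_unique_at[OF this u] show ?case .
qed (simp add: eq)

section \<open>Entire extensions of test functions and the dual space\<close>

text \<open>The Taylor series at 0 defines F, and a remainder estimate identifies it with \<phi> on
  real points. That series does not show the decay in x, so the growth bound uses a second
  expansion, at x = Re z in direction y = Im z: its coefficients carry exp(-c|x|^2), and its value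
  at t = \<i> is F z.\<close>

lemma entire_extension:
  fixes \<phi> :: "real ^ 'n::finite \<Rightarrow> complex"
  assumes \<phi>: "smooth \<phi>" and "C \<ge> 0" "h > 0" "c > 0"
    and bnd: "\<And>js x. cmod (foldr partial_deriv js \<phi> x) \<le> C * h ^ length js * sqrt (fact (length js)) * exp (- c * (norm x)\<^sup>2)"
  obtains F where "entire F" "\<And>x. F (cvec x) = \<phi> x" "gbound c (2 * h\<^sup>2 * (CARD('n))\<^sup>2) (2 * C) F"
proof -
  define P where "P n z = lsum n (\<lambda>js. coord_monom z js * foldr partial_deriv js \<phi> 0) / fact n" for n z
  define F where "F z = (\<Sum>n. P n z)" for z
  \<comment> \<open>The candidate for the n-th derivative of \<phi> (x + t y) in t, written over
    words by the chain rule.\<close>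
  define u where "u x y n t = lsum n (\<lambda>js. coord_monom (cvec y) js * foldr partial_deriv js \<phi> (x + t *\<^sub>R y))" for x y n t
  have div: "C * h ^ n * sqrt (fact n) * E * s ^ n / fact n = C * E * ((h * s) ^ n / sqrt (fact n))" for n E s
  proof -
    have "sqrt (fact n) / fact n = 1 / sqrt (fact n)"
      using real_sqrt_mult_self[of "fact n"] by (simp add: field_simps)
    then show ?thesis by (simp add: power_mult_distrib field_simps)
  qed
  have u: "(u x y n has_vector_derivative u x y (Suc n) t) (at t)" for x y n t
  proof -
    have "((\<lambda>t. u x y n t) has_vector_derivative
      lsum n (\<lambda>js. coord_monom (cvec y) js * (\<Sum>j\<in>UNIV. y $ j *\<^sub>R partial_deriv j (foldr partial_deriv js \<phi>) (x + t *\<^sub>R y)))) (at t)"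
      unfolding u_def
      by (intro lsum_has_vector_derivative has_vector_derivative_mult_right smooth_line smooth_foldr \<phi>)
    also have "lsum n (\<lambda>js. coord_monom (cvec y) js * (\<Sum>j\<in>UNIV. y $ j *\<^sub>R partial_deriv j (foldr partial_deriv js \<phi>) (x + t *\<^sub>R y)))
      = u x y (Suc n) t"
      by (simp add: u_def sum_distrib_left lsum_sum scaleR_conv_of_real mult_ac)
    finally show ?thesis .
  qed
  have ubnd: "cmod (u x y n t) \<le> C * h ^ n * sqrt (fact n) * exp (- c * (norm (x + t *\<^sub>R y))\<^sup>2) * norm1 y ^ n" for x y n t
  proof -
    have "norm1 (cvec y) = norm1 y" by (simp add: norm1_def)
    moreover have "cmod (u x y n t) \<le> C * h ^ n * sqrt (fact n) * exp (- c * (norm (x + t *\<^sub>R y))\<^sup>2) * norm1 (cvec y) ^ n"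
      unfolding u_def by (rule lsum_bound) (use bnd in auto)
    ultimately show ?thesis by simp
  qed
  have Pbnd: "cmod (P n z) \<le> C * ((h * norm1 z) ^ n / sqrt (fact n))" for n z
  proof -
    have "cmod (lsum n (\<lambda>js. coord_monom z js * foldr partial_deriv js \<phi> 0)) \<le> C * h ^ n * sqrt (fact n) * 1 * norm1 z ^ n"
      using bnd[of _ 0] by (intro lsum_bound) auto
    then have "cmod (P n z) \<le> C * h ^ n * sqrt (fact n) * 1 * norm1 z ^ n / fact n"
      unfolding P_def norm_divide by (simp add: divide_right_mono)
    then show ?thesis unfolding div by simp
  qed
  have F: "entire F"
  proof (rule entire_uniform_limit[where F = "\<lambda>n z. \<Sum>i<n. P i z"])
    have "entire (P i)" for i
      unfolding P_def divide_inverse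
      by (intro entire_mult entire_const entire_lsum entire_monom)
    then show "entire (\<lambda>z. \<Sum>i<n. P i z)" for n by (intro entire_sum)
    fix R :: real
    let ?s = "h * (CARD('n) * max R 0)"
    show "uniform_limit (cball 0 R) (\<lambda>n z. \<Sum>i<n. P i z) F sequentially"
      unfolding F_def
    proof (rule Weierstrass_m_test)
      fix n and z :: "complex ^ 'n" assume "z \<in> cball 0 R"
      then have "norm1 z \<le> CARD('n) * max R 0"
        by (intro order_trans[OF norm1_le] mult_left_mono) auto
      then have "C * ((h * norm1 z) ^ n / sqrt (fact n)) \<le> C * (?s ^ n / sqrt (fact n))"
        using assms norm1_nonneg[of z] by (intro mult_left_mono divide_right_mono power_mono) auto
      then show "cmod (P n z) \<le> C * (?s ^ n / sqrt (fact n))"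
        by (rule order_trans[OF Pbnd])
    next
      show "summable (\<lambda>n. C * (?s ^ n / sqrt (fact n)))"
        using assms by (intro summable_mult sqrt_fact_series) auto
    qed
  qed
  have eq: "F (cvec x) = \<phi> x" for x
  proof -
    have P: "P n (cvec x) = u 0 x n 0 / fact n" for n by (simp add: P_def u_def)
    have "(\<lambda>n. P n (cvec x)) sums \<phi> x"
      unfolding sums_def_le
    proof (rule LIM_zero_cancel, rule Lim_null_comparison)
      let ?B = "\<lambda>n. C * h ^ n * sqrt (fact n) * norm1 x ^ n"
      let ?s = "h * norm1 x"
      have "cmod (u 0 x 0 1 - (\<Sum>i\<le>n. u 0 x i 0 / fact i)) \<le> 2 * ?B (Suc n) / fact n" for n
      proof (rule vector_Taylor[where u = "u 0 x", OF u])
        fix t :: real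
        have "exp (- c * (norm (0 + t *\<^sub>R x))\<^sup>2) \<le> 1" using assms by simp
        then have "?B (Suc n) * exp (- c * (norm (0 + t *\<^sub>R x))\<^sup>2) \<le> ?B (Suc n) * 1"
          using assms norm1_nonneg[of x] by (intro mult_left_mono) auto
        then show "cmod (u 0 x (Suc n) t) \<le> ?B (Suc n)"
          using ubnd[of 0 x "Suc n" t] by (simp add: mult_ac)
      qed
      moreover have "2 * ?B (Suc n) / fact n \<le> 2 * C * ((2 * ?s) ^ Suc n / sqrt (fact (Suc n)))" for n
      proof -
        \<comment> \<open>The Taylor remainder divides a derivative of order n + 1 by n! only. The
          stray factor n + 1 is absorbed by doubling the argument of the series.\<close>
        have "real (Suc n) \<le> 2 ^ Suc n"
          using of_nat_mono[OF less_imp_le[OF less_exp[of "Suc n"]], where 'a = real] by simp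
        have fs: "2 * real (Suc n) * (X / fact (Suc n)) = 2 * X / fact n" for X :: real
          by (simp del: of_nat_Suc)
        have "2 * ?B (Suc n) / fact n = 2 * real (Suc n) * (C * h ^ Suc n * sqrt (fact (Suc n)) * 1 * norm1 x ^ Suc n / fact (Suc n))"
          unfolding fs by simp
        also have "\<dots> = 2 * real (Suc n) * (C * (?s ^ Suc n / sqrt (fact (Suc n))))"
          unfolding div by simp
        also have "\<dots> \<le> 2 * 2 ^ Suc n * (C * (?s ^ Suc n / sqrt (fact (Suc n))))"
          using assms norm1_nonneg[of x] \<open>real (Suc n) \<le> 2 ^ Suc n\<close>
          by (intro mult_right_mono mult_left_mono mult_nonneg_nonneg divide_nonneg_nonneg) auto
        also have "\<dots> = 2 * C * ((2 * ?s) ^ Suc n / sqrt (fact (Suc n)))"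
          by (simp only: power_mult_distrib) simp
        finally show ?thesis .
      qed
      moreover have "u 0 x 0 1 = \<phi> x" by (simp add: u_def)
      ultimately have "cmod (\<phi> x - (\<Sum>i\<le>n. P i (cvec x))) \<le> 2 * C * ((2 * ?s) ^ Suc n / sqrt (fact (Suc n)))" for n
        unfolding P using order_trans by fastforce
      then show "\<forall>\<^sub>F n in sequentially. norm ((\<Sum>i\<le>n. P i (cvec x)) - \<phi> x) \<le> 2 * C * ((2 * ?s) ^ Suc n / sqrt (fact (Suc n)))"
        by (simp add: norm_minus_commute)
      have "(\<lambda>n. (2 * ?s) ^ n / sqrt (fact n)) \<longlonglongrightarrow> 0"
        using assms norm1_nonneg[of x] by (intro summable_LIMSEQ_zero sqrt_fact_series) auto
      then show "(\<lambda>n. 2 * C * ((2 * ?s) ^ Suc n / sqrt (fact (Suc n)))) \<longlonglongrightarrow> 0"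
        by (intro tendsto_mult_right_zero LIMSEQ_Suc)
    qed
    then show ?thesis by (simp add: F_def sums_iff)
  qed
  have "gbound c (2 * h\<^sup>2 * (CARD('n))\<^sup>2) (2 * C) F"
    unfolding gbound_def
  proof
    fix z :: "complex ^ 'n"
    define x y where "x = rvec z" and "y = ivec z"
    define g where "g t = F (cvec x + t *s cvec y)" for t
    have g: "g holomorphic_on UNIV" unfolding g_def by (rule entire_line[OF F])
    have gu: "(deriv ^^ n) g (of_real t) = u x y n t" for n t
      by (rule higher_deriv_real_axis[where u = "u x y", OF g _ u])
        (simp add: g_def u_def eq cvec_add[symmetric] cvec_scaleR[symmetric])
    let ?s = "h * norm1 y"
    have "(\<lambda>n. (deriv ^^ n) g 0 / fact n * (\<i> - 0) ^ n) sums g \<i>"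
      by (rule holomorphic_power_series[of _ _ 2]) (auto intro: holomorphic_on_subset[OF g])
    then have "(\<lambda>n. u x y n 0 / fact n * \<i> ^ n) sums g \<i>"
      using gu[of _ 0] by simp
    then have "cmod (g \<i>) = cmod (\<Sum>n. u x y n 0 / fact n * \<i> ^ n)"
      by (simp add: sums_iff)
    also have "\<dots> \<le> (\<Sum>n. C * exp (- c * (norm x)\<^sup>2) * (?s ^ n / sqrt (fact n)))"
    proof (rule norm_suminf_le)
      show "cmod (u x y n 0 / fact n * \<i> ^ n) \<le> C * exp (- c * (norm x)\<^sup>2) * (?s ^ n / sqrt (fact n))" for n
        using divide_right_mono[OF ubnd[of x y n 0], of "fact n"] unfolding div
        by (simp add: norm_mult norm_divide norm_power)
      show "summable (\<lambda>n. C * exp (- c * (norm x)\<^sup>2) * (?s ^ n / sqrt (fact n)))"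
        using assms norm1_nonneg[of y] by (intro summable_mult sqrt_fact_series) auto
    qed
    also have "\<dots> = C * exp (- c * (norm x)\<^sup>2) * (\<Sum>n. ?s ^ n / sqrt (fact n))"
      using assms norm1_nonneg[of y] by (intro suminf_mult sqrt_fact_series) auto
    also have "\<dots> \<le> C * exp (- c * (norm x)\<^sup>2) * (2 * exp (2 * ?s\<^sup>2))"
      using assms norm1_nonneg[of y] by (intro mult_left_mono sqrt_fact_series) auto
    also have "\<dots> = 2 * C * exp (2 * ?s\<^sup>2 - c * (norm x)\<^sup>2)"
      by (simp add: exp_diff exp_minus field_simps)
    also have "\<dots> \<le> 2 * C * exp ((2 * h\<^sup>2 * (CARD('n))\<^sup>2) * (norm y)\<^sup>2 - c * (norm x)\<^sup>2)"
    proof -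
      have "?s\<^sup>2 \<le> (h * (CARD('n) * norm y))\<^sup>2"
        using assms norm1_nonneg[of y] norm1_le[of y] by (intro power_mono mult_left_mono) auto
      then show ?thesis using assms by (intro mult_left_mono) (auto simp: power_mult_distrib)
    qed
    also have "g \<i> = F z" by (simp add: g_def x_def y_def cvec_decompose[symmetric])
    finally show "cmod (F z) \<le> 2 * C * exp ((2 * h\<^sup>2 * (CARD('n))\<^sup>2) * (norm (ivec z))\<^sup>2 - c * (norm (rvec z))\<^sup>2)"
      by (simp add: x_def y_def)
  qed
  with F eq show ?thesis by (rule that)
qed

lemma gs_space_extension:
  fixes \<phi> :: "real ^ 'n::finite \<Rightarrow> complex"
  assumes "\<phi> \<in> gs_space"
  obtains F where "F \<in> gs_entire" "\<phi> = (\<lambda>x. F (cvec x))"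
proof -
  obtain h where h: "h > 0" "\<phi> \<in> gs_banach h" using assms by (auto simp: gs_space_def)
  have sm: "smooth \<phi>" using h by (simp add: gs_banach_def)
  define c where "c = 1 / (4 * CARD('n) * h\<^sup>2)"
  have c: "c > 0" using h by (simp add: c_def)
  obtain C where C: "C \<ge> 0" and b: "\<And>\<alpha> x. cmod (mi_deriv \<alpha> \<phi> x)
    \<le> C * h ^ mi_abs \<alpha> * sqrt (mi_fact \<alpha>) * exp (- c * (norm x)\<^sup>2)"
    using gs_gaussian_decay[OF h(2,1)] unfolding c_def by blast
  have "cmod (foldr partial_deriv js \<phi> x) \<le> C * h ^ length js * sqrt (fact (length js)) * exp (- c * (norm x)\<^sup>2)" for js x
  proof -
    have "cmod (foldr partial_deriv js \<phi> x) \<le> C * h ^ length js * sqrt (mi_fact (count_list js)) * exp (- c * (norm x)\<^sup>2)"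
      using b[of "count_list js" x] by (simp add: foldr_partial_deriv_eq_mi_deriv[OF sm] mi_abs_count_list)
    also have "\<dots> \<le> C * h ^ length js * sqrt (fact (length js)) * exp (- c * (norm x)\<^sup>2)"
      using C h(1) mi_fact_count_list[of js] by (intro mult_right_mono mult_left_mono) auto
    finally show ?thesis .
  qed
  from entire_extension[OF sm C h(1) c this] obtain F where F: "entire F" "\<And>x. F (cvec x) = \<phi> x"
    "gbound c (2 * h\<^sup>2 * (CARD('n))\<^sup>2) (2 * C) F" by blast
  have "2 * h\<^sup>2 * (CARD('n))\<^sup>2 > 0" using h by simp
  with F c have "F \<in> gs_entire" unfolding gs_entire_def by blast
  then show ?thesis using that F(2) by (metis (no_types, lifting) ext)
qed

lemma gs_entire_lincomb:
  assumes "F \<in> gs_entire" "G \<in> gs_entire"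
  shows "(\<lambda>z. a * F z + b * G z) \<in> gs_entire"
proof -
  obtain c b1 M c' b' M' where F: "entire F" "gbound c b1 M F" "c > 0" "b1 > 0"
    and G: "entire G" "gbound c' b' M' G" "c' > 0" "b' > 0"
    using assms by (auto simp: gs_entire_def)
  have "gbound (min c c') (max b1 b') (cmod a * M) (\<lambda>z. a * F z)" "gbound (min c c') (max b1 b') (cmod b * M') (\<lambda>z. b * G z)"
    by (auto intro: gbound_mono[OF gbound_cmult[OF F(2)]] gbound_mono[OF gbound_cmult[OF G(2)]])
  then have "gbound (min c c') (max b1 b') (cmod a * M + cmod b * M') (\<lambda>z. a * F z + b * G z)"
    unfolding gbound_def distrib_right by (blast intro: order_trans[OF norm_triangle_ineq add_mono])
  moreover have "entire (\<lambda>z. a * F z + b * G z)"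
    by (intro entire_add entire_mult entire_const F G)
  ultimately show ?thesis using F G unfolding gs_entire_def
    by (intro CollectI conjI exI[of _ "min c c'"] exI[of _ "max b1 b'"] exI[of _ "cmod a * M + cmod b * M'"]) auto
qed

text \<open>Two test functions may belong to different steps h. For their extensions it is enough to
  merge two Gaussian bounds.\<close>

lemma abs_convex_gs_space: "abs_convex (gs_space :: (real ^ 'n::finite \<Rightarrow> complex) set)"
  unfolding abs_convex_def
proof (intro ballI allI impI)
  fix f g :: "real ^ 'n \<Rightarrow> complex" and a b
  assume "f \<in> gs_space" "g \<in> gs_space"
  then obtain F G where "F \<in> gs_entire" "f = (\<lambda>x. F (cvec x))" "G \<in> gs_entire" "g = (\<lambda>x. G (cvec x))"
    by (meson gs_space_extension)
  then show "(\<lambda>x. a * f x + b * g x) \<in> gs_space"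
    using gs_entire_gs_space[OF gs_entire_lincomb[of F G a b]] by simp
qed

lemma gs_nhd0_gs_space: "gs_nhd0 gs_space"
  unfolding gs_nhd0_def
proof (intro conjI allI impI abs_convex_gs_space subset_refl)
  fix h :: real assume "h > 0"
  then show "\<exists>\<epsilon>>0. {f \<in> gs_banach h. gs_norm h f < ennreal \<epsilon>} \<subseteq> gs_space"
    by (intro exI[of _ 1]) (auto simp: gs_space_def)
qed

lemma zero_gs_entire: "(\<lambda>z. 0) \<in> gs_entire"
proof -
  have "gbound 1 1 0 (\<lambda>z. 0)" by (rule gbound_zero)
  then show ?thesis unfolding gs_entire_def by (intro CollectI conjI entire_const exI[of _ 1] exI[of _ 0]) auto
qed

lemma topspace_gs_topology: "topspace gs_topology = (gs_space :: (real ^ 'n::finite \<Rightarrow> complex) set)"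
proof -
  have op: "gs_open (gs_space :: (real ^ 'n \<Rightarrow> complex) set)"
    unfolding gs_open_def
  proof (intro conjI ballI subset_refl)
    fix f :: "real ^ 'n \<Rightarrow> complex" assume f: "f \<in> gs_space"
    show "\<exists>V. gs_nhd0 V \<and> (\<forall>g\<in>V. (\<lambda>x. f x + g x) \<in> gs_space)"
    proof (intro exI[of _ gs_space] conjI ballI gs_nhd0_gs_space)
      fix g :: "real ^ 'n \<Rightarrow> complex" assume "g \<in> gs_space"
      with f obtain F G where "F \<in> gs_entire" "f = (\<lambda>x. F (cvec x))" "G \<in> gs_entire" "g = (\<lambda>x. G (cvec x))"
        by (meson gs_space_extension)
      then show "(\<lambda>x. f x + g x) \<in> gs_space"
        using gs_entire_gs_space[OF gs_entire_lincomb[of F G 1 1]] by simp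
    qed
  qed
  have "topspace gs_topology \<subseteq> (gs_space :: (real ^ 'n \<Rightarrow> complex) set)"
    using openin_topspace[of "gs_topology :: (real ^ 'n \<Rightarrow> complex) topology"]
    unfolding openin_gs_topology gs_open_def by blast
  moreover have "gs_space \<subseteq> topspace (gs_topology :: (real ^ 'n \<Rightarrow> complex) topology)"
    using op unfolding openin_gs_topology[symmetric] by (rule openin_subset)
  ultimately show ?thesis by (rule subset_antisym)
qed

text \<open>The preimage of the unit disc contains a ball of the single Banach space
  \<open>gs_banach (gs_h c b)\<close>, and scaling turns this into a bound with K depending on f, c
  and b only. When M = 0 there is nothing to scale, but then F = 0. Continuity of f enters the proof
  only here.\<close>

lemma gs_dual_bounded:
  fixes f :: "(real ^ 'n::finite \<Rightarrow> complex) \<Rightarrow> complex"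
  assumes f: "f \<in> gs_dual" and "c > 0" "b > 0"
  obtains K where "K \<ge> 0" "\<And>F M. entire F \<Longrightarrow> gbound c b M F \<Longrightarrow> cmod (f (\<lambda>x. F (cvec x))) \<le> K * M"
proof -
  have f0: "f (\<lambda>x. 0) = 0" using gs_dual_lincomb[OF f zero_gs_entire zero_gs_entire, of 0 0] by simp
  let ?W = "{\<phi> \<in> topspace gs_topology. f \<phi> \<in> ball 0 1}"
  have cont: "continuous_map gs_topology euclidean f" using f by (simp add: gs_dual_def)
  have "openin gs_topology ?W"
    by (rule openin_continuous_map_preimage[OF cont]) simp
  then have op: "gs_open ?W" by (simp add: openin_gs_topology)
  have "(\<lambda>x. 0) \<in> ?W"
    using gs_entire_gs_space[OF zero_gs_entire] f0 by (simp add: topspace_gs_topology)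
  then obtain V where V: "gs_nhd0 V" "\<forall>g\<in>V. (\<lambda>x. 0 + g x) \<in> ?W"
    using op unfolding gs_open_def by blast
  obtain e where e: "e > 0" "{f \<in> gs_banach (gs_h c b). gs_norm (gs_h c b) f < ennreal e} \<subseteq> V"
    using V(1) gs_h_pos[OF assms(2)] unfolding gs_nhd0_def by blast
  have small: "cmod (f (\<lambda>x. F (cvec x))) < 1" if "entire F" "gbound c b (e / 2) F" for F
  proof -
    have "gs_norm (gs_h c b) (\<lambda>x. F (cvec x)) \<le> ennreal (e / 2)"
      by (rule gs_norm_gbound[OF that assms(2,3)])
    also have "\<dots> < ennreal e" using e(1) by (simp add: ennreal_less_iff)
    finally have "(\<lambda>x. F (cvec x)) \<in> V"
      using e(2) gs_banach_gbound[OF that assms(2,3)] by blast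
    then show ?thesis using V(2) by auto
  qed
  have "cmod (f (\<lambda>x. F (cvec x))) \<le> (2 / e) * M" if F: "entire F" "gbound c b M F" for F M
  proof (cases "M = 0")
    case True
    have "cmod (F z) \<le> 0" for z using gboundD[OF F(2), of z] True by simp
    then have "F = (\<lambda>z. 0)" by auto
    then show ?thesis using f0 True by simp
  next
    case False
    then have M: "M > 0" using gbound_nonneg[OF F(2)] by simp
    have FG: "F \<in> gs_entire" using F assms unfolding gs_entire_def by blast
    define a where "a = e / (2 * M)"
    have a: "a > 0" "a * M = e / 2" using e M by (auto simp: a_def)
    have "gbound c b (cmod (of_real a) * M) (\<lambda>z. of_real a * F z)" by (rule gbound_cmult[OF F(2)])
    then have "cmod (f (\<lambda>x. of_real a * F (cvec x))) < 1"
      using a by (intro small entire_mult entire_const F) simp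
    moreover have "f (\<lambda>x. of_real a * F (cvec x)) = of_real a * f (\<lambda>x. F (cvec x))"
      using gs_dual_lincomb[OF f FG zero_gs_entire, of "of_real a" 0] by simp
    ultimately have "a * cmod (f (\<lambda>x. F (cvec x))) < 1" using a by (simp add: norm_mult)
    then show ?thesis using M e by (simp add: a_def field_simps)
  qed
  with e show ?thesis by (intro that[of "2 / e"]) auto
qed

section \<open>Completeness of monomials times a Gaussian\<close>

text \<open>Keeping only linearity and one bound per class admits not just f but also its difference
  from a rotated copy, to which the uniqueness result is applied.\<close>

definition gs_functional :: "((complex ^ 'n::finite \<Rightarrow> complex) \<Rightarrow> complex) \<Rightarrow> bool" where
  "gs_functional L \<longleftrightarrow>
    (\<forall>F\<in>gs_entire. \<forall>G\<in>gs_entire. \<forall>a b. L (\<lambda>z. a * F z + b * G z) = a * L F + b * L G) \<and>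
    (\<forall>c>0. \<forall>b>0. \<exists>K\<ge>0. \<forall>F M. entire F \<longrightarrow> gbound c b M F \<longrightarrow> cmod (L F) \<le> K * M)"

lemma gs_functional_lincomb:
  "gs_functional L \<Longrightarrow> F \<in> gs_entire \<Longrightarrow> G \<in> gs_entire \<Longrightarrow> L (\<lambda>z. a * F z + b * G z) = a * L F + b * L G"
  by (simp add: gs_functional_def)

lemma gs_functional_bounded:
  assumes "gs_functional L" "c > 0" "b > 0"
  obtains K where "K \<ge> 0" "\<And>F M. entire F \<Longrightarrow> gbound c b M F \<Longrightarrow> cmod (L F) \<le> K * M"
proof -
  have "\<exists>K\<ge>0. \<forall>F M. entire F \<longrightarrow> gbound c b M F \<longrightarrow> cmod (L F) \<le> K * M"
    using assms unfolding gs_functional_def by blast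
  then show ?thesis using that by blast
qed

lemma gs_entireI: "entire F \<Longrightarrow> gbound c b M F \<Longrightarrow> c > 0 \<Longrightarrow> b > 0 \<Longrightarrow> F \<in> gs_entire"
  by (auto simp: gs_entire_def)

lemma gs_dual_functional:
  assumes "f \<in> gs_dual"
  shows "gs_functional (\<lambda>F. f (\<lambda>x. F (cvec x)))"
  unfolding gs_functional_def
proof (intro conjI ballI allI impI)
  show "f (\<lambda>x. a * F (cvec x) + b * G (cvec x)) = a * f (\<lambda>x. F (cvec x)) + b * f (\<lambda>x. G (cvec x))"
    if "F \<in> gs_entire" "G \<in> gs_entire" for F G a b
    by (rule gs_dual_lincomb[OF assms that])
  fix c b :: real assume "c > 0" "b > 0"
  from gs_dual_bounded[OF assms this] obtain K where
    "K \<ge> 0" "\<And>F M. entire F \<Longrightarrow> gbound c b M F \<Longrightarrow> cmod (f (\<lambda>x. F (cvec x))) \<le> K * M" by blast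
  then show "\<exists>K\<ge>0. \<forall>F M. entire F \<longrightarrow> gbound c b M F \<longrightarrow> cmod (f (\<lambda>x. F (cvec x))) \<le> K * M"
    by blast
qed

lemma gs_functional_mult: "gs_functional L \<Longrightarrow> F \<in> gs_entire \<Longrightarrow> L (\<lambda>z. a * F z) = a * L F"
  using gs_functional_lincomb[of L F F a 0] by simp

lemma gs_entire_mult: "F \<in> gs_entire \<Longrightarrow> (\<lambda>z. a * F z) \<in> gs_entire"
  using gs_entire_lincomb[of F F a 0] by simp

lemma gs_functional_zero: "gs_functional L \<Longrightarrow> L (\<lambda>z. 0) = 0"
  using gs_functional_mult[OF _ zero_gs_entire, of L 0] by simp

lemma gs_functional_sum:
  assumes L: "gs_functional L" and G: "\<And>i. i \<in> I \<Longrightarrow> G i \<in> gs_entire"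
  shows "L (\<lambda>z. \<Sum>i\<in>I. G i z) = (\<Sum>i\<in>I. L (G i)) \<and> (\<lambda>z. \<Sum>i\<in>I. G i z) \<in> gs_entire"
  using G
proof (induction I rule: infinite_finite_induct)
  case (insert i I)
  then show ?case
    using gs_functional_lincomb[OF L, of "G i" "\<lambda>z. \<Sum>i\<in>I. G i z" 1 1]
      gs_entire_lincomb[of "G i" "\<lambda>z. \<Sum>i\<in>I. G i z" 1 1] by simp
qed (simp_all add: gs_functional_zero[OF L] zero_gs_entire)

lemma gs_functional_lsum:
  assumes L: "gs_functional L" and G: "\<And>js. G js \<in> gs_entire"
  shows "L (\<lambda>z. lsum n (\<lambda>js. G js z)) = lsum n (\<lambda>js. L (G js)) \<and> (\<lambda>z. lsum n (\<lambda>js. G js z)) \<in> gs_entire"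
  using G
proof (induction n arbitrary: G)
  case (Suc n)
  have IH: "L (\<lambda>z. lsum n (\<lambda>js. G (j # js) z)) = lsum n (\<lambda>js. L (G (j # js)))"
      "(\<lambda>z. lsum n (\<lambda>js. G (j # js) z)) \<in> gs_entire" for j
    using Suc.IH[of "\<lambda>js. G (j # js)"] Suc.prems by auto
  show ?case
    using gs_functional_sum[OF L, of UNIV "\<lambda>j z. lsum n (\<lambda>js. G (j # js) z)"] IH by simp
qed simp

text \<open>Differentiation under L. A bound uniform in |t| \<le> 2 puts the first-order remainder
  into the same class with constant 2M|t|^2, and boundedness of L carries this estimate over to the
  values.\<close>

lemma gs_functional_has_field_derivative:
  assumes L: "gs_functional L" and c: "c > 0" "b > 0"
    and G: "\<And>t. cmod t \<le> 2 \<Longrightarrow> entire (G t)" "\<And>t. cmod t \<le> 2 \<Longrightarrow> gbound c b M (G t)"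
    and hol: "\<And>z. (\<lambda>t. G t z) holomorphic_on UNIV"
    and G': "entire G'" "\<And>z. ((\<lambda>t. G t z) has_field_derivative G' z) (at 0)"
  shows "((\<lambda>t. L (G t)) has_field_derivative L G') (at 0)"
proof -
  obtain K where K: "K \<ge> 0" "\<And>F M. entire F \<Longrightarrow> gbound c b M F \<Longrightarrow> cmod (L F) \<le> K * M"
    using gs_functional_bounded[OF L c] by blast
  define w where "w z = exp (b * (norm (ivec z))\<^sup>2 - c * (norm (rvec z))\<^sup>2)" for z :: "complex ^ 'a"
  have Gw: "cmod (G t z) \<le> M * w z" if "cmod t \<le> 2" for t z
    unfolding w_def by (rule gboundD[OF G(2)[OF that]])
  have d: "deriv (\<lambda>t. G t z) 0 = G' z" for z by (rule DERIV_imp_deriv[OF G'(2)])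
  have "gbound c b M G'"
    unfolding gbound_def w_def[symmetric]
  proof
    fix z
    have "cmod ((deriv ^^ 1) (\<lambda>t. G t z) 0) \<le> fact 1 * (M * w z) / 1 ^ 1"
      using Gw by (intro Cauchy_inequality holomorphic_on_imp_continuous_on holomorphic_on_subset[OF hol]) auto
    then show "cmod (G' z) \<le> M * w z" by (simp add: d)
  qed
  then have Gs': "G' \<in> gs_entire" by (rule gs_entireI[OF G'(1) _ c])
  have Gs: "G t \<in> gs_entire" if "cmod t \<le> 2" for t by (rule gs_entireI[OF G(1) G(2) c]) (use that in auto)
  have rem: "cmod (L (G t) - L (G 0) - t * L G') \<le> K * (2 * M) * (cmod t)\<^sup>2" if t: "cmod t \<le> 1" for t
  proof -
    \<comment> \<open>Written so that two nested uses of \<open>gs_functional_lincomb\<close> match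
      it.\<close>
    let ?R = "\<lambda>z. 1 * (1 * G t z + (-1) * G 0 z) + (- t) * G' z"
    have in1: "(\<lambda>z. 1 * G t z + (-1) * G 0 z) \<in> gs_entire" using t by (intro gs_entire_lincomb Gs) auto
    have "L ?R = L (G t) - L (G 0) - t * L G'"
      using t by (subst gs_functional_lincomb[OF L in1 Gs'], subst gs_functional_lincomb[OF L Gs Gs]) auto
    moreover have "gbound c b (2 * M * (cmod t)\<^sup>2) ?R"
      unfolding gbound_def w_def[symmetric]
    proof
      fix z
      have "cmod (G t z - G 0 z - deriv (\<lambda>t. G t z) 0 * t) \<le> 2 * (M * w z) * (cmod t)\<^sup>2"
        by (rule holomorphic_quadratic_remainder[OF hol Gw t])
      then show "cmod (?R z) \<le> 2 * M * (cmod t)\<^sup>2 * w z" by (simp add: d mult_ac)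
    qed
    moreover have "entire ?R" using gs_entire_lincomb[OF in1 Gs', of 1 "- t"] by (simp add: gs_entire_def)
    ultimately show ?thesis using K(2)[of ?R "2 * M * (cmod t)\<^sup>2"] by (simp only: mult.assoc)
  qed
  show ?thesis
    unfolding DERIV_def
  proof (rule LIM_zero_cancel, rule Lim_null_comparison)
    have "cmod ((L (G (0 + h)) - L (G 0)) / h - L G') \<le> K * (2 * M) * cmod h" if h: "cmod h \<le> 1" "h \<noteq> 0" for h
    proof -
      have "(L (G (0 + h)) - L (G 0)) / h - L G' = (L (G h) - L (G 0) - h * L G') / h"
        using h by (simp add: diff_divide_distrib)
      also have "cmod \<dots> \<le> (K * (2 * M) * (cmod h)\<^sup>2) / cmod h"
        unfolding norm_divide by (intro divide_right_mono rem h) auto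
      finally show ?thesis using h by (simp add: power2_eq_square)
    qed
    then show "\<forall>\<^sub>F h in at 0. norm ((L (G (0 + h)) - L (G 0)) / h - L G') \<le> K * (2 * M) * cmod h"
      unfolding eventually_at by (intro exI[of _ 1]) auto
    show "((\<lambda>h. K * (2 * M) * cmod h) \<longlongrightarrow> 0) (at 0)" by (intro tendsto_eq_intros) auto
  qed
qed

lemma Re_cpair: "Re (cpair z z) = (norm (rvec z))\<^sup>2 - (norm (ivec z))\<^sup>2"
  by (simp add: cpair_def norm_sum_squares sum_subtractf[symmetric]) (simp add: power2_eq_square)

lemma cmod_cpair_le: "cmod (cpair z w) \<le> norm z * norm w"
proof -
  have "cmod (cpair z w) \<le> (\<Sum>j\<in>UNIV. norm (z $ j) * norm (w $ j))"
    unfolding cpair_def by (rule sum_norm_le) (simp add: norm_mult)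
  also have "\<dots> \<le> norm z * norm w"
    unfolding norm_vec_def using L2_set_mult_ineq[of "\<lambda>j. norm (z $ j)" "\<lambda>j. norm (w $ j)" UNIV] by simp
  finally show ?thesis .
qed

lemma cmod_monom_le: "cmod (coord_monom z js) \<le> norm z ^ length js"
proof (induction js)
  case (Cons j js)
  then show ?case by (simp add: norm_mult mult_mono Finite_Cartesian_Product.norm_nth_le)
qed simp

lemma monom_exp_bound:
  assumes "e > 0"
  shows "cmod (coord_monom z js) \<le> sqrt (fact (length js)) * (1 / sqrt (2 * e)) ^ length js * exp (e * (norm z)\<^sup>2)"
  using order_trans[OF cmod_monom_le power_le_sqrt_fact_exp[of "2 * e" "norm z" "length js", unfolded abs_norm_cancel]] assms
  by simp

definition gauss :: "real \<Rightarrow> complex ^ 'n::finite \<Rightarrow> complex" where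
  "gauss a z = exp (- of_real a * cpair z z)"

lemma entire_gauss: "entire (gauss a)"
  unfolding gauss_def by (intro entire_exp entire_mult entire_const entire_cpair)

lemma norm_gauss: "cmod (gauss a z) = exp (a * (norm (ivec z))\<^sup>2 - a * (norm (rvec z))\<^sup>2)"
  by (simp add: gauss_def norm_exp_eq_Re Re_cpair right_diff_distrib)

text \<open>Since |z|^2 = |x|^2 + |y|^2 at z = x + iy, the price exp(e|z|^2) of a monomial lowers
  the decay rate and raises the growth rate by the same arbitrary e.\<close>

lemma monom_gauss_gbound:
  fixes js :: "'n::finite list"
  assumes "e > 0"
  obtains M where "gbound (a - e) (a + e) M (\<lambda>z. coord_monom z js * gauss a z)"
proof
  let ?M = "sqrt (fact (length js)) * (1 / sqrt (2 * e)) ^ length js"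
  show "gbound (a - e) (a + e) ?M (\<lambda>z. coord_monom z js * gauss a z)"
    unfolding gbound_def
  proof
    fix z :: "complex ^ 'n"
    have "cmod (coord_monom z js * gauss a z) \<le> ?M * exp (e * (norm z)\<^sup>2) * exp (a * (norm (ivec z))\<^sup>2 - a * (norm (rvec z))\<^sup>2)"
      unfolding norm_mult norm_gauss by (intro mult_right_mono monom_exp_bound assms) simp
    also have "\<dots> = ?M * exp ((a + e) * (norm (ivec z))\<^sup>2 - (a - e) * (norm (rvec z))\<^sup>2)"
      unfolding mult.assoc exp_add[symmetric] norm_rvec_ivec by (simp add: algebra_simps)
    finally show "cmod (coord_monom z js * gauss a z) \<le> ?M * exp ((a + e) * (norm (ivec z))\<^sup>2 - (a - e) * (norm (rvec z))\<^sup>2)" .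
  qed
qed

lemma monom_gauss_gs_entire: "a > 0 \<Longrightarrow> (\<lambda>z. coord_monom z js * gauss a z) \<in> gs_entire"
proof -
  assume a: "a > 0"
  then obtain M where M: "gbound (a - a / 2) (a + a / 2) M (\<lambda>z. coord_monom z js * gauss a z)"
    using monom_gauss_gbound[of "a / 2" a js] by auto
  show ?thesis
    by (rule gs_entireI[OF entire_mult[OF entire_monom entire_gauss] M]) (use a in auto)
qed

lemma dird_expand:
  assumes "entire F" shows "dird w F z = (\<Sum>j\<in>UNIV. w $ j * cpd j F z)"
  using dird_sum[OF assms, where c = "\<lambda>j. w $ j" and u = "\<lambda>j. axis j 1" and I = UNIV and z = z] by (simp add: basis_expansion)

lemma lsum_has_field_derivative:
  assumes "\<And>js. (g js has_field_derivative g' js) F"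
  shows "((\<lambda>t. lsum n (\<lambda>js. g js t)) has_field_derivative lsum n g') F"
  using assms
proof (induction n arbitrary: g g')
  case (Suc n)
  show ?case using Suc.prems by (simp, intro DERIV_sum Suc.IH)
qed simp

lemma higher_deriv_ray:
  assumes F: "entire F"
  shows "(deriv ^^ n) (\<lambda>t. F (t *s z)) t = lsum n (\<lambda>js. coord_monom z js * foldr cpd js F (t *s z))"
proof (induction n arbitrary: t)
  case (Suc n)
  have "((\<lambda>t. lsum n (\<lambda>js. coord_monom z js * foldr cpd js F (t *s z))) has_field_derivative
      lsum n (\<lambda>js. coord_monom z js * dird z (foldr cpd js F) (t *s z))) (at t)"
    using dird_line[OF entire_foldr_cpd[OF F], where z = 0 and w = z and t = t]
    by (intro lsum_has_field_derivative DERIV_cmult) simp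
  moreover have "(deriv ^^ n) (\<lambda>t. F (t *s z)) = (\<lambda>t. lsum n (\<lambda>js. coord_monom z js * foldr cpd js F (t *s z)))"
    by (rule ext) (rule Suc.IH)
  ultimately have "(deriv ^^ Suc n) (\<lambda>t. F (t *s z)) t = lsum n (\<lambda>js. coord_monom z js * dird z (foldr cpd js F) (t *s z))"
    by (simp add: DERIV_imp_deriv)
  also have "\<dots> = lsum (Suc n) (\<lambda>js. coord_monom z js * foldr cpd js F (t *s z))"
    by (simp add: dird_expand[OF entire_foldr_cpd[OF F], where w = z] sum_distrib_left lsum_sum mult_ac)
  finally show ?case .
qed simp

text \<open>Expanding \<open>\<psi> = F exp (a \<langle>z, z\<rangle>)\<close> into homogeneous polynomials \<open>P\<^sub>n\<close>, the Cauchy estimate on the circle of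
  radius \<open>r > 1\<close> gives \<open>\<bar>P\<^sub>n\<bar> \<le> M r\<^sup>-\<^sup>n exp ((a - c / 2) \<bar>z\<bar>\<^sup>2)\<close>, which still leaves
  Gaussian decay after multiplication with \<open>exp (- a \<langle>z, z\<rangle>)\<close>.\<close>

lemma gs_functional_eq_0_of_monomials:
  fixes F :: "complex ^ 'n::finite \<Rightarrow> complex"
  assumes L: "gs_functional L" and kill: "\<And>js. L (\<lambda>z. coord_monom z js * gauss a z) = 0"
    and F: "entire F" "gbound c b M F" and c: "0 < c" "c < a" "b > 0" "b + c \<le> 2 * a"
  shows "L F = 0"
proof -
  define \<psi> where "\<psi> z = F z * gauss (- a) z" for z
  define P where "P n z = lsum n (\<lambda>js. coord_monom z js * foldr cpd js \<psi> 0) / fact n" for n z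
  define S where "S N z = (\<Sum>n<N. P n z * gauss a z)" for N z
  \<comment> \<open>Chosen so that (a - c) r^2 = a - c/2: the larger circle spends half of the
    margin c and gains the factor r^(-n).\<close>
  define r where "r = sqrt ((a - c / 2) / (a - c))"
  have r: "r > 1" using c by (simp add: r_def)
  have r2: "(a - c) * r\<^sup>2 = a - c / 2" using c by (simp add: r_def)
  have M: "M \<ge> 0" by (rule gbound_nonneg[OF F(2)])
  have \<psi>: "entire \<psi>" unfolding \<psi>_def by (intro entire_mult F entire_gauss)
  have \<psi>b: "cmod (\<psi> z) \<le> M * exp ((a - c) * (norm z)\<^sup>2)" for z
  proof -
    have "cmod (\<psi> z) \<le> M * exp (b * (norm (ivec z))\<^sup>2 - c * (norm (rvec z))\<^sup>2) * exp ((- a) * (norm (ivec z))\<^sup>2 - (- a) * (norm (rvec z))\<^sup>2)"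
      unfolding \<psi>_def norm_mult norm_gauss by (intro mult_right_mono gboundD[OF F(2)]) simp
    also have "\<dots> = M * exp ((a - c) * (norm (rvec z))\<^sup>2 + (b - a) * (norm (ivec z))\<^sup>2)"
      unfolding mult.assoc exp_add[symmetric] by (simp add: algebra_simps)
    \<comment> \<open>Here b + c \<le> 2a enters, in the form b - a \<le> a - c.\<close>
    also have "\<dots> \<le> M * exp ((a - c) * (norm (rvec z))\<^sup>2 + (a - c) * (norm (ivec z))\<^sup>2)"
      using c M by (intro mult_left_mono) (auto intro!: mult_right_mono)
    finally show ?thesis by (simp add: norm_rvec_ivec distrib_left)
  qed
  have P_deriv: "P n z = (deriv ^^ n) (\<lambda>t. \<psi> (t *s z)) 0 / fact n" for n z
    unfolding P_def higher_deriv_ray[OF \<psi>] by simp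
  have P_sums: "(\<lambda>n. P n z) sums \<psi> z" for z
  proof -
    have "(\<lambda>n. (deriv ^^ n) (\<lambda>t. \<psi> (t *s z)) 0 / fact n * (1 - 0) ^ n) sums \<psi> (1 *s z)"
      by (rule holomorphic_power_series[where r = 2]) (auto intro: entire_ray[OF \<psi>])
    then show ?thesis by (simp add: P_deriv)
  qed
  have P_bound: "cmod (P n z) \<le> M * exp ((a - c / 2) * (norm z)\<^sup>2) * (1 / r) ^ n" for n z
  proof -
    have "cmod ((deriv ^^ n) (\<lambda>t. \<psi> (t *s z)) 0) \<le> fact n * (M * exp ((a - c / 2) * (norm z)\<^sup>2)) / r ^ n"
    proof (rule Cauchy_inequality)
      fix t :: complex assume "norm (0 - t) = r"
      then have "(a - c) * (norm (t *s z))\<^sup>2 = (a - c / 2) * (norm z)\<^sup>2"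
        by (simp add: norm_cscale power_mult_distrib r2[symmetric])
      then show "cmod (\<psi> (t *s z)) \<le> M * exp ((a - c / 2) * (norm z)\<^sup>2)" using \<psi>b[of "t *s z"] by simp
    qed (use r in \<open>auto intro: entire_ray[OF \<psi>] holomorphic_on_imp_continuous_on\<close>)
    then show ?thesis unfolding P_deriv norm_divide by (simp add: pos_divide_le_eq power_one_over field_simps)
  qed
  have S_in: "S N \<in> gs_entire" and LS: "L (S N) = 0" for N
  proof -
    have tm: "L (\<lambda>z. P n z * gauss a z) = 0 \<and> (\<lambda>z. P n z * gauss a z) \<in> gs_entire" for n
    proof -
      let ?G = "\<lambda>js z. (foldr cpd js \<psi> 0 / fact n) * (coord_monom z js * gauss a z)"
      have eq: "(\<lambda>z. P n z * gauss a z) = (\<lambda>z. lsum n (\<lambda>js. ?G js z))"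
      proof
        fix z
        have "P n z * gauss a z = (gauss a z / fact n) * lsum n (\<lambda>js. coord_monom z js * foldr cpd js \<psi> 0)"
          by (simp add: P_def)
        also have "\<dots> = lsum n (\<lambda>js. ?G js z)"
          unfolding lsum_mult[symmetric] by (rule lsum_cong) simp
        finally show "P n z * gauss a z = lsum n (\<lambda>js. ?G js z)" .
      qed
      have G: "?G js \<in> gs_entire" "L (?G js) = 0" for js
        using c kill gs_functional_mult[OF L monom_gauss_gs_entire, of a "foldr cpd js \<psi> 0 / fact n"]
          gs_entire_mult[OF monom_gauss_gs_entire, of a "foldr cpd js \<psi> 0 / fact n"] by simp_all
      show ?thesis
        unfolding eq using gs_functional_lsum[where G = ?G, OF L G(1)] lsum_mult[of n 0 "\<lambda>_. 0"]
        by (simp only: G(2)) simp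
    qed
    then show "S N \<in> gs_entire" "L (S N) = 0"
      using gs_functional_sum[OF L, of "{..<N}" "\<lambda>n z. P n z * gauss a z"] by (auto simp: S_def[abs_def])
  qed
  let ?R = "\<lambda>N z. 1 * F z + (-1) * S N z"
  have Fin: "F \<in> gs_entire" using gs_entireI[OF F] c by simp
  \<comment> \<open>Adding a|y|^2 - a|x|^2 to (a - c/2)|z|^2 gives the rates c/2 and 2a - c/2. They
    do not depend on N, so one constant K serves all remainders while (1/r)^N tends to 0.\<close>
  have R_bound: "gbound (c / 2) (2 * a - c / 2) (M * (1 / r) ^ N / (1 - 1 / r)) (?R N)" for N
    unfolding gbound_def
  proof
    fix z :: "complex ^ 'n"
    let ?E = "M * exp ((a - c / 2) * (norm z)\<^sup>2)"
    have geo: "(\<lambda>n. ?E * (1 / r) ^ N * (1 / r) ^ n) sums (?E * (1 / r) ^ N * (1 / (1 - 1 / r)))"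
      using r by (intro sums_mult geometric_sums) auto
    have tail: "(\<lambda>n. P (n + N) z) sums (\<psi> z - (\<Sum>n<N. P n z))"
      by (rule sums_split_initial_segment[OF P_sums])
    have "cmod (\<psi> z - (\<Sum>n<N. P n z)) \<le> ?E * (1 / r) ^ N * (1 / (1 - 1 / r))"
      unfolding sums_unique[OF tail] sums_unique[OF geo]
    proof (rule norm_suminf_le)
      show "cmod (P (n + N) z) \<le> ?E * (1 / r) ^ N * (1 / r) ^ n" for n
        using P_bound[of "n + N" z] by (simp add: power_add mult_ac)
    qed (rule sums_summable[OF geo])
    moreover have "?R N z = (\<psi> z - (\<Sum>n<N. P n z)) * gauss a z"
      by (simp add: \<psi>_def S_def left_diff_distrib sum_distrib_right gauss_def mult.assoc exp_minus)
    ultimately have "cmod (?R N z) \<le> ?E * (1 / r) ^ N * (1 / (1 - 1 / r)) * exp (a * (norm (ivec z))\<^sup>2 - a * (norm (rvec z))\<^sup>2)"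
      by (simp only: norm_mult norm_gauss) (intro mult_right_mono, auto)
    also have "\<dots> = (M * (1 / r) ^ N / (1 - 1 / r)) * (exp ((a - c / 2) * (norm z)\<^sup>2) * exp (a * (norm (ivec z))\<^sup>2 - a * (norm (rvec z))\<^sup>2))"
      by (simp add: mult_ac)
    also have "exp ((a - c / 2) * (norm z)\<^sup>2) * exp (a * (norm (ivec z))\<^sup>2 - a * (norm (rvec z))\<^sup>2)
      = exp ((2 * a - c / 2) * (norm (ivec z))\<^sup>2 - c / 2 * (norm (rvec z))\<^sup>2)"
      unfolding exp_add[symmetric] norm_rvec_ivec by (simp add: algebra_simps)
    finally show "cmod (?R N z) \<le> M * (1 / r) ^ N / (1 - 1 / r) * exp ((2 * a - c / 2) * (norm (ivec z))\<^sup>2 - c / 2 * (norm (rvec z))\<^sup>2)" .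
  qed
  have cb: "c / 2 > 0" "2 * a - c / 2 > 0" using c by auto
  obtain K where K: "K \<ge> 0" "\<And>F M. entire F \<Longrightarrow> gbound (c / 2) (2 * a - c / 2) M F \<Longrightarrow> cmod (L F) \<le> K * M"
    using gs_functional_bounded[OF L cb] by blast
  have "cmod (L F) \<le> K * (M * (1 / r) ^ N / (1 - 1 / r))" for N
  proof -
    have "L (?R N) = L F" using gs_functional_lincomb[OF L Fin S_in, of 1 "-1" N] LS by simp
    moreover have "entire (?R N)" using gs_entire_lincomb[OF Fin S_in, of 1 "-1" N] by (simp add: gs_entire_def)
    ultimately show ?thesis using K(2)[OF _ R_bound[of N]] by simp
  qed
  moreover have "(\<lambda>N. K * (M * (1 / r) ^ N / (1 - 1 / r))) \<longlonglongrightarrow> K * (M * 0 / (1 - 1 / r))"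
    using r by (intro tendsto_intros LIMSEQ_power_zero) auto
  ultimately have "cmod (L F) \<le> K * (M * 0 / (1 - 1 / r))"
    by (intro LIMSEQ_le_const) auto
  then show ?thesis by simp
qed

text \<open>From a to 3a/2: a polynomial times the Gaussian of parameter 3a/2 lies in the class c =
  a/4, b = 7a/4, and b + c = 2a. The ratio has to be below 2, because b cannot be smaller than the
  parameter of the new Gaussian and c > 0. The start 1/2 is the Gaussian in the kernel.\<close>

lemma gs_functional_eq_0:
  assumes L: "gs_functional L" and kill: "\<And>js. L (\<lambda>z. coord_monom z js * gauss (1 / 2) z) = 0"
    and F: "F \<in> gs_entire"
  shows "L F = 0"
proof -
  have kill: "L (\<lambda>z. coord_monom z js * gauss ((3 / 2) ^ k / 2) z) = 0" for k js
  proof (induction k arbitrary: js)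
    case (Suc k)
    let ?a = "(3 / 2) ^ k / 2 :: real"
    have a: "?a > 0" by simp
    obtain M where M: "gbound (3 / 2 * ?a - ?a / 4) (3 / 2 * ?a + ?a / 4) M (\<lambda>z. coord_monom z js * gauss (3 / 2 * ?a) z)"
      using monom_gauss_gbound[of "?a / 4" "3 / 2 * ?a" js] a by auto
    have "L (\<lambda>z. coord_monom z js * gauss (3 / 2 * ?a) z) = 0"
    proof (rule gs_functional_eq_0_of_monomials[OF L Suc])
      show "entire (\<lambda>z. coord_monom z js * gauss (3 / 2 * ?a) z)"
        by (intro entire_mult entire_monom entire_gauss)
      show "gbound (?a / 4) (7 / 4 * ?a) M (\<lambda>z. coord_monom z js * gauss (3 / 2 * ?a) z)"
        by (rule gbound_mono[OF M]) (use a in auto)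
    qed (use a in auto)
    then show ?case by simp
  qed (simp add: kill)
  obtain c b M where cb: "c > 0" "b > 0" and F': "entire F" "gbound c b M F"
    using F by (auto simp: gs_entire_def)
  obtain k where k: "(3 / 2) ^ k > 2 * (b + c)" using real_arch_pow[of "3 / 2" "2 * (b + c)"] by auto
  show ?thesis
    by (rule gs_functional_eq_0_of_monomials[OF L kill[of _ k] F']) (use k cb in auto)
qed

section \<open>The Bargmann kernel and Hermite functions\<close>

text \<open>By \<open>norm_add_squared_ge\<close> each rate loses a relative amount e, uniformly in
  the shift; the rest, (c + 2b) R^2 / e in the exponent, goes into the constant.\<close>

lemma gbound_translate:
  fixes G :: "complex ^ 'n::finite \<Rightarrow> complex"
  assumes G: "gbound c b M G" and c: "c > 0" "b > 0" and e: "0 < e" "e \<le> 1"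
  shows "\<exists>M'. \<forall>s. norm s \<le> R \<longrightarrow> gbound (c * (1 - e)) (b * (1 + e)) M' (\<lambda>w. G (w + s))"
proof (intro exI allI impI)
  fix s :: "complex ^ 'n" assume s: "norm s \<le> R"
  let ?M = "M * exp ((c + 2 * b) * (R\<^sup>2 / e))"
  have "(norm s)\<^sup>2 \<le> R\<^sup>2" using s by (intro power_mono) auto
  then have sR: "(norm (rvec s))\<^sup>2 \<le> R\<^sup>2" "(norm (ivec s))\<^sup>2 \<le> R\<^sup>2"
    unfolding norm_rvec_ivec using zero_le_power2[of "norm (rvec s)"] zero_le_power2[of "norm (ivec s)"]
    by linarith+
  show "gbound (c * (1 - e)) (b * (1 + e)) ?M (\<lambda>w. G (w + s))"
    unfolding gbound_def
  proof
    fix w :: "complex ^ 'n"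
    have "(1 - e) * (norm (rvec w))\<^sup>2 - R\<^sup>2 / e \<le> (norm (rvec (w + s)))\<^sup>2"
      using norm_add_squared_ge(1)[OF e, of "rvec w" "rvec s"] divide_right_mono[OF sR(1), of e] e
      by (simp add: rvec_add)
    then have 1: "c * ((1 - e) * (norm (rvec w))\<^sup>2 - R\<^sup>2 / e) \<le> c * (norm (rvec (w + s)))\<^sup>2"
      using c by (intro mult_left_mono) auto
    have "(norm (ivec (w + s)))\<^sup>2 \<le> (1 + e) * (norm (ivec w))\<^sup>2 + 2 * (R\<^sup>2 / e)"
      using norm_add_squared_ge(2)[OF e, of "ivec w" "ivec s"] divide_right_mono[OF sR(2), of e] e
      by (simp add: ivec_add)
    then have 2: "b * (norm (ivec (w + s)))\<^sup>2 \<le> b * ((1 + e) * (norm (ivec w))\<^sup>2 + 2 * (R\<^sup>2 / e))"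
      using c by (intro mult_left_mono) auto
    have "b * (norm (ivec (w + s)))\<^sup>2 - c * (norm (rvec (w + s)))\<^sup>2
      \<le> b * ((1 + e) * (norm (ivec w))\<^sup>2 + 2 * (R\<^sup>2 / e)) - c * ((1 - e) * (norm (rvec w))\<^sup>2 - R\<^sup>2 / e)"
      using 1 2 by linarith
    also have "\<dots> = (c + 2 * b) * (R\<^sup>2 / e) + (b * (1 + e) * (norm (ivec w))\<^sup>2 - c * (1 - e) * (norm (rvec w))\<^sup>2)"
      by (simp only: distrib_left distrib_right left_diff_distrib right_diff_distrib mult.assoc mult_2 mult_1 mult_1_right)
    finally have le: "b * (norm (ivec (w + s)))\<^sup>2 - c * (norm (rvec (w + s)))\<^sup>2
      \<le> (c + 2 * b) * (R\<^sup>2 / e) + (b * (1 + e) * (norm (ivec w))\<^sup>2 - c * (1 - e) * (norm (rvec w))\<^sup>2)" .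
    have "M * exp (b * (norm (ivec (w + s)))\<^sup>2 - c * (norm (rvec (w + s)))\<^sup>2)
      \<le> M * exp ((c + 2 * b) * (R\<^sup>2 / e) + (b * (1 + e) * (norm (ivec w))\<^sup>2 - c * (1 - e) * (norm (rvec w))\<^sup>2))"
      using le gbound_nonneg[OF G] by (simp only: mult_left_mono exp_le_cancel_iff)
    also have "\<dots> = ?M * exp (b * (1 + e) * (norm (ivec w))\<^sup>2 - c * (1 - e) * (norm (rvec w))\<^sup>2)"
      by (simp only: exp_add mult.assoc)
    finally show "cmod (G (w + s)) \<le> ?M * exp (b * (1 + e) * (norm (ivec w))\<^sup>2 - c * (1 - e) * (norm (rvec w))\<^sup>2)"
      using gboundD[OF G, of "w + s"] by linarith
  qed
qed

text \<open>The rates (1, 1) of \<open>gauss 1\<close> are not preserved exactly by translation or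
  differentiation. Allowing an arbitrarily small loss makes the class stable under both.\<close>

definition near_gauss :: "(complex ^ 'n::finite \<Rightarrow> complex) \<Rightarrow> bool" where
  "near_gauss G \<longleftrightarrow> entire G \<and> (\<forall>e. 0 < e \<longrightarrow> e < 1 \<longrightarrow> (\<exists>M. gbound (1 - e) (1 + e) M G))"

lemma near_gauss_entire: "near_gauss G \<Longrightarrow> entire G"
  by (simp add: near_gauss_def)

lemma near_gauss_gauss: "near_gauss (gauss 1)"
proof -
  have "gbound 1 1 1 (gauss 1)" unfolding gbound_def norm_gauss by simp
  then have "gbound (1 - e) (1 + e) 1 (gauss 1)" if "e > 0" for e
    by (rule gbound_mono) (use that in auto)
  then show ?thesis unfolding near_gauss_def using entire_gauss by blast
qed

lemma near_gauss_translate: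
  fixes G :: "complex ^ 'n::finite \<Rightarrow> complex"
  assumes G: "near_gauss G" and e: "0 < e" "e < 1"
  shows "\<exists>M. \<forall>s. norm s \<le> R \<longrightarrow> gbound (1 - e) (1 + e) M (\<lambda>w. G (w + s))"
proof -
  \<comment> \<open>One loss e/3 is spent on G and another on the translation, as (1 - e/3)^2 \<ge>
    1 - e and (1 + e/3)^2 \<le> 1 + e.\<close>
  have e3: "0 < e / 3" "e / 3 < 1" "e / 3 \<le> 1" "1 - e / 3 > 0" "1 + e / 3 > 0" using e by auto
  obtain M0 where M0: "gbound (1 - e / 3) (1 + e / 3) M0 G"
    using G e3 unfolding near_gauss_def by blast
  obtain M where M: "\<And>s. norm s \<le> R \<Longrightarrow> gbound ((1 - e / 3) * (1 - e / 3)) ((1 + e / 3) * (1 + e / 3)) M (\<lambda>w. G (w + s))"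
    using gbound_translate[OF M0 e3(4,5) e3(1,3), of R] by blast
  have ee: "e * e \<le> e * 1" using e by (intro mult_left_mono) auto
  have "gbound (1 - e) (1 + e) M (\<lambda>w. G (w + s))" if "norm s \<le> R" for s
  proof (rule gbound_mono[OF M[OF that]])
    have q: "(1 - e / 3) * (1 - e / 3) = 1 - 2 * e / 3 + e * e / 9" "(1 + e / 3) * (1 + e / 3) = 1 + 2 * e / 3 + e * e / 9"
      by (simp_all add: field_simps)
    have lin: "1 - e \<le> 1 - 2 * e / 3 + p / 9" "1 + 2 * e / 3 + p / 9 \<le> 1 + e" if "p \<ge> 0" "p \<le> e" for p
      using e that by simp_all
    show "1 - e \<le> (1 - e / 3) * (1 - e / 3)" unfolding q using e ee by (intro lin) auto
    show "(1 + e / 3) * (1 + e / 3) \<le> 1 + e" unfolding q using e ee by (intro lin) auto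
  qed simp
  then show ?thesis by blast
qed

lemma near_gauss_dird:
  assumes G: "near_gauss G"
  shows "near_gauss (dird v G)"
  unfolding near_gauss_def
proof (intro conjI allI impI)
  show "entire (dird v G)" by (intro entire_dird near_gauss_entire G)
  fix e :: real assume e: "0 < e" "e < 1"
  obtain M where M: "\<And>s. norm s \<le> norm v \<Longrightarrow> gbound (1 - e) (1 + e) M (\<lambda>w. G (w + s))"
    using near_gauss_translate[OF G e] by blast
  have "cmod (dird v G z) \<le> M * exp ((1 + e) * (norm (ivec z))\<^sup>2 - (1 - e) * (norm (rvec z))\<^sup>2)" for z
  proof -
    have "cmod ((dird v ^^ 1) G z) \<le> fact 1 * (M * exp ((1 + e) * (norm (ivec z))\<^sup>2 - (1 - e) * (norm (rvec z))\<^sup>2)) / 1 ^ 1"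
    proof (rule dird_cauchy[OF near_gauss_entire[OF G]])
      fix t :: complex assume "cmod t = 1"
      then show "cmod (G (z + t *s v)) \<le> M * exp ((1 + e) * (norm (ivec z))\<^sup>2 - (1 - e) * (norm (rvec z))\<^sup>2)"
        by (intro gboundD[OF M]) (simp add: norm_cscale)
    qed simp
    then show ?thesis by simp
  qed
  then show "\<exists>M. gbound (1 - e) (1 + e) M (dird v G)" unfolding gbound_def by blast
qed

text \<open>The first factor is exp(<w,w>/2). With \<open>gauss 1\<close> for G this is the kernel
  up to a factor, and with a derivative of \<open>gauss 1\<close> and z = 0 it is a Hermite function
  up to a factor. Leaving G free closes the family under differentiation in z.\<close>

definition shifted :: "(complex ^ 'n::finite \<Rightarrow> complex) \<Rightarrow> complex ^ 'n \<Rightarrow> complex ^ 'n \<Rightarrow> complex" where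
  "shifted G z w = gauss (- 1 / 2) w * G (w + (- 1 / of_real (sqrt 2)) *s z)"

lemma entire_shifted:
  assumes "entire G" shows "entire (shifted G z)"
  unfolding shifted_def
  using entire_affine[OF assms, of 1 "(- 1 / of_real (sqrt 2)) *s z"]
  by (intro entire_mult entire_gauss) simp

lemma shifted_gbound:
  assumes G: "near_gauss G"
  shows "\<exists>M. \<forall>z. norm z \<le> R \<longrightarrow> gbound (1 / 4) (3 / 4) M (shifted G z)"
proof -
  \<comment> \<open>After the factor exp(<w,w>/2), a loss of 1/4 leaves the rates 1 - 1/4 - 1/2 =
    1/4 and 1 + 1/4 - 1/2 = 3/4.\<close>
  have e: "0 < (1/4::real)" "(1/4::real) < 1" by auto
  obtain M where M: "\<And>s. norm s \<le> R \<Longrightarrow> gbound (1 - 1/4) (1 + 1/4) M (\<lambda>w. G (w + s))"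
    using near_gauss_translate[OF G e] by blast
  have "gbound (1 / 4) (3 / 4) M (shifted G z)" if z: "norm z \<le> R" for z
    unfolding gbound_def
  proof
    fix w
    let ?s = "(- 1 / of_real (sqrt 2)) *s z"
    have "norm ?s = norm z / sqrt 2" by (simp add: norm_cscale norm_divide)
    also have "\<dots> \<le> norm z / 1" by (intro divide_left_mono) auto
    finally have "norm ?s \<le> R" using z by simp
    from gboundD[OF M[OF this], of w]
    have "cmod (shifted G z w) \<le> exp ((- 1 / 2) * (norm (ivec w))\<^sup>2 - (- 1 / 2) * (norm (rvec w))\<^sup>2) *
      (M * exp ((1 + 1/4) * (norm (ivec w))\<^sup>2 - (1 - 1/4) * (norm (rvec w))\<^sup>2))"
      unfolding shifted_def norm_mult norm_gauss by (intro mult_left_mono) auto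
    also have "\<dots> = M * (exp ((- 1 / 2) * (norm (ivec w))\<^sup>2 - (- 1 / 2) * (norm (rvec w))\<^sup>2) * exp ((1 + 1/4) * (norm (ivec w))\<^sup>2 - (1 - 1/4) * (norm (rvec w))\<^sup>2))"
      by (rule mult.left_commute)
    also have "\<dots> = M * exp (3 / 4 * (norm (ivec w))\<^sup>2 - 1 / 4 * (norm (rvec w))\<^sup>2)"
      unfolding exp_add[symmetric] by simp
    finally show "cmod (shifted G z w) \<le> M * exp (3 / 4 * (norm (ivec w))\<^sup>2 - 1 / 4 * (norm (rvec w))\<^sup>2)" .
  qed
  then show ?thesis by blast
qed

lemma shifted_gs_entire: "near_gauss G \<Longrightarrow> shifted G z \<in> gs_entire"
  using shifted_gbound[of G "norm z"] gs_entireI[OF entire_shifted[OF near_gauss_entire], of G "1/4" "3/4" _ z]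
  by auto

lemma line_bound: "cmod t \<le> 2 \<Longrightarrow> norm (z + t *s v) \<le> norm z + 2 * norm v"
  using norm_triangle_ineq[of z "t *s v"] mult_right_mono[of "cmod t" 2 "norm v"]
  by (simp add: norm_cscale)

lemma shifted_line:
  "shifted G (z + t *s v) w = gauss (- 1 / 2) w * G ((w + (- 1 / of_real (sqrt 2)) *s z) + t *s ((- 1 / of_real (sqrt 2)) *s v))"
  unfolding shifted_def by (simp only: vec.scale_right_distrib vec.scale_left_commute add.assoc)

lemma shifted_functional_derivative:
  fixes L :: "(complex ^ 'n::finite \<Rightarrow> complex) \<Rightarrow> complex"
  assumes L: "gs_functional L" and G: "near_gauss G"
  shows "((\<lambda>t. L (shifted G (z + t *s v))) has_field_derivative (- 1 / of_real (sqrt 2)) * L (shifted (dird v G) z)) (at 0)"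
proof -
  let ?c = "- 1 / of_real (sqrt 2) :: complex"
  note eG = near_gauss_entire[OF G]
  obtain M where M: "\<And>x. norm x \<le> norm z + 2 * norm v \<Longrightarrow> gbound (1 / 4) (3 / 4) M (shifted G x)"
    using shifted_gbound[OF G] by blast
  have "((\<lambda>t. L (shifted G (z + t *s v))) has_field_derivative L (\<lambda>w. ?c * shifted (dird v G) z w)) (at 0)"
  proof (rule gs_functional_has_field_derivative[OF L, where c = "1 / 4" and b = "3 / 4"])
    show "entire (shifted G (z + t *s v))" for t by (rule entire_shifted[OF eG])
    show "gbound (1 / 4) (3 / 4) M (shifted G (z + t *s v))" if "cmod t \<le> 2" for t
      by (rule M[OF line_bound[OF that]])
    show "(\<lambda>t. shifted G (z + t *s v) w) holomorphic_on UNIV" for w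
      unfolding shifted_line by (intro holomorphic_intros entire_line[OF eG])
    show "entire (\<lambda>w. ?c * shifted (dird v G) z w)"
      by (intro entire_mult entire_const entire_shifted entire_dird eG)
    fix w
    have "((\<lambda>t. shifted G (z + t *s v) w) has_field_derivative
      gauss (- 1 / 2) w * dird (?c *s v) G ((w + ?c *s z) + 0 *s (?c *s v))) (at 0)"
      unfolding shifted_line by (intro DERIV_cmult dird_line[OF eG])
    then show "((\<lambda>t. shifted G (z + t *s v) w) has_field_derivative ?c * shifted (dird v G) z w) (at 0)"
      unfolding shifted_line by (simp only: shifted_def dird_scale[OF eG] vec.scale_zero_left add_0_right mult.left_commute)
  qed auto
  then show ?thesis
    by (simp only: gs_functional_mult[OF L shifted_gs_entire[OF near_gauss_dird[OF G]]])
qed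

text \<open>Moving the base point along the line turns the derivative at 0 into holomorphy on lines.
  Continuity follows from local boundedness, since one class contains the functions for all |z|
  \<le> R.\<close>

lemma shifted_functional_entire:
  fixes L :: "(complex ^ 'n::finite \<Rightarrow> complex) \<Rightarrow> complex"
  assumes L: "gs_functional L" and G: "near_gauss G"
  shows "entire (\<lambda>z. L (shifted G z))"
    and "dird v (\<lambda>z. L (shifted G z)) = (\<lambda>z. (- 1 / of_real (sqrt 2)) * L (shifted (dird v G) z))"
proof -
  show "entire (\<lambda>z. L (shifted G z))"
  proof (rule entire_of_locally_bounded)
    fix z v :: "complex ^ 'n"
    have "((\<lambda>t. L (shifted G (z + t *s v))) has_field_derivative
        (- 1 / of_real (sqrt 2)) * L (shifted (dird v G) (z + t0 *s v))) (at t0)" for t0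
    proof -
      have "((\<lambda>t. L (shifted G ((z + t0 *s v) + t *s v))) has_field_derivative
        (- 1 / of_real (sqrt 2)) * L (shifted (dird v G) (z + t0 *s v))) (at 0)"
        by (rule shifted_functional_derivative[OF L G])
      moreover have "(z + t0 *s v) + t *s v = z + (t + t0) *s v" for t
        by (simp add: vec.scale_left_distrib add_ac)
      ultimately show ?thesis
        using DERIV_shift[of "\<lambda>t. L (shifted G (z + t *s v))" _ 0 t0] by simp
    qed
    then show "(\<lambda>t. L (shifted G (z + t *s v))) holomorphic_on UNIV"
      unfolding holomorphic_on_def field_differentiable_def by auto
  next
    fix R
    obtain M where M: "\<And>x. norm x \<le> R \<Longrightarrow> gbound (1 / 4) (3 / 4) M (shifted G x)"
      using shifted_gbound[OF G] by blast
    have pos: "(1 / 4 :: real) > 0" "(3 / 4 :: real) > 0" by auto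
    obtain K where "K \<ge> 0" and K: "\<And>F M. entire F \<Longrightarrow> gbound (1 / 4) (3 / 4) M F \<Longrightarrow> cmod (L F) \<le> K * M"
      using gs_functional_bounded[OF L pos] by blast
    show "\<exists>B. \<forall>z. norm z \<le> R \<longrightarrow> cmod (L (shifted G z)) \<le> B"
      using K[OF entire_shifted[OF near_gauss_entire[OF G]] M] by blast
  qed
  show "dird v (\<lambda>z. L (shifted G z)) = (\<lambda>z. (- 1 / of_real (sqrt 2)) * L (shifted (dird v G) z))"
    unfolding dird_def[of v "\<lambda>z. L (shifted G z)"]
    by (rule ext) (rule DERIV_imp_deriv[OF shifted_functional_derivative[OF L G]])
qed

lemma near_gauss_foldr: "near_gauss G \<Longrightarrow> near_gauss (foldr cpd js G)"
  by (induction js) (auto intro: near_gauss_dird)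

lemma dird_cmult: "entire F \<Longrightarrow> dird v (\<lambda>z. c * F z) = (\<lambda>z. c * dird v F z)"
proof
  fix z assume F: "entire F"
  have "((\<lambda>t. c * F (z + t *s v)) has_field_derivative c * dird v F (z + 0 *s v)) (at 0)"
    by (intro DERIV_cmult dird_line[OF F])
  then show "dird v (\<lambda>z. c * F z) z = c * dird v F z"
    unfolding dird_def[of v "\<lambda>z. c * F z"] by (simp add: DERIV_imp_deriv)
qed

lemma foldr_cpd_cmult: "entire F \<Longrightarrow> foldr cpd js (\<lambda>z. c * F z) = (\<lambda>z. c * foldr cpd js F z)"
  by (induction js) (auto simp: dird_cmult entire_foldr_cpd)

lemma foldr_cpd_shifted:
  assumes L: "gs_functional L" and G: "near_gauss G"
  shows "foldr cpd js (\<lambda>z. L (shifted G z)) = (\<lambda>z. (- 1 / of_real (sqrt 2)) ^ length js * L (shifted (foldr cpd js G) z))"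
proof (induction js)
  case (Cons j js)
  note F = near_gauss_foldr[OF G, of js]
  show ?case
    using Cons dird_cmult[OF shifted_functional_entire(1)[OF L F]] shifted_functional_entire(2)[OF L F]
    by (simp add: mult.assoc mult.left_commute)
qed simp

section \<open>The Bargmann kernel as a shifted Gaussian\<close>

definition kap :: "'n::finite itself \<Rightarrow> complex" where
  "kap _ = of_real (pi powr (- real CARD('n) / 4))"

lemma kap_nonzero: "kap TYPE('n::finite) \<noteq> 0"
  by (simp add: kap_def)

lemma cpair_add_left: "cpair (x + y) z = cpair x z + cpair y z"
  and cpair_scale_left: "cpair (c *s x) z = c * cpair x z"
  and cpair_commute: "cpair x z = cpair z x"
  unfolding cpair_def by (simp add: distrib_right sum.distrib, simp add: sum_distrib_left mult.assoc, simp add: mult.commute)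

lemma cpair_add_right: "cpair z (x + y) = cpair z x + cpair z y"
  and cpair_scale_right: "cpair z (c *s x) = c * cpair z x"
  by (simp_all only: cpair_commute[of z] cpair_add_left cpair_scale_left)

lemma cpair_cvec: "cpair (cvec x) (cvec y) = of_real (x \<bullet> y)"
  by (simp add: cpair_def inner_vec_def)

lemma cpair_cvec_self: "cpair (cvec x) (cvec x) = of_real ((norm x)\<^sup>2)"
  by (simp add: cpair_cvec power2_norm_eq_inner)

definition bkernel :: "complex ^ 'n::finite \<Rightarrow> complex ^ 'n \<Rightarrow> complex" where
  "bkernel z w = kap TYPE('n) * exp (- (cpair z z + cpair w w) / 2 + of_real (sqrt 2) * cpair z w)"

lemma bargmann_kernel_eq: "bargmann_kernel z = (\<lambda>y. bkernel z (cvec y))"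
  by (rule ext) (simp add: bargmann_kernel_def bkernel_def kap_def cpair_cvec_self)

text \<open>Completing the square: with v = w - z / sqrt 2 one has <v,v> = <w,w> - sqrt 2 <z,w> +
  <z,z>/2, and the prefactor exp(<w,w>/2) halves the first term.\<close>

lemma bkernel_shifted: "bkernel z = (\<lambda>w. kap TYPE('n) * shifted (gauss 1) z w)" for z :: "complex ^ 'n::finite"
proof
  fix w :: "complex ^ 'n"
  define c where "c = - 1 / complex_of_real (sqrt 2)"
  have c2: "c * c = 1 / 2" "2 * c = - of_real (sqrt 2)"
    by (auto simp: c_def field_simps simp flip: of_real_mult)
  have "cpair (w + c *s z) (w + c *s z) = cpair w w + (2 * c) * cpair z w + (c * c) * cpair z z"
    by (simp add: cpair_add_left cpair_scale_left cpair_add_right cpair_scale_right cpair_commute[of w z] algebra_simps)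
  then have eq: "cpair (w + c *s z) (w + c *s z) = cpair w w - of_real (sqrt 2) * cpair z w + cpair z z / 2"
    unfolding c2 by simp
  have "shifted (gauss 1) z w = exp (- (cpair z z + cpair w w) / 2 + of_real (sqrt 2) * cpair z w)"
    unfolding shifted_def gauss_def c_def[symmetric] exp_add[symmetric] eq
    by (rule arg_cong[where f = exp]) (simp add: field_simps)
  then show "bkernel z w = kap TYPE('n) * shifted (gauss 1) z w" by (simp add: bkernel_def)
qed

lemma bkernel_gs_entire: "bkernel z \<in> gs_entire"
  unfolding bkernel_shifted by (intro gs_entire_mult shifted_gs_entire near_gauss_gauss)

section \<open>Hermite functions and Taylor coefficients of the Bargmann transform\<close>

lemma smooth_foldr_real:
  assumes f: "smooth f" and "\<And>x. Im (f x) = 0"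
  shows "Im (foldr partial_deriv js f x) = 0"
proof (induction js arbitrary: x)
  case (Cons j js)
  let ?g = "foldr partial_deriv js f"
  have "((\<lambda>t. ?g (x + t *\<^sub>R axis j 1)) has_vector_derivative partial_deriv j ?g (x + 0 *\<^sub>R axis j 1)) (at 0)"
    by (rule smooth_line_axis[OF smooth_foldr[OF f]])
  then have "((\<lambda>t. Im (?g (x + t *\<^sub>R axis j 1))) has_vector_derivative Im (partial_deriv j ?g (x + 0 *\<^sub>R axis j 1))) (at 0)"
    by (rule bounded_linear.has_vector_derivative[OF bounded_linear_Im])
  then have "((\<lambda>t. 0) has_vector_derivative Im (partial_deriv j ?g x)) (at (0::real))"
    using Cons by simp
  from vector_derivative_unique_at[OF this has_vector_derivative_const] show ?case by simp
qed (use assms in simp)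

lemma gauss_cvec: "of_real (exp (- (norm y)\<^sup>2)) = gauss 1 (cvec y)"
  unfolding gauss_def cpair_cvec_self by (simp flip: exp_of_real)

lemma powr_neg_half:
  assumes "(x::real) > 0" shows "x powr (- 1 / 2) = 1 / sqrt x"
  unfolding minus_divide_left[symmetric] powr_minus powr_half_sqrt[OF less_imp_le[OF assms]]
  by (rule inverse_eq_divide)

lemma hermite_shifted:
  fixes \<gamma> :: "'n::finite \<Rightarrow> nat"
  shows "hermite \<gamma> x = kap TYPE('n) * (-1) ^ mi_abs \<gamma> / of_real (sqrt (2 ^ mi_abs \<gamma> * mi_fact \<gamma>)) *
    shifted (foldr cpd (mi_list \<gamma> coords) (gauss 1)) 0 (cvec x)"
proof -
  have pos: "2 ^ mi_abs \<gamma> * mi_fact \<gamma> > 0" using mi_fact_pos[of \<gamma>] by simp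
  have p: "(2 ^ mi_abs \<gamma> * mi_fact \<gamma>) powr (-1/2) = 1 / sqrt (2 ^ mi_abs \<gamma> * mi_fact \<gamma>)"
    by (rule powr_neg_half[OF pos])
  have D: "mi_deriv \<gamma> (\<lambda>y. of_real (exp (- (norm y)\<^sup>2))) x = foldr cpd (mi_list \<gamma> coords) (gauss 1) (cvec x)"
    unfolding gauss_cvec mi_deriv_cvec[OF entire_gauss] foldr_funpow ..
  have g: "gauss (- 1 / 2) (cvec x) = of_real (exp ((norm x)\<^sup>2 / 2))"
    unfolding gauss_def cpair_cvec_self by (simp flip: exp_of_real)
  have s: "shifted G 0 w = gauss (- 1 / 2) w * G w" for G :: "complex ^ 'n \<Rightarrow> complex" and w
    by (simp add: shifted_def)
  show ?thesis
    unfolding hermite_def p D s g kap_def by simp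
qed

text \<open>Derivatives of a real Gaussian are real. This removes the conjugation in
  \<open>gs_scalar\<close> and leaves the bilinear pairing.\<close>

lemma cnj_hermite: "cnj (hermite \<gamma> x) = hermite \<gamma> x"
proof -
  have "smooth (\<lambda>y. complex_of_real (exp (- (norm y)\<^sup>2)))"
    unfolding gauss_cvec by (rule smooth_cvec[OF entire_gauss])
  then have "Im (mi_deriv \<gamma> (\<lambda>y. of_real (exp (- (norm y)\<^sup>2))) x) = 0"
    unfolding mi_deriv_foldr by (rule smooth_foldr_real) simp
  then have "cnj (mi_deriv \<gamma> (\<lambda>y. of_real (exp (- (norm y)\<^sup>2))) x) = mi_deriv \<gamma> (\<lambda>y. of_real (exp (- (norm y)\<^sup>2))) x"
    by (intro complex_eqI) auto
  then show ?thesis by (simp only: hermite_def complex_cnj_mult complex_cnj_complex_of_real)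
qed

lemma length_mi_list: "length (mi_list \<gamma> js) = (\<Sum>j\<leftarrow>js. \<gamma> j)"
  by (induction js) (auto simp: mi_list_def)

lemma length_mi_list_coords: "length (mi_list \<gamma> coords) = mi_abs \<gamma>"
  by (simp add: length_mi_list mi_abs_def sum_list_distinct_conv_sum_set coords)

lemma bargmann_entire:
  fixes f :: "(real ^ 'n::finite \<Rightarrow> complex) \<Rightarrow> complex"
  assumes f: "f \<in> gs_dual"
  shows "entire (bargmann f)"
    and "foldr (\<lambda>j. cpd j ^^ \<gamma> j) coords (bargmann f) 0 = of_real (sqrt (mi_fact \<gamma>)) * gs_scalar f (hermite \<gamma>)"
proof -
  define L where "L F = f (\<lambda>x. F (cvec x))" for F
  have L: "gs_functional L" unfolding L_def by (rule gs_dual_functional[OF f])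
  note n = near_gauss_gauss
  have B: "bargmann f = (\<lambda>z. kap TYPE('n) * L (shifted (gauss 1) z))"
  proof
    fix z
    have "bargmann f z = L (bkernel z)" by (simp add: bargmann_def bargmann_kernel_eq L_def)
    then show "bargmann f z = kap TYPE('n) * L (shifted (gauss 1) z)"
      by (simp only: bkernel_shifted gs_functional_mult[OF L shifted_gs_entire[OF n]])
  qed
  show "entire (bargmann f)" unfolding B by (intro entire_mult entire_const shifted_functional_entire L n)
  let ?G = "foldr cpd (mi_list \<gamma> coords) (gauss 1)"
  have "gs_scalar f (hermite \<gamma>) = L (\<lambda>w. kap TYPE('n) * (-1) ^ mi_abs \<gamma> / of_real (sqrt (2 ^ mi_abs \<gamma> * mi_fact \<gamma>)) * shifted ?G 0 w)"
    unfolding gs_scalar_def cnj_hermite L_def by (subst hermite_shifted[abs_def]) simp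
  also have "\<dots> = kap TYPE('n) * (-1) ^ mi_abs \<gamma> / of_real (sqrt (2 ^ mi_abs \<gamma> * mi_fact \<gamma>)) * L (shifted ?G 0)"
    by (rule gs_functional_mult[OF L shifted_gs_entire[OF near_gauss_foldr[OF n]]])
  finally have s: "gs_scalar f (hermite \<gamma>) = kap TYPE('n) * (-1) ^ mi_abs \<gamma> / of_real (sqrt (2 ^ mi_abs \<gamma> * mi_fact \<gamma>)) * L (shifted ?G 0)" .
  have "foldr (\<lambda>j. cpd j ^^ \<gamma> j) coords (bargmann f) 0 = kap TYPE('n) * ((- 1 / of_real (sqrt 2)) ^ mi_abs \<gamma> * L (shifted ?G 0))"
    unfolding foldr_funpow B foldr_cpd_cmult[OF shifted_functional_entire(1)[OF L n]] foldr_cpd_shifted[OF L n]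
    by (simp add: length_mi_list_coords)
  \<comment> \<open>The factor (-1 / sqrt 2)^|\<gamma>| from differentiation is sqrt(\<gamma>!)
    times the Hermite normalisation (-1)^|\<gamma>| / sqrt(2^|\<gamma>| \<gamma>!).\<close>
  also have "\<dots> = of_real (sqrt (mi_fact \<gamma>)) * gs_scalar f (hermite \<gamma>)"
    using mi_fact_pos[of \<gamma>] unfolding s power_divide
    by (simp add: real_sqrt_mult real_sqrt_power)
  finally show "foldr (\<lambda>j. cpd j ^^ \<gamma> j) coords (bargmann f) 0 = of_real (sqrt (mi_fact \<gamma>)) * gs_scalar f (hermite \<gamma>)" .
qed

text \<open>The kernel without exp(-<z,z>/2): a derivative in the j-th coordinate of z then only
  multiplies by sqrt 2 times the j-th coordinate of w, so these functions are closed under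
  differentiation up to constants.\<close>

definition tilted :: "'n::finite list \<Rightarrow> complex ^ 'n \<Rightarrow> complex ^ 'n \<Rightarrow> complex" where
  "tilted js z w = coord_monom w js * gauss (1 / 2) w * exp (of_real (sqrt 2) * cpair z w)"

lemma entire_tilted: "entire (tilted js z)"
  unfolding tilted_def
  by (intro entire_mult entire_monom entire_gauss entire_exp entire_const entire_cpair_right)

lemma tilted_gbound: "\<exists>M. \<forall>z. norm z \<le> R \<longrightarrow> gbound (1 / 4) (3 / 4) M (tilted js z)"
proof -
  \<comment> \<open>From the rate 1/2 the monomial takes 1/8 and the cross term another 1/8, by sqrt
    2 |z||w| \<le> 4|z|^2 + |w|^2 / 8; this leaves 1/4 and 3/4.\<close>
  have e: "0 < (1/8::real)" by simp
  obtain M where M: "gbound (1 / 2 - 1 / 8) (1 / 2 + 1 / 8) M (\<lambda>w. coord_monom w js * gauss (1 / 2) w)"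
    using monom_gauss_gbound[OF e] by blast
  have "gbound (1 / 4) (3 / 4) (M * exp (4 * R\<^sup>2)) (tilted js z)" if z: "norm z \<le> R" for z
    unfolding gbound_def
  proof
    fix w
    have "Re (of_real (sqrt 2) * cpair z w) \<le> sqrt 2 * (norm z * norm w)"
      using complex_Re_le_cmod[of "cpair z w"] cmod_cpair_le[of z w] by (simp add: mult_left_mono)
    also have "\<dots> \<le> 4 * (norm z)\<^sup>2 + (norm w)\<^sup>2 / 8"
    proof -
      have "0 \<le> (2 * norm z - sqrt 2 / 4 * norm w)\<^sup>2" by simp
      also have "\<dots> = 4 * (norm z)\<^sup>2 + (norm w)\<^sup>2 / 8 - sqrt 2 * (norm z * norm w)"
        by (simp add: power2_diff power_mult_distrib power_divide)
      finally show ?thesis by simp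
    qed
    also have "\<dots> \<le> 4 * R\<^sup>2 + (norm w)\<^sup>2 / 8"
      using power_mono[OF z, of 2] by simp
    finally have "cmod (exp (of_real (sqrt 2) * cpair z w)) \<le> exp (4 * R\<^sup>2 + (norm w)\<^sup>2 / 8)"
      unfolding norm_exp_eq_Re by simp
    then have "cmod (tilted js z w) \<le> M * exp ((1 / 2 + 1 / 8) * (norm (ivec w))\<^sup>2 - (1 / 2 - 1 / 8) * (norm (rvec w))\<^sup>2) * exp (4 * R\<^sup>2 + (norm w)\<^sup>2 / 8)"
      unfolding tilted_def norm_mult[of "_ * _" "exp _"] using gbound_nonneg[OF M]
      by (intro mult_mono gboundD[OF M]) auto
    also have "\<dots> = M * exp (4 * R\<^sup>2) * exp (3 / 4 * (norm (ivec w))\<^sup>2 - 1 / 4 * (norm (rvec w))\<^sup>2)"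
      unfolding mult.assoc exp_add[symmetric] norm_rvec_ivec by (simp add: field_simps)
    finally show "cmod (tilted js z w) \<le> M * exp (4 * R\<^sup>2) * exp (3 / 4 * (norm (ivec w))\<^sup>2 - 1 / 4 * (norm (rvec w))\<^sup>2)" .
  qed
  then show ?thesis by blast
qed

lemma tilted_gs_entire: "tilted js z \<in> gs_entire"
  using tilted_gbound[of "norm z" js] gs_entireI[OF entire_tilted, of "1/4" "3/4" _ js z] by auto

text \<open>Differentiating \<open>L (exp (- \<langle>w, w\<rangle> / 2 + sqrt 2 \<langle>z, w\<rangle>)) = 0\<close> in \<open>z\<close> produces the monomials.\<close>

lemma gs_functional_eq_0_of_kernel:
  fixes L :: "(complex ^ 'n::finite \<Rightarrow> complex) \<Rightarrow> complex"
  assumes L: "gs_functional L" and kill: "\<And>z. L (bkernel z) = 0" and F: "F \<in> gs_entire"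
  shows "L F = 0"
proof (rule gs_functional_eq_0[OF L _ F])
  have "L (tilted js z) = 0" for js z
  proof (induction js arbitrary: z)
    case Nil
    have "bkernel z = (\<lambda>w. (kap TYPE('n) * exp (- cpair z z / 2)) * tilted [] z w)"
      unfolding bkernel_def tilted_def gauss_def
      by (rule ext) (simp add: mult.assoc exp_add[symmetric] diff_divide_distrib add_divide_distrib algebra_simps)
    then have "(kap TYPE('n) * exp (- cpair z z / 2)) * L (tilted [] z) = 0"
      using kill[of z] gs_functional_mult[OF L tilted_gs_entire, of "kap TYPE('n) * exp (- cpair z z / 2)" "[]" z] by simp
    then show ?case using kap_nonzero[where 'n = 'n] by simp
  next
    case (Cons j js)
    obtain M where M: "\<And>x. norm x \<le> norm z + 2 * norm (axis j 1 :: complex ^ 'n) \<Longrightarrow> gbound (1 / 4) (3 / 4) M (tilted js x)"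
      using tilted_gbound[of "norm z + 2 * norm (axis j 1 :: complex ^ 'n)" js] by blast
    have line: "tilted js (z + t *s axis j 1) w = tilted js z w * exp (of_real (sqrt 2) * (t * w $ j))" for t w
    proof -
      have "cpair (axis j 1) w = w $ j"
        by (simp add: cpair_def axis_def if_distrib[of "\<lambda>a. a * _"] cong: if_cong)
      then show ?thesis
        by (simp add: tilted_def cpair_add_left cpair_scale_left distrib_left exp_add mult.assoc)
    qed
    have "((\<lambda>t. L (tilted js (z + t *s axis j 1))) has_field_derivative L (\<lambda>w. of_real (sqrt 2) * tilted (j # js) z w)) (at 0)"
    proof (rule gs_functional_has_field_derivative[OF L, where c = "1 / 4" and b = "3 / 4"])
      show "gbound (1 / 4) (3 / 4) M (tilted js (z + t *s axis j 1))" if "cmod t \<le> 2" for t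
        by (rule M[OF line_bound[OF that]])
      show "(\<lambda>t. tilted js (z + t *s axis j 1) w) holomorphic_on UNIV" for w
        unfolding line by (intro holomorphic_intros)
      fix w :: "complex ^ 'n"
      have "((\<lambda>t. tilted js z w * exp (of_real (sqrt 2) * (t * w $ j))) has_field_derivative
        tilted js z w * (exp (of_real (sqrt 2) * (0 * w $ j)) * (of_real (sqrt 2) * (1 * w $ j)))) (at 0)"
        by (auto intro!: derivative_eq_intros)
      then show "((\<lambda>t. tilted js (z + t *s axis j 1) w) has_field_derivative of_real (sqrt 2) * tilted (j # js) z w) (at 0)"
        unfolding line by (simp add: tilted_def mult_ac)
    qed (auto intro: entire_tilted entire_mult entire_const)
    moreover have "(\<lambda>t. L (tilted js (z + t *s axis j 1))) = (\<lambda>t. 0)" by (rule ext) (rule Cons.IH)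
    ultimately have "((\<lambda>t. 0) has_field_derivative L (\<lambda>w. of_real (sqrt 2) * tilted (j # js) z w)) (at (0 :: complex))"
      by simp
    then have "L (\<lambda>w. of_real (sqrt 2) * tilted (j # js) z w) = 0"
      using DERIV_const by (rule DERIV_unique)
    then show ?case using gs_functional_mult[OF L tilted_gs_entire] by simp
  qed
  from this[of _ 0] show "L (\<lambda>w. coord_monom w js * gauss (1 / 2) w) = 0" for js
    by (simp add: tilted_def[abs_def] cpair_def)
qed

section \<open>Rotation invariant entire functions\<close>

lemma higher_deriv_of_sums:
  fixes h :: "complex \<Rightarrow> complex"
  assumes "\<And>t. (\<lambda>n. c n * t ^ n) sums h t"
  shows "(deriv ^^ k) h 0 = fact k * c k"
proof -
  have "h has_fps_expansion Abs_fps c"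
    using assms by (intro has_fps_expansionI always_eventually) simp
  from fps_nth_fps_expansion[OF this, of k] show ?thesis by simp
qed

lemma entire_function_sums:
  assumes "h holomorphic_on UNIV"
  shows "(\<lambda>n. (deriv ^^ n) h s / fact n * (t - s) ^ n) sums h t"
  by (rule holomorphic_power_series[where r = "dist s t + 1"]) (auto intro: holomorphic_on_subset[OF assms])

lemma sums_even_terms:
  fixes a :: "nat \<Rightarrow> complex"
  assumes "\<And>n. odd n \<Longrightarrow> a n = 0"
  shows "(\<lambda>n. a (2 * n)) sums l \<longleftrightarrow> a sums l"
proof (rule sums_mono_reindex)
  show "strict_mono (\<lambda>n::nat. 2 * n)" by (simp add: strict_mono_def)
  fix n :: nat assume "n \<notin> range (\<lambda>n. 2 * n)"
  then have "odd n" by (auto elim!: evenE)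
  then show "a n = 0" by (rule assms)
qed

lemma even_entire_function:
  assumes F: "F holomorphic_on UNIV" and odd: "\<And>n. odd n \<Longrightarrow> (deriv ^^ n) F 0 = 0"
  obtains F0 where "F0 holomorphic_on UNIV" "\<And>t. F t = F0 (t\<^sup>2)"
proof
  define a where "a n = (deriv ^^ n) F 0 / fact n" for n
  \<comment> \<open>The jump of \<open>csqrt\<close> is harmless: the series of F contains only even
    powers, so F0 is a power series in w.\<close>
  define F0 where "F0 w = F (csqrt w)" for w
  have a: "(\<lambda>n. a (2 * n) * (t\<^sup>2) ^ n) sums F t" for t
  proof -
    have "(\<lambda>n. a n * t ^ n) sums F t"
      using entire_function_sums[OF F, of 0 t] by (simp add: a_def)
    then have "(\<lambda>n. a (2 * n) * t ^ (2 * n)) sums F t"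
      by (subst sums_even_terms) (auto simp: a_def odd)
    then show ?thesis by (simp add: power_mult)
  qed
  have s: "(\<lambda>n. a (2 * n) * w ^ n) sums F0 w" for w
    using a[of "csqrt w"] by (simp add: F0_def)
  show "F t = F0 (t\<^sup>2)" for t using sums_unique2[OF a[of t] s] .
  have "F0 holomorphic_on ball 0 r" for r
    by (rule power_series_holomorphic[where a = "\<lambda>n. a (2 * n)"]) (use s in simp)
  then show "F0 holomorphic_on UNIV"
    unfolding holomorphic_on_open[OF open_ball] holomorphic_on_open[OF open_UNIV]
    by (metis UNIV_I centre_in_ball dist_0_norm less_add_one mem_ball)
qed

text \<open>In G(s + t^2) the power t^(2m) has the m-th Taylor coefficient of G at s, so the
  derivative of order 2m at t = 0 is (2m)!/m! times the m-th derivative of G, and odd orders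
  vanish.\<close>

definition evcoeff :: "nat \<Rightarrow> complex" where
  "evcoeff k = (if even k then fact k / fact (k div 2) else 0)"

lemma higher_deriv_quadratic:
  assumes G: "G holomorphic_on UNIV"
  shows "(deriv ^^ k) (\<lambda>t. G (s + t\<^sup>2)) 0 = evcoeff k * (deriv ^^ (k div 2)) G s"
proof -
  define c where "c n = (if even n then (deriv ^^ (n div 2)) G s / fact (n div 2) else 0)" for n
  have "(\<lambda>n. c n * t ^ n) sums G (s + t\<^sup>2)" for t
  proof -
    have "(\<lambda>n. c (2 * n) * t ^ (2 * n)) sums G (s + t\<^sup>2)"
      using entire_function_sums[OF G, of s "s + t\<^sup>2"] by (simp add: c_def power_mult)
    then show ?thesis by (subst (asm) sums_even_terms) (auto simp: c_def)
  qed
  then have "(deriv ^^ k) (\<lambda>t. G (s + t\<^sup>2)) 0 = fact k * c k" by (rule higher_deriv_of_sums)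
  then show ?thesis by (simp add: c_def evcoeff_def)
qed

lemma cpair_axis: "cpair z (axis j 1) = z $ j"
  by (simp add: cpair_def axis_def if_distrib[of "\<lambda>a. _ * a"] cong: if_cong)

lemma cpair_line:
  "z $ j = 0 \<Longrightarrow> cpair (z + t *s axis j 1) (z + t *s axis j 1) = cpair z z + t\<^sup>2"
  by (simp add: cpair_add_left cpair_add_right cpair_scale_left cpair_scale_right cpair_axis
      cpair_commute[of "axis j 1" z] power2_eq_square)

lemma entire_of_cpair:
  assumes "G holomorphic_on UNIV" shows "entire (\<lambda>z. G (cpair z z))"
  by (rule entire_compose[OF assms entire_cpair])

text \<open>Where the j-th coordinate vanishes, moving along axis j adds t^2 to <z,z> without a
  linear term, so each coordinate contributes its own \<open>evcoeff\<close>. The induction needs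
  general z, because the inner derivatives are evaluated at points whose j-th coordinate is
  t.\<close>

lemma foldr_cpd_of_cpair:
  fixes z :: "complex ^ 'n::finite"
  assumes G: "G holomorphic_on UNIV"
  shows "distinct js \<Longrightarrow> (\<And>j. j \<in> set js \<Longrightarrow> z $ j = 0) \<Longrightarrow>
    foldr (\<lambda>j. cpd j ^^ \<gamma> j) js (\<lambda>z. G (cpair z z)) z =
      (\<Prod>j\<in>set js. evcoeff (\<gamma> j)) * (deriv ^^ (\<Sum>j\<in>set js. \<gamma> j div 2)) G (cpair z z)"
proof (induction js arbitrary: z)
  case (Cons j js)
  define H where "H = foldr (\<lambda>j. cpd j ^^ \<gamma> j) js (\<lambda>z. G (cpair z z))"
  define p where "p = (\<Prod>j\<in>set js. evcoeff (\<gamma> j))"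
  define m where "m = (\<Sum>j\<in>set js. \<gamma> j div 2)"
  have Gm: "(deriv ^^ m) G holomorphic_on UNIV" by (rule holomorphic_higher_deriv[OF G open_UNIV])
  have H: "entire H" unfolding H_def by (rule entire_foldr_cpd_funpow[OF entire_of_cpair[OF G]])
  have "H (z + t *s axis j 1) = p * (deriv ^^ m) G (cpair z z + t\<^sup>2)" for t
  proof -
    have "H (z + t *s axis j 1) = p * (deriv ^^ m) G (cpair (z + t *s axis j 1) (z + t *s axis j 1))"
      unfolding H_def p_def m_def by (rule Cons.IH) (use Cons.prems in \<open>auto simp: axis_def\<close>)
    then show ?thesis using Cons.prems by (simp add: cpair_line)
  qed
  then have line: "(\<lambda>t. H (z + t *s axis j 1)) = (\<lambda>t. p * (deriv ^^ m) G (cpair z z + t\<^sup>2))" by (rule ext)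
  have "(cpd j ^^ \<gamma> j) H z = (deriv ^^ \<gamma> j) (\<lambda>t. H (z + t *s axis j 1)) 0"
    by (simp add: higher_deriv_line[OF H])
  also have "\<dots> = p * (deriv ^^ \<gamma> j) (\<lambda>t. (deriv ^^ m) G (cpair z z + t\<^sup>2)) 0"
  proof -
    have "(\<lambda>t. (deriv ^^ m) G (cpair z z + t\<^sup>2)) holomorphic_on UNIV"
      using holomorphic_on_compose_gen[OF _ Gm, of "\<lambda>t. cpair z z + t\<^sup>2" UNIV]
      by (simp add: o_def holomorphic_intros)
    then show ?thesis unfolding line by (intro higher_deriv_cmult) auto
  qed
  also have "\<dots> = p * (evcoeff (\<gamma> j) * (deriv ^^ (\<gamma> j div 2 + m)) G (cpair z z))"
    unfolding higher_deriv_quadratic[OF Gm] by (simp add: funpow_add)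
  finally show ?case using Cons.prems(1) by (simp add: H_def p_def m_def mult_ac)
qed simp

lemma entire_eqI_deriv:
  assumes g: "g holomorphic_on UNIV" "h holomorphic_on UNIV"
    and eq: "\<And>k. (deriv ^^ k) g 0 = (deriv ^^ k) h 0"
  shows "g t = h t"
  using entire_function_sums[OF g(1), of 0 t] entire_function_sums[OF g(2), of 0 t]
  unfolding eq by (rule sums_unique2)

text \<open>Coordinates are released one at a time: equality of all derivatives in direction j gives
  equality on the whole line, in particular where that coordinate has its final value in z'. The
  coordinates left in the list are still 0 there.\<close>

lemma entire_eqI:
  fixes V W :: "complex ^ 'n::finite \<Rightarrow> complex"
  assumes V: "entire V" and W: "entire W"
  shows "distinct js \<Longrightarrow> (\<And>\<gamma>. foldr (\<lambda>j. cpd j ^^ \<gamma> j) js V z = foldr (\<lambda>j. cpd j ^^ \<gamma> j) js W z) \<Longrightarrow>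
    (\<And>j. j \<in> set js \<Longrightarrow> z $ j = 0) \<Longrightarrow> (\<And>j. j \<notin> set js \<Longrightarrow> z' $ j = z $ j) \<Longrightarrow> V z' = W z'"
proof (induction js arbitrary: z)
  case Nil
  then have "z' = z" by (simp add: vec_eq_iff)
  \<comment> \<open>With no directions left the hypothesis does not depend on \<gamma>, so any value
    serves.\<close>
  then show ?case using Nil(2)[of undefined] by simp
next
  case (Cons j js)
  let ?y = "z + z' $ j *s axis j 1"
  show ?case
  proof (rule Cons.IH)
    show "distinct js" using Cons.prems(1) by simp
    show "?y $ i = 0" if "i \<in> set js" for i
      using that Cons.prems(1,3) by (auto simp: axis_def)
    show "z' $ i = ?y $ i" if "i \<notin> set js" for i
      using that Cons.prems(3,4)[of i] by (auto simp: axis_def)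
    fix \<gamma> :: "'n \<Rightarrow> nat"
    define HV where "HV = foldr (\<lambda>j. cpd j ^^ \<gamma> j) js V"
    define HW where "HW = foldr (\<lambda>j. cpd j ^^ \<gamma> j) js W"
    have H: "entire HV" "entire HW"
      unfolding HV_def HW_def by (auto intro: entire_foldr_cpd_funpow V W)
    have "(cpd j ^^ k) HV z = (cpd j ^^ k) HW z" for k
    proof -
      \<comment> \<open>Since j does not occur in js, its order can be set to k without touching the
        other derivatives.\<close>
      have "foldr (\<lambda>i. cpd i ^^ (\<gamma>(j := k)) i) js F = foldr (\<lambda>i. cpd i ^^ \<gamma> i) js F" for F
        using Cons.prems(1) by (intro foldr_cong) auto
      then show ?thesis using Cons.prems(2)[of "\<gamma>(j := k)"] by (simp add: HV_def HW_def)
    qed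
    then have "(deriv ^^ k) (\<lambda>t. HV (z + t *s axis j 1)) 0 = (deriv ^^ k) (\<lambda>t. HW (z + t *s axis j 1)) 0" for k
      by (simp add: higher_deriv_line[OF H(1)] higher_deriv_line[OF H(2)])
    then have "HV (z + t *s axis j 1) = HW (z + t *s axis j 1)" for t
      by (rule entire_eqI_deriv[OF entire_line[OF H(1), of z "axis j 1" UNIV] entire_line[OF H(2), of z "axis j 1" UNIV]])
    then show "foldr (\<lambda>j. cpd j ^^ \<gamma> j) js V ?y = foldr (\<lambda>j. cpd j ^^ \<gamma> j) js W ?y"
      by (simp add: HV_def HW_def)
  qed
qed

lemma entire_eqI_at_0:
  fixes V W :: "complex ^ 'n::finite \<Rightarrow> complex"
  assumes "entire V" "entire W"
    and "\<And>\<gamma>. foldr (\<lambda>j. cpd j ^^ \<gamma> j) coords V 0 = foldr (\<lambda>j. cpd j ^^ \<gamma> j) coords W 0"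
  shows "V z = W z"
proof (rule entire_eqI[OF assms(1,2) coords(1), where z = 0])
  show "foldr (\<lambda>j. cpd j ^^ \<gamma> j) coords V 0 = foldr (\<lambda>j. cpd j ^^ \<gamma> j) coords W 0" for \<gamma>
    by (rule assms(3))
qed (auto simp: coords)

text \<open>On the complex line through Re z in direction Im z the functions agree for real t, hence
  by the identity theorem also at t = \<i>, the point z.\<close>

lemma entire_eqI_real:
  fixes V W :: "complex ^ 'n::finite \<Rightarrow> complex"
  assumes V: "entire V" and W: "entire W" and eq: "\<And>x. V (cvec x) = W (cvec x)"
  shows "V z = W z"
proof -
  let ?g = "\<lambda>t. V (cvec (rvec z) + t *s cvec (ivec z)) - W (cvec (rvec z) + t *s cvec (ivec z))"
  have "?g \<i> = 0"
  proof (rule analytic_continuation[where S = UNIV and U = "range of_real" and \<xi> = 0 and f = ?g])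
    show "?g holomorphic_on UNIV" by (intro holomorphic_intros entire_line V W)
    show "0 islimpt range complex_of_real"
      unfolding islimpt_approachable
    proof (intro allI impI)
      fix e :: real assume "e > 0"
      then show "\<exists>x'\<in>range complex_of_real. x' \<noteq> 0 \<and> dist x' 0 < e"
        by (intro bexI[OF _ rangeI[where x = "e / 2"]]) (simp_all del: of_real_divide)
    qed
    fix t assume "t \<in> range complex_of_real"
    then show "?g t = 0" by (auto simp: eq cvec_scaleR[symmetric] cvec_add[symmetric])
  qed auto
  then show ?thesis by (simp add: cvec_decompose[symmetric])
qed

section \<open>Complexified rotations and the Bargmann transform\<close>

lemma complexify_eq: "complexify U z = cvec (U (rvec z)) + \<i> *s cvec (U (ivec z))"
  by (simp add: complexify_def rvec_def ivec_def)

lemma rvec_complexify: "rvec (complexify U z) = U (rvec z)"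
  and ivec_complexify: "ivec (complexify U z) = U (ivec z)"
  by (simp_all add: complexify_eq rvec_add ivec_add)

lemma complexify_cvec:
  assumes "linear U" shows "complexify U (cvec x) = cvec (U x)"
  using linear_0[OF assms] by (simp add: complexify_eq)

lemma entire_complexify:
  fixes F :: "complex ^ 'n::finite \<Rightarrow> complex"
  assumes F: "entire F" and U: "linear U"
  shows "entire (\<lambda>z. F (complexify U z))"
proof (rule entireI)
  have rl: "linear (rvec :: complex ^ 'n \<Rightarrow> _)" "linear (ivec :: complex ^ 'n \<Rightarrow> _)"
    by (rule linearI; simp add: vec_eq_iff)+
  have "continuous_on UNIV (complexify U)"
    unfolding complexify_eq[abs_def]
    by (intro continuous_intros bounded_linear.continuous_on[OF bounded_linear_cvec]
      linear_continuous_on[OF linear_conv_bounded_linear[THEN iffD1]] linear_compose[OF _ U, unfolded o_def] rl)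
  then show "continuous_on UNIV (\<lambda>z. F (complexify U z))"
    by (rule continuous_on_compose2[OF entire_continuous[OF F, of UNIV]]) simp
  fix z w :: "complex ^ 'n"
  have "complexify U (z + t *s w) = complexify U z + t *s complexify U w" for t
  proof -
    have r: "rvec (t *s w) = Re t *\<^sub>R rvec w - Im t *\<^sub>R ivec w" "ivec (t *s w) = Re t *\<^sub>R ivec w + Im t *\<^sub>R rvec w"
      by (simp_all add: vec_eq_iff)
    show ?thesis
      unfolding complexify_eq rvec_add ivec_add r linear_add[OF U] linear_diff[OF U] linear_scale[OF U]
      by (simp add: vec_eq_iff complex_eq_iff)
  qed
  then show "(\<lambda>t. F (complexify U (z + t *s w))) holomorphic_on UNIV"
    using entire_line[OF F] by simp
qed

lemma gbound_complexify:
  assumes "orthogonal_transformation U" "gbound c b M F"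
  shows "gbound c b M (\<lambda>z. F (complexify U z))"
  unfolding gbound_def
proof
  fix z
  show "cmod (F (complexify U z)) \<le> M * exp (b * (norm (ivec z))\<^sup>2 - c * (norm (rvec z))\<^sup>2)"
    using gboundD[OF assms(2), of "complexify U z"]
    by (simp add: rvec_complexify ivec_complexify orthogonal_transformation_norm[OF assms(1)])
qed

lemma gs_entire_complexify:
  assumes "orthogonal_transformation U" "F \<in> gs_entire"
  shows "(\<lambda>z. F (complexify U z)) \<in> gs_entire"
proof -
  obtain c b M where F: "entire F" "gbound c b M F" "c > 0" "b > 0"
    using assms(2) by (auto simp: gs_entire_def)
  show ?thesis
    by (rule gs_entireI[OF entire_complexify[OF F(1) orthogonal_transformation_linear[OF assms(1)]]
      gbound_complexify[OF assms(1) F(2)] F(3,4)])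
qed

lemma cpair_split: "cpair z w = of_real (rvec z \<bullet> rvec w - ivec z \<bullet> ivec w) + \<i> * of_real (rvec z \<bullet> ivec w + ivec z \<bullet> rvec w)"
  by (simp add: cpair_def inner_vec_def complex_eq_iff sum_subtractf sum.distrib)

lemma cpair_complexify:
  assumes "orthogonal_transformation U"
  shows "cpair (complexify U z) (complexify U w) = cpair z w"
  unfolding cpair_split rvec_complexify ivec_complexify
  using assms by (simp add: orthogonal_transformation_def)

text \<open>U preserves norms and the bilinear form, so rotating the parameter by U amounts to
  rotating the test variable by its inverse, the composition used in
  \<open>gs_pullback\<close>.\<close>

lemma bargmann_kernel_complexify:
  assumes U: "orthogonal_transformation U"
  shows "bargmann_kernel (complexify U z) = bargmann_kernel z \<circ> inv U"
proof
  fix y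
  have y: "U (inv U y) = y" using orthogonal_transformation_surj[OF U] by (simp add: surj_f_inv_f)
  have "norm y = norm (inv U y)" using orthogonal_transformation_norm[OF U, of "inv U y"] by (simp add: y)
  moreover have "cvec y = complexify U (cvec (inv U y))"
    by (simp add: complexify_cvec[OF orthogonal_transformation_linear[OF U]] y)
  ultimately show "bargmann_kernel (complexify U z) y = (bargmann_kernel z \<circ> inv U) y"
    by (simp add: bargmann_kernel_def cpair_complexify[OF U])
qed

lemma bargmann_complexify: "orthogonal_transformation U \<Longrightarrow> bargmann f (complexify U z) = gs_pullback U f (bargmann_kernel z)"
  by (simp add: bargmann_def gs_pullback_def bargmann_kernel_complexify)

lemma bargmann_kernel_gs_space: "bargmann_kernel z \<in> gs_space"
  unfolding bargmann_kernel_eq by (rule gs_entire_gs_space[OF bkernel_gs_entire])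

text \<open>U preserves |Re z| and |Im z|, hence every growth class, and the constant at most
  doubles. Testing this difference on kernels alone decides whether it vanishes.\<close>

lemma pullback_functional:
  assumes f: "f \<in> gs_dual" and U: "orthogonal_transformation U"
  shows "gs_functional (\<lambda>F. f (\<lambda>x. F (cvec (U x))) - f (\<lambda>x. F (cvec x)))"
proof -
  define L where "L F = f (\<lambda>x. F (cvec x))" for F
  have L: "gs_functional L" unfolding L_def by (rule gs_dual_functional[OF f])
  have eq: "f (\<lambda>x. F (cvec (U x))) - f (\<lambda>x. F (cvec x)) = L (\<lambda>z. F (complexify U z)) - L F" for F
    by (simp add: L_def complexify_cvec[OF orthogonal_transformation_linear[OF U]])
  show ?thesis
    unfolding eq gs_functional_def
  proof (intro conjI ballI allI impI)
    fix F G :: "complex ^ 'a \<Rightarrow> complex" and a b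
    assume "F \<in> gs_entire" "G \<in> gs_entire"
    then show "L (\<lambda>z. a * F (complexify U z) + b * G (complexify U z)) - L (\<lambda>z. a * F z + b * G z) =
        a * (L (\<lambda>z. F (complexify U z)) - L F) + b * (L (\<lambda>z. G (complexify U z)) - L G)"
      by (simp add: gs_functional_lincomb[OF L] gs_entire_complexify[OF U] algebra_simps)
  next
    fix c b :: real assume cb: "c > 0" "b > 0"
    obtain K where K: "K \<ge> 0" "\<And>F M. entire F \<Longrightarrow> gbound c b M F \<Longrightarrow> cmod (L F) \<le> K * M"
      using gs_functional_bounded[OF L cb] by blast
    have "cmod (L (\<lambda>z. F (complexify U z)) - L F) \<le> (2 * K) * M" if "entire F" "gbound c b M F" for F M
      using norm_triangle_ineq4[of "L (\<lambda>z. F (complexify U z))" "L F"] K(2)[OF that]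
        K(2)[OF entire_complexify[OF that(1) orthogonal_transformation_linear[OF U]] gbound_complexify[OF U that(2)]]
      by simp
    then show "\<exists>K\<ge>0. \<forall>F M. entire F \<longrightarrow> gbound c b M F \<longrightarrow> cmod (L (\<lambda>z. F (complexify U z)) - L F) \<le> K * M"
      using K(1) by (intro exI[of _ "2 * K"]) auto
  qed
qed

lemma radial_symmetric_iff_bargmann:
  assumes f: "f \<in> gs_dual"
  shows "radial_symmetric f \<longleftrightarrow>
    (\<forall>U. orthogonal_transformation U \<longrightarrow> (\<forall>z. bargmann f (complexify U z) = bargmann f z))"
proof
  assume rad: "radial_symmetric f"
  show "\<forall>U. orthogonal_transformation U \<longrightarrow> (\<forall>z. bargmann f (complexify U z) = bargmann f z)"
  proof (intro allI impI)
    fix U :: "real ^ 'a \<Rightarrow> real ^ 'a" and z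
    assume U: "orthogonal_transformation U"
    then have "gs_pullback U f (bargmann_kernel z) = f (bargmann_kernel z)"
      using rad bargmann_kernel_gs_space unfolding radial_symmetric_def by blast
    then show "bargmann f (complexify U z) = bargmann f z"
      by (simp only: bargmann_complexify[OF U]) (simp only: bargmann_def)
  qed
next
  assume inv: "\<forall>U. orthogonal_transformation U \<longrightarrow> (\<forall>z. bargmann f (complexify U z) = bargmann f z)"
  show "radial_symmetric f"
    unfolding radial_symmetric_def
  proof (intro allI impI ballI)
    fix U :: "real ^ 'a \<Rightarrow> real ^ 'a" and \<phi> :: "real ^ 'a \<Rightarrow> complex"
    assume U: "orthogonal_transformation U" and "\<phi> \<in> gs_space"
    then obtain F where F: "F \<in> gs_entire" "\<phi> = (\<lambda>x. F (cvec x))" by (meson gs_space_extension)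
    note U' = orthogonal_transformation_inv[OF U]
    \<comment> \<open>\<open>gs_pullback U\<close> composes with \<open>inv U\<close>, so the
      difference functional is taken for \<open>inv U\<close>; on kernels its vanishing is the
      invariance (2) for U itself.\<close>
    have "f (\<lambda>x. F (cvec (inv U x))) - f (\<lambda>x. F (cvec x)) = 0"
    proof (rule gs_functional_eq_0_of_kernel[OF pullback_functional[OF f U'] _ F(1)])
      fix z
      have "f (\<lambda>x. bkernel z (cvec (inv U x))) = bargmann f (complexify U z)"
        by (simp add: bargmann_complexify[OF U] gs_pullback_def bargmann_kernel_eq o_def)
      also have "\<dots> = f (\<lambda>x. bkernel z (cvec x))"
        using inv U by (simp add: bargmann_def bargmann_kernel_eq)
      finally show "f (\<lambda>x. bkernel z (cvec (inv U x))) - f (\<lambda>x. bkernel z (cvec x)) = 0" by simp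
    qed
    then show "gs_pullback U f \<phi> = f \<phi>" by (simp add: gs_pullback_def F(2) o_def)
  qed
qed

lemma entire_radial_iff:
  fixes V :: "complex ^ 'n::finite \<Rightarrow> complex"
  assumes V: "entire V"
  shows "(\<forall>U. orthogonal_transformation U \<longrightarrow> (\<forall>z. V (complexify U z) = V z)) \<longleftrightarrow>
    (\<exists>F0. F0 holomorphic_on UNIV \<and> (\<forall>z. V z = F0 (cpair z z)))"
proof
  assume "\<exists>F0. F0 holomorphic_on UNIV \<and> (\<forall>z. V z = F0 (cpair z z))"
  then show "\<forall>U. orthogonal_transformation U \<longrightarrow> (\<forall>z. V (complexify U z) = V z)"
    by (auto simp: cpair_complexify)
next
  assume inv: "\<forall>U. orthogonal_transformation U \<longrightarrow> (\<forall>z. V (complexify U z) = V z)"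
  obtain j :: 'n where True by simp
  define F where "F t = V (t *s axis j 1)" for t
  have F: "F holomorphic_on UNIV" unfolding F_def by (rule entire_ray[OF V])
  have "F (- t) = F t" for t
  proof -
    \<comment> \<open>Minus the identity is orthogonal in every dimension, so evenness on the axis
      holds for d = 1 as well.\<close>
    have "orthogonal_transformation (uminus :: real ^ 'n \<Rightarrow> real ^ 'n)"
      by (simp add: orthogonal_transformation_def linear_uminus)
    moreover have "complexify uminus (t *s axis j 1 :: complex ^ 'n) = (- t) *s axis j 1"
      by (simp add: vec_eq_iff complex_eq_iff complexify_eq)
    ultimately show ?thesis unfolding F_def using inv by metis
  qed
  then have even: "(\<lambda>t. F (- 1 * t)) = F" by auto
  have "(deriv ^^ n) F 0 = 0" if "odd n" for n
  proof -
    have "(deriv ^^ n) (\<lambda>t. F (- 1 * t)) 0 = (- 1) ^ n * (deriv ^^ n) F (- 1 * 0)"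
      by (rule higher_deriv_compose_linear[OF F, of UNIV]) auto
    then show ?thesis using that unfolding even by simp
  qed
  from even_entire_function[OF F this] obtain F0 where F0: "F0 holomorphic_on UNIV" "\<And>t. F t = F0 (t\<^sup>2)" by blast
  have "V z = F0 (cpair z z)" for z
  proof (rule entire_eqI_real[OF V entire_of_cpair[OF F0(1)]])
    fix x :: "real ^ 'n"
    \<comment> \<open>Orthogonal maps act transitively on spheres, so every real point can be moved
      onto the chosen axis, where V is F.\<close>
    have nx: "norm x = norm (norm x *\<^sub>R axis j (1 :: real))" by simp
    have "\<exists>U. orthogonal_transformation U \<and> U x = norm x *\<^sub>R axis j (1 :: real)"
      by (rule orthogonal_transformation_exists[OF nx]) blast
    then obtain U where U: "orthogonal_transformation U" "U x = norm x *\<^sub>R axis j (1 :: real)" by blast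
    have "V (cvec x) = V (complexify U (cvec x))" using inv U(1) by simp
    also have "\<dots> = F (of_real (norm x))"
      by (simp add: complexify_cvec[OF orthogonal_transformation_linear[OF U(1)]] U(2) F_def cvec_scaleR cvec_axis)
    also have "\<dots> = F0 (cpair (cvec x) (cvec x))" by (simp add: F0(2) cpair_cvec_self)
    finally show "V (cvec x) = F0 (cpair (cvec x) (cvec x))" .
  qed
  with F0(1) show "\<exists>F0. F0 holomorphic_on UNIV \<and> (\<forall>z. V z = F0 (cpair z z))" by blast
qed

section \<open>Taylor coefficients of functions of <z,z>\<close>

lemma foldr_funpow_single:
  assumes "distinct js" "i \<in> set js"
  shows "foldr (\<lambda>j. T j ^^ (if j = i then k else 0)) js F = (T i ^^ k) F"
  using assms
proof (induction js)
  case (Cons j js)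
  have "foldr (\<lambda>j. T j ^^ (if j = i then k else 0)) js F = F" if "i \<notin> set js"
    using that by (induction js) auto
  with Cons show ?case by auto
qed simp

lemma prod_evcoeff_double:
  fixes \<alpha> :: "'n::finite \<Rightarrow> nat"
  shows "(\<Prod>j\<in>UNIV. evcoeff (2 * \<alpha> j)) = of_real (mi_fact (\<lambda>j. 2 * \<alpha> j) / mi_fact \<alpha>)"
  by (simp add: evcoeff_def mi_fact_def prod_dividef)

lemma taylor_of_cpair:
  assumes "G holomorphic_on UNIV"
  shows "foldr (\<lambda>j. cpd j ^^ \<gamma> j) coords (\<lambda>z. G (cpair z z)) 0 =
    (\<Prod>j\<in>UNIV. evcoeff (\<gamma> j)) * (deriv ^^ (\<Sum>j\<in>UNIV. \<gamma> j div 2)) G 0"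
  using foldr_cpd_of_cpair[OF assms coords(1), of 0 \<gamma>] by (simp add: coords cpair_def)

text \<open>For V = G(<z,z>) the derivative of order 2\<alpha> at 0 is (2\<alpha>)!/\<alpha>! times
  the |\<alpha>|-th derivative of G at 0; by hypothesis it is sqrt((2\<alpha>)!) s(2\<alpha>). Hence
  the normalised coefficient in (4) is that derivative of G and depends on |\<alpha>| only.
  Conversely, one axis determines G, and (4) transports its coefficients to all \<alpha>.\<close>

lemma entire_radial_iff_taylor:
  fixes V :: "complex ^ 'n::finite \<Rightarrow> complex" and s :: "('n \<Rightarrow> nat) \<Rightarrow> complex"
  assumes V: "entire V" and s: "\<And>\<gamma>. foldr (\<lambda>j. cpd j ^^ \<gamma> j) coords V 0 = of_real (sqrt (mi_fact \<gamma>)) * s \<gamma>"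
  shows "(\<exists>F0. F0 holomorphic_on UNIV \<and> (\<forall>z. V z = F0 (cpair z z))) \<longleftrightarrow>
    (\<forall>\<alpha>. (\<exists>j. odd (\<alpha> j)) \<longrightarrow> s \<alpha> = 0) \<and>
    (\<forall>\<alpha> \<beta>. mi_abs \<alpha> = mi_abs \<beta> \<longrightarrow>
      of_real (mi_fact \<alpha> / sqrt (mi_fact (\<lambda>j. 2 * \<alpha> j))) * s (\<lambda>j. 2 * \<alpha> j) =
      of_real (mi_fact \<beta> / sqrt (mi_fact (\<lambda>j. 2 * \<beta> j))) * s (\<lambda>j. 2 * \<beta> j))"
    (is "?R \<longleftrightarrow> ?odd \<and> ?even")
proof -
  let ?q = "\<lambda>\<alpha>. of_real (mi_fact \<alpha> / sqrt (mi_fact (\<lambda>j. 2 * \<alpha> j))) * s (\<lambda>j. 2 * \<alpha> j)"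
  \<comment> \<open>Clears denominators using (2\<alpha>)! = sqrt((2\<alpha>)!)^2, so that (4) and
    statements about Taylor coefficients can be exchanged.\<close>
  have q_iff: "?q \<alpha> = g \<longleftrightarrow> foldr (\<lambda>j. cpd j ^^ (2 * \<alpha> j)) coords V 0 = of_real (mi_fact (\<lambda>j. 2 * \<alpha> j) / mi_fact \<alpha>) * g" for \<alpha> g
  proof -
    define A where "A = mi_fact \<alpha>"
    define B where "B = sqrt (mi_fact (\<lambda>j. 2 * \<alpha> j))"
    have pos: "A > 0" "B > 0" "mi_fact (\<lambda>j. 2 * \<alpha> j) = B * B"
      using mi_fact_pos[of \<alpha>] mi_fact_pos[of "\<lambda>j. 2 * \<alpha> j"] by (auto simp: A_def B_def)
    show ?thesis
      unfolding s[of "\<lambda>j. 2 * \<alpha> j"] A_def[symmetric] B_def[symmetric] pos(3)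
      using pos(1,2) by (auto simp: field_simps)
  qed
  have zero: "(\<Prod>j\<in>UNIV. evcoeff (\<gamma> j)) = 0" if "odd (\<gamma> j)" for \<gamma> :: "'n \<Rightarrow> nat" and j
    using that by (intro prod_zero) (auto simp: evcoeff_def)
  show ?thesis
  proof
    assume ?R
    then obtain F0 where F0: "F0 holomorphic_on UNIV" and "\<And>z. V z = F0 (cpair z z)" by blast
    then have "V = (\<lambda>z. F0 (cpair z z))" by blast
    then have t: "foldr (\<lambda>j. cpd j ^^ \<gamma> j) coords V 0 = (\<Prod>j\<in>UNIV. evcoeff (\<gamma> j)) * (deriv ^^ (\<Sum>j\<in>UNIV. \<gamma> j div 2)) F0 0" for \<gamma>
      by (simp add: taylor_of_cpair[OF F0])
    have ?odd
    proof (intro allI impI)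
      fix \<alpha> :: "'n \<Rightarrow> nat" assume "\<exists>j. odd (\<alpha> j)"
      then have "of_real (sqrt (mi_fact \<alpha>)) * s \<alpha> = 0" using zero t[of \<alpha>] s[of \<alpha>] by auto
      then show "s \<alpha> = 0" using mi_fact_pos[of \<alpha>] by simp
    qed
    moreover have "?q \<alpha> = (deriv ^^ mi_abs \<alpha>) F0 0" for \<alpha>
      unfolding q_iff t[of "\<lambda>j. 2 * \<alpha> j"] prod_evcoeff_double by (simp add: mi_abs_def)
    ultimately show "?odd \<and> ?even" by simp
  next
    assume "?odd \<and> ?even"
    then have odd: ?odd and ev: ?even by blast+
    obtain i :: 'n where True by simp
    define F where "F t = V (t *s axis i 1)" for t
    have F: "F holomorphic_on UNIV" unfolding F_def by (rule entire_ray[OF V])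
    have dF: "(deriv ^^ k) F 0 = foldr (\<lambda>j. cpd j ^^ (if j = i then k else 0)) coords V 0" for k
    proof -
      have "(deriv ^^ k) F 0 = (cpd i ^^ k) V 0"
        unfolding F_def using higher_deriv_line[OF V, of k 0 "axis i 1" 0] by simp
      then show ?thesis by (simp add: foldr_funpow_single coords)
    qed
    have "(deriv ^^ k) F 0 = 0" if "odd k" for k
    proof -
      have "\<exists>j. odd (if j = i then k else 0)" using that by (intro exI[of _ i]) simp
      then have "s (\<lambda>j. if j = i then k else 0) = 0" by (rule odd[THEN spec, THEN mp])
      then show ?thesis unfolding dF s by simp
    qed
    from even_entire_function[OF F this] obtain F0 where F0: "F0 holomorphic_on UNIV" "\<And>t. F t = F0 (t\<^sup>2)" by blast
    have q: "?q \<alpha> = (deriv ^^ mi_abs \<alpha>) F0 0" for \<alpha>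
    proof -
      define n where "n = mi_abs \<alpha>"
      \<comment> \<open>The representative of degree n concentrated on axis i, whose coefficient can
        be read off F.\<close>
      let ?\<beta> = "\<lambda>j. if j = i then n else 0"
      have \<beta>: "mi_abs ?\<beta> = n" "mi_fact ?\<beta> = fact n" "mi_fact (\<lambda>j. 2 * ?\<beta> j) = fact (2 * n)"
      proof -
        show "mi_abs ?\<beta> = n" by (simp add: mi_abs_def)
        have "mi_fact ?\<beta> = (\<Prod>j\<in>UNIV. if j = i then fact n else 1)"
          unfolding mi_fact_def by (intro prod.cong) auto
        then show "mi_fact ?\<beta> = fact n" by simp
        have "mi_fact (\<lambda>j. 2 * ?\<beta> j) = (\<Prod>j\<in>UNIV. if j = i then fact (2 * n) else 1)"
          unfolding mi_fact_def by (intro prod.cong) auto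
        then show "mi_fact (\<lambda>j. 2 * ?\<beta> j) = fact (2 * n)" by simp
      qed
      have two: "(\<lambda>j. 2 * ?\<beta> j) = (\<lambda>j. if j = i then 2 * n else 0)" by auto
      have "F = (\<lambda>t. F0 (0 + t\<^sup>2))" using F0(2) by auto
      then have "(deriv ^^ (2 * n)) F 0 = fact (2 * n) / fact n * (deriv ^^ n) F0 0"
        using higher_deriv_quadratic[OF F0(1), of "2 * n" 0] by (simp add: evcoeff_def)
      then have "(deriv ^^ (2 * n)) F 0 = of_real (mi_fact (\<lambda>j. 2 * ?\<beta> j) / mi_fact ?\<beta>) * (deriv ^^ n) F0 0"
        unfolding \<beta> by simp
      moreover have "foldr (\<lambda>j. cpd j ^^ (2 * ?\<beta> j)) coords V 0 = (deriv ^^ (2 * n)) F 0"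
        unfolding dF fun_cong[OF two] ..
      ultimately have "foldr (\<lambda>j. cpd j ^^ (2 * ?\<beta> j)) coords V 0 = of_real (mi_fact (\<lambda>j. 2 * ?\<beta> j) / mi_fact ?\<beta>) * (deriv ^^ n) F0 0"
        by (rule trans[rotated])
      then have "?q ?\<beta> = (deriv ^^ n) F0 0" unfolding q_iff .
      moreover have "mi_abs \<alpha> = mi_abs ?\<beta>" by (rule trans[OF n_def[symmetric] \<beta>(1)[symmetric]])
      then have "?q \<alpha> = ?q ?\<beta>" by (rule ev[THEN spec, THEN spec, THEN mp])
      ultimately show ?thesis unfolding n_def by (rule trans[rotated])
    qed
    have "V z = F0 (cpair z z)" for z
    proof (rule entire_eqI_at_0[OF V entire_of_cpair[OF F0(1)]])
      fix \<gamma> :: "'n \<Rightarrow> nat"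
      show "foldr (\<lambda>j. cpd j ^^ \<gamma> j) coords V 0 = foldr (\<lambda>j. cpd j ^^ \<gamma> j) coords (\<lambda>z. F0 (cpair z z)) 0"
      proof (cases "\<exists>j. odd (\<gamma> j)")
        case True
        then show ?thesis using zero odd by (auto simp: s taylor_of_cpair[OF F0(1)])
      next
        case False
        define \<alpha> where "\<alpha> j = \<gamma> j div 2" for j
        have \<gamma>: "\<gamma> = (\<lambda>j. 2 * \<alpha> j)" using False by (auto simp: \<alpha>_def)
        have "foldr (\<lambda>j. cpd j ^^ (2 * \<alpha> j)) coords V 0 = of_real (mi_fact (\<lambda>j. 2 * \<alpha> j) / mi_fact \<alpha>) * (deriv ^^ mi_abs \<alpha>) F0 0"
          using q[of \<alpha>] unfolding q_iff .
        then show ?thesis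
          unfolding \<gamma> taylor_of_cpair[OF F0(1)] prod_evcoeff_double by (simp add: mi_abs_def)
      qed
    qed
    with F0(1) show ?R by blast
  qed
qed

theorem theorem3p1:
  fixes f :: "(real ^ 'n::finite \<Rightarrow> complex) \<Rightarrow> complex"
  assumes "f \<in> gs_dual"
  shows "(radial_symmetric f \<longleftrightarrow>
            (\<forall>U. orthogonal_transformation U \<longrightarrow>
               (\<forall>z. bargmann f (complexify U z) = bargmann f z))) \<and>
         ((\<forall>U. orthogonal_transformation U \<longrightarrow>
               (\<forall>z. bargmann f (complexify U z) = bargmann f z)) \<longleftrightarrow>
            (\<exists>F0 :: complex \<Rightarrow> complex. F0 holomorphic_on UNIV \<and>
               (\<forall>z. bargmann f z = F0 (cpair z z)))) \<and>
         ((\<exists>F0 :: complex \<Rightarrow> complex. F0 holomorphic_on UNIV \<and>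
               (\<forall>z. bargmann f z = F0 (cpair z z))) \<longleftrightarrow>
            (\<forall>\<alpha>. (\<exists>j. odd (\<alpha> j)) \<longrightarrow> gs_scalar f (hermite \<alpha>) = 0) \<and>
            (\<forall>\<alpha> \<beta>. mi_abs \<alpha> = mi_abs \<beta> \<longrightarrow>
               of_real (mi_fact \<alpha> / sqrt (mi_fact (\<lambda>j. 2 * \<alpha> j))) * gs_scalar f (hermite (\<lambda>j. 2 * \<alpha> j)) =
               of_real (mi_fact \<beta> / sqrt (mi_fact (\<lambda>j. 2 * \<beta> j))) * gs_scalar f (hermite (\<lambda>j. 2 * \<beta> j))))"
  unfolding radial_symmetric_iff_bargmann[OF assms] entire_radial_iff[OF bargmann_entire(1)[OF assms]]
    entire_radial_iff_taylor[OF bargmann_entire[OF assms]]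
  by blast

end
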